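(* There exist a constant $\theta\in(0,1)$ and, for any $\alpha\in(0,1)$, a constant $C>0$ such that $$\|\mathcal{P}^n\psi-\phi\|_{L^1(\mathfrak{m})}\le C\|\psi\|_\alpha\,\theta^{\alpha n}$$ for all $n\ge0$ and all probability densities $\psi\in C^\alpha$. Moreover, $$\left|\int f\cdot\mathcal{Q}^ng\,d\mu-\int f\,d\mu\int g\,d\mu\right|\le C\|f\|_\alpha\|g\|_\infty\,\theta^{\alpha n}$$ for all $n\ge0$ and all complex-valued functions $f\in C^\alpha$ and $g\in L^\infty$.
   Context: Let $\mathbb{S}$ be the circle obtained by identifying the endpoints of $[0,1]$, with its usual metric $d$ and Lebesgue measure $\mathfrak{m}$. For $\alpha\in(0,1)$, $C^\alpha$ is the set of (real- or complex-valued) functions on $\mathbb{S}$ that are Hölder continuous with exponent $\alpha$; $|f|_\alpha$ is the Hölder constant and $\|f\|_\alpha=|f|_\alpha+\|f\|_\infty$. Let $(\Omega,\mathcal{F},\eta)$ be a probability space and, for each $\omega_1\in\Omega$, let $T_{\omega_1}:\mathbb{S}\to\mathbb{S}$ be a $C^2$ map without critical points ($T_{\omega_1}'\neq 0$ everywhere), such that $\Omega\times\mathbb{S}\to\mathbb{S}:(\omega_1,x)\mapsto T_{\omega_1}x$ is measurable. Put $\lambda_{\omega_1}=\inf|T_{\omega_1}'|$ and $\Delta_{\omega_1}=\|T_{\omega_1}''/(T_{\omega_1}')^2\|_\infty$, and for measurable $h:\Omega\to\mathbb{R}$ write $\langle h\rangle=\int h_{\omega_1}\,d\eta(\omega_1)$.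 Standing assumption: $\langle\lambda^{-2}\rangle<1$ and $\langle\Delta^2\rangle<\infty$. The transfer operator of $T_{\omega_1}$ is $\mathcal{L}_{\omega_1}g(x)=\sum_{y\in T_{\omega_1}^{-1}\{x\}}g(y)/|T_{\omega_1}'(y)|$ on $L^1(\mathfrak{m})$. Define $\mathcal{P}g(x)=\int\mathcal{L}_{\omega_1}g(x)\,d\eta(\omega_1)$ for $g\in L^1(\mathfrak{m})$ and $\mathcal{Q}f(x)=\int_\Omega f(T_{\omega_1}x)\,d\eta(\omega_1)$ for bounded measurable $f$. Let $\mu$, with $d\mu=\phi\,d\mathfrak{m}$, be the absolutely continuous stationary probability distribution (i.e. $\int\mathcal{Q}f\,d\mu=\int f\,d\mu$ for all bounded measurable $f$, equivalently $\mathcal{P}\phi=\phi$) whose density $\phi$ is Lipschitz continuous and bounded away from zero; such a distribution exists under the standing assumption. Probability densities are with respect to $\mathfrak{m}$. *)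

theory Defs
  imports "HOL-Probability.Probability"
begin

text \<open>Each class of the circle is represented by its unique point in the half-open
  unit interval.\<close>

typedef circle = "{0..<1::real}" morphisms circle_coord Abs_circle
  by (rule exI[of _ 0]) simp

definition circle_proj :: "real \<Rightarrow> circle" where
  "circle_proj x = Abs_circle (frac x)"

instantiation circle :: metric_space
begin

definition dist_circle :: "circle \<Rightarrow> circle \<Rightarrow> real" where
  "dist_circle p q = (let t = \<bar>circle_coord p - circle_coord q\<bar> in min t (1 - t))"

definition uniformity_circle :: "(circle \<times> circle) filter" where
  "uniformity_circle = (INF e\<in>{0 <..}. principal {(x, y). dist x y < e})"

definition open_circle :: "circle set \<Rightarrow> bool" where
  "open_circle U \<longleftrightarrow> (\<forall>x\<in>U. eventually (\<lambda>(x', y). x' = x \<longrightarrow> y \<in> U) uniformity)"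

instance
proof
  fix x y z :: circle
  have bds: "0 \<le> circle_coord p" "circle_coord p < 1" for p
    using circle_coord[of p] by auto
  show "dist x y = 0 \<longleftrightarrow> x = y"
    using bds[of x] bds[of y] circle_coord_inject[of x y]
    by (auto simp: dist_circle_def Let_def min_def split: if_splits)
  show "dist x y \<le> dist x z + dist y z"
    using bds[of x] bds[of y] bds[of z] by (simp add: dist_circle_def Let_def)
qed (simp_all add: uniformity_circle_def open_circle_def)

end

definition circle_measure :: "circle measure" where
  "circle_measure = distr (restrict_space lborel {0..<1}) borel Abs_circle"

text \<open>Derivatives of circle maps are taken in the charts given by local inverses of
  \<open>circle_proj\<close>. The function \<open>F\<close> is only required to lift \<open>T\<close> pointwise; being
  differentiable at the base point, it is continuous there, and any two lifts continuous
  at a point differ by a constant integer near it, so \<open>D\<close> is unique.\<close>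

definition has_circle_derivative :: "(circle \<Rightarrow> circle) \<Rightarrow> real \<Rightarrow> circle \<Rightarrow> bool" where
  "has_circle_derivative T D p \<longleftrightarrow>
     (\<exists>F. (\<forall>x. circle_proj (F x) = T (circle_proj x)) \<and>
          (F has_real_derivative D) (at (circle_coord p)))"

definition circle_deriv :: "(circle \<Rightarrow> circle) \<Rightarrow> circle \<Rightarrow> real" where
  "circle_deriv T p = (THE D. has_circle_derivative T D p)"

definition circle_deriv2 :: "(circle \<Rightarrow> circle) \<Rightarrow> circle \<Rightarrow> real" where
  "circle_deriv2 T p = deriv (\<lambda>x. circle_deriv T (circle_proj x)) (circle_coord p)"

definition C2_circle_map :: "(circle \<Rightarrow> circle) \<Rightarrow> bool" where
  "C2_circle_map T \<longleftrightarrow>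
     (\<forall>p. \<exists>D. has_circle_derivative T D p) \<and>
     (\<forall>p. (\<lambda>x. circle_deriv T (circle_proj x)) field_differentiable at (circle_coord p)) \<and>
     continuous_on UNIV (circle_deriv2 T)"

definition min_expansion :: "(circle \<Rightarrow> circle) \<Rightarrow> real" where
  "min_expansion T = (INF p. \<bar>circle_deriv T p\<bar>)"

definition distortion :: "(circle \<Rightarrow> circle) \<Rightarrow> real" where
  "distortion T = (SUP p. \<bar>circle_deriv2 T p / (circle_deriv T p)\<^sup>2\<bar>)"

definition transfer_op ::
  "(circle \<Rightarrow> circle) \<Rightarrow> (circle \<Rightarrow> 'b::real_normed_vector) \<Rightarrow> circle \<Rightarrow> 'b" where
  "transfer_op T g x = (\<Sum>y\<in>T -` {x}. g y /\<^sub>R \<bar>circle_deriv T y\<bar>)"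

definition annealed_transfer_op ::
  "'w measure \<Rightarrow> ('w \<Rightarrow> circle \<Rightarrow> circle) \<Rightarrow>
     (circle \<Rightarrow> 'b::{banach, second_countable_topology}) \<Rightarrow> circle \<Rightarrow> 'b" where
  "annealed_transfer_op \<eta> T g x = (\<integral>\<omega>. transfer_op (T \<omega>) g x \<partial>\<eta>)"

definition annealed_koopman_op ::
  "'w measure \<Rightarrow> ('w \<Rightarrow> circle \<Rightarrow> circle) \<Rightarrow>
     (circle \<Rightarrow> 'b::{banach, second_countable_topology}) \<Rightarrow> circle \<Rightarrow> 'b" where
  "annealed_koopman_op \<eta> T f x = (\<integral>\<omega>. f (T \<omega> x) \<partial>\<eta>)"

definition holder_on_circle :: "real \<Rightarrow> (circle \<Rightarrow> 'b::real_normed_vector) \<Rightarrow> bool" where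
  "holder_on_circle \<alpha> f \<longleftrightarrow> (\<exists>K. \<forall>x y. norm (f x - f y) \<le> K * dist x y powr \<alpha>)"

definition holder_const :: "real \<Rightarrow> (circle \<Rightarrow> 'b::real_normed_vector) \<Rightarrow> real" where
  "holder_const \<alpha> f = Sup {norm (f x - f y) / dist x y powr \<alpha> | x y. x \<noteq> y}"

definition holder_norm :: "real \<Rightarrow> (circle \<Rightarrow> 'b::real_normed_vector) \<Rightarrow> real" where
  "holder_norm \<alpha> f = holder_const \<alpha> f + (SUP x. norm (f x))"

text \<open>Elements of the space of essentially bounded functions are represented by Borel
  functions. Such a function may be unbounded on a null set, so the averaging operator
  \<open>annealed_koopman_op\<close> is then determined almost everywhere only.\<close>

definition ess_bounded :: "(circle \<Rightarrow> 'b::real_normed_vector) \<Rightarrow> bool" where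
  "ess_bounded g \<longleftrightarrow> g \<in> borel_measurable circle_measure \<and>
     (\<exists>B. AE x in circle_measure. norm (g x) \<le> B)"

definition linf_norm :: "(circle \<Rightarrow> 'b::real_normed_vector) \<Rightarrow> real" where
  "linf_norm g = real_of_ereal (esssup circle_measure (\<lambda>x. ereal (norm (g x))))"

definition prob_density :: "(circle \<Rightarrow> real) \<Rightarrow> bool" where
  "prob_density \<psi> \<longleftrightarrow> integrable circle_measure \<psi> \<and> (\<forall>x. 0 \<le> \<psi> x) \<and>
     (\<integral>x. \<psi> x \<partial>circle_measure) = 1"

definition stationary ::
  "'w measure \<Rightarrow> ('w \<Rightarrow> circle \<Rightarrow> circle) \<Rightarrow> circle measure \<Rightarrow> bool" where
  "stationary \<eta> T \<mu> \<longleftrightarrow>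
     (\<forall>f::circle \<Rightarrow> real. f \<in> borel_measurable borel \<longrightarrow> bounded (range f) \<longrightarrow>
        (\<integral>x. annealed_koopman_op \<eta> T f x \<partial>\<mu>) = (\<integral>x. f x \<partial>\<mu>))"

lemma circle_proj_eq_iff: "circle_proj x = circle_proj y \<longleftrightarrow> x - y \<in> \<int>"
proof -
  have "circle_proj x = circle_proj y \<longleftrightarrow> frac x = frac y"
    unfolding circle_proj_def by (rule Abs_circle_inject) (auto simp: frac_lt_1)
  also have "\<dots> \<longleftrightarrow> x - y \<in> \<int>"
  proof
    assume "frac x = frac y"
    then have "x - y = of_int (\<lfloor>x\<rfloor> - \<lfloor>y\<rfloor>)" by (simp add: frac_def)
    then show "x - y \<in> \<int>" by (metis Ints_of_int)
  next
    assume "x - y \<in> \<int>"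
    then obtain k where "x - y = of_int k" by (rule Ints_cases)
    then have "x = y + of_int k" by simp
    then show "frac x = frac y" by (simp add: frac_def)
  qed
  finally show ?thesis .
qed

lemma has_circle_derivative_unique:
  assumes "has_circle_derivative T D p" "has_circle_derivative T E p"
  shows "D = E"
proof -
  define a where "a = circle_coord p"
  obtain F where F: "\<And>x. circle_proj (F x) = T (circle_proj x)"
    and FD: "(F has_real_derivative D) (at a)"
    using assms(1) by (auto simp: has_circle_derivative_def a_def)
  obtain G where G: "\<And>x. circle_proj (G x) = T (circle_proj x)"
    and GE: "(G has_real_derivative E) (at a)"
    using assms(2) by (auto simp: has_circle_derivative_def a_def)
  have int: "F x - G x \<in> \<int>" for x
    using F[of x] G[of x] by (simp flip: circle_proj_eq_iff)
  have der: "((\<lambda>x. F x - G x) has_real_derivative (D - E)) (at a)"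
    by (rule DERIV_diff[OF FD GE])
  then have "isCont (\<lambda>x. F x - G x) a" by (rule DERIV_isCont)
  then have "((\<lambda>x. F x - G x) \<longlongrightarrow> F a - G a) (nhds a)"
    using tendsto_at_iff_tendsto_nhds[of "\<lambda>x. F x - G x" a] by (simp add: isCont_def)
  then have "eventually (\<lambda>x. dist (F x - G x) (F a - G a) < 1) (nhds a)"
    by (rule tendstoD) simp
  then have "eventually (\<lambda>x. F x - G x = F a - G a) (nhds a)"
  proof eventually_elim
    case (elim x)
    then show ?case
      using Ints_eq_abs_less1[OF int[of x] int[of a]] by (simp add: dist_real_def)
  qed
  from DERIV_cong_ev[OF refl this refl] der
  have "((\<lambda>x. F a - G a) has_real_derivative (D - E)) (at a)"
    by simp
  from DERIV_unique[OF this DERIV_const] show "D = E" by simp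
qed

lemma dist_circle_proj:
  "\<bar>x - y\<bar> \<le> 1/2 \<Longrightarrow> dist (circle_proj x) (circle_proj y) = \<bar>x - y\<bar>"
proof -
  assume a: "\<bar>x - y\<bar> \<le> 1/2"
  have c: "circle_coord (circle_proj z) = frac z" for z
    unfolding circle_proj_def by (rule Abs_circle_inverse) (auto simp: frac_lt_1)
  define k where "k = \<lfloor>x\<rfloor> - \<lfloor>y\<rfloor>"
  have f: "frac x - frac y = x - y - of_int k" by (simp add: frac_def k_def)
  have b: "\<bar>x - y - of_int k\<bar> < 1"
    unfolding f[symmetric]
    using frac_ge_0[of x] frac_lt_1[of x] frac_ge_0[of y] frac_lt_1[of y] by linarith
  then have "k = 0 \<or> k = 1 \<or> k = -1" using a by linarith
  then show ?thesis
    unfolding dist_circle_def c Let_def f min_def using a b by (elim disjE) simp_all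
qed

lemma Abs_circle_measurable: "Abs_circle \<in> restrict_space lborel {0..<1} \<rightarrow>\<^sub>M borel"
proof -
  have d: "dist (Abs_circle x) (Abs_circle y) \<le> dist x y" if "x \<in> {0..<1}" "y \<in> {0..<1}" for x y :: real
    using that by (simp add: dist_circle_def Abs_circle_inverse dist_real_def Let_def)
  then have "continuous_on {0..<1} Abs_circle"
    unfolding continuous_on_iff by (meson le_less_trans)
  then show ?thesis 
    using borel_measurable_continuous_on_restrict
    by (simp cong: measurable_cong_sets sets_restrict_space_cong)
qed

lemma prob_space_circle_measure: "prob_space circle_measure"
  unfolding circle_measure_def
  by (rule prob_space.prob_space_distr[OF _ Abs_circle_measurable])
     (rule prob_spaceI, simp add: emeasure_restrict_space)

end

theory Submission
  imports Defs
begin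

text \<open>The averaged transfer operator \<open>P\<close> is the adjoint of the averaged composition operator \<open>Q\<close>,
  and both estimates express that \<open>P\<close> contracts mean-zero functions exponentially fast in
  \<open>L\<^sup>1\<close>, up to a measure of their roughness. The proof has four ideas.

  Roughness is a weak form of total variation: \<open>variation_le V g\<close> means that
  \<open>\<integral> g k' \<le> V sup \<bar>k\<bar>\<close> for all \<open>C\<^sup>1\<close> functions \<open>k\<close>. By duality, the variation of a transferred
  function only involves \<open>k' \<circ> T = (k \<circ> T / T')' + (k \<circ> T) T'' / (T')\<^sup>2\<close>. So one map multiplies the
  variation by at most \<open>1/\<lambda>\<close> and adds at most \<open>\<Delta> \<integral> \<bar>g\<bar>\<close>
  (\<open>test_integral_pullback_le\<close>). Averaging gives a Lasota-Yorke inequality for \<open>P\<close>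
  (\<open>variation_P\<close>), with a factor below 1 because \<open>1/\<lambda> \<le> (1 + 1/\<lambda>\<^sup>2)/2\<close>. No inverse branch
  is differentiated, and nothing is differentiated under an integral over the maps.

  A continuous density of variation at most \<open>B\<close> is at least \<open>1/2\<close> on some arc whose length depends
  on \<open>B\<close> only (\<open>arc_with_half_mass\<close>). With positive probability a map expands by a factor
  \<open>l > 1\<close> and has derivative at most \<open>M\<close>; enough such maps in a row stretch the arc over
  the whole circle (\<open>arcs_spread\<close>). Hence \<open>(P ^^ N) g \<ge> \<epsilon>\<close> with \<open>\<epsilon>\<close> and \<open>N\<close> independent of the
  density (\<open>P_iterate_positive\<close>).

  Now any two such densities can be coupled: after \<open>N\<close> steps both contain the constant \<open>\<epsilon>\<close>,
  which cancels in the difference. By the Lasota-Yorke inequality the rescaled remainders are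
  again densities of variation at most \<open>B\<close> (\<open>coupling_step\<close>), so the \<open>L\<^sup>1\<close> distance shrinks by the
  factor \<open>1 - \<epsilon>\<close> every \<open>N\<close> steps (\<open>regular_densities_merge\<close>). A mean-zero function of
  bounded variation is a multiple of a difference of two such densities (\<open>mean_zero_decay\<close>).

  Finally a Hoelder function is averaged over arcs of length \<open>s\<close>. This costs \<open>s\<^sup>\<alpha>\<close> in \<open>L\<^sup>1\<close> and
  produces variation of order \<open>1/s\<close>; taking \<open>s\<close> exponentially small in \<open>n\<close> balances the two
  (\<open>holder_decay_exists\<close>). The theorem follows by applying this to \<open>\<psi> - \<phi>\<close> and to
  \<open>f \<phi> - (\<integral> f \<phi>) \<phi>\<close>, which are Hoelder with mean zero, since \<open>P \<phi> = \<phi>\<close>. The sup norm of \<open>g\<close>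
  enters the correlation bound only through \<open>\<integral> u (Q ^^ n) g = \<integral> ((P ^^ n) u) g\<close>.\<close>

section \<open>The circle as a quotient of the line\<close>

lemma circle_coord_bounds: "0 \<le> circle_coord p" "circle_coord p < 1"
  using circle_coord[of p] by auto

lemma circle_coord_proj [simp]: "circle_coord (circle_proj x) = frac x"
  unfolding circle_proj_def by (rule Abs_circle_inverse) (auto simp: frac_lt_1)

lemma circle_proj_coord [simp]: "circle_proj (circle_coord p) = p"
  using circle_coord_bounds[of p]
  by (simp add: circle_proj_def frac_eq[THEN iffD2] circle_coord_inverse)

lemma circle_proj_add_int [simp]: "circle_proj (x + of_int k) = circle_proj x"
  by (simp add: circle_proj_eq_iff)

lemma circle_proj_add_one [simp]: "circle_proj (x + 1) = circle_proj x"
  using circle_proj_add_int[of x 1] by simp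

lemma surj_circle_proj: "\<exists>x. p = circle_proj x"
  by (metis circle_proj_coord)

lemma dist_circle_le_half: "dist (p::circle) q \<le> 1/2"
  by (simp add: dist_circle_def Let_def min_def)

lemma dist_circle_proj_le: "dist (circle_proj x) (circle_proj y) \<le> \<bar>x - y\<bar>"
  using dist_circle_proj[of x y] dist_circle_le_half[of "circle_proj x" "circle_proj y"]
  by (cases "\<bar>x - y\<bar> \<le> 1/2") auto

text \<open>Distances on the circle are realised in the chart: every point has a lift that is as close to a
  given real number as the two points are on the circle.\<close>

lemma near_representative:
  obtains y where "circle_proj y = q" "\<bar>x - y\<bar> = dist (circle_proj x) q"
proof -
  define s where "s = x - circle_coord q"
  define y where "y = circle_coord q + of_int (round s)"
  have "circle_proj y = q" by (simp add: y_def)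
  moreover have "\<bar>x - y\<bar> \<le> 1/2"
    using of_int_round_abs_le[of s] by (simp add: y_def s_def abs_if split: if_splits)
  ultimately show ?thesis using dist_circle_proj[of x y] that by metis
qed

lemma dist_circle_proj_ge:
  assumes "e \<le> \<bar>x - y\<bar>" "\<bar>x - y\<bar> \<le> 1 - e"
  shows "e \<le> dist (circle_proj x) (circle_proj y)"
proof -
  obtain z where z: "circle_proj z = circle_proj y" "\<bar>x - z\<bar> = dist (circle_proj x) (circle_proj y)"
    using near_representative[of "circle_proj y" x] by metis
  obtain k :: int where k: "z - y = of_int k" using z(1) by (auto simp: circle_proj_eq_iff elim: Ints_cases)
  have "k = 0 \<or> real_of_int k \<ge> 1 \<or> real_of_int k \<le> -1" by linarith
  then show ?thesis using assms z(2) k by (elim disjE) linarith+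
qed

lemma continuous_on_circle_proj: "continuous_on S circle_proj"
  unfolding continuous_on_iff dist_real_def
  by (metis dist_circle_proj_le le_less_trans)

lemma continuous_on_lift:
  fixes g :: "circle \<Rightarrow> 'b::metric_space"
  assumes "continuous_on UNIV g"
  shows "continuous_on S (\<lambda>x. g (circle_proj x))"
  by (rule continuous_on_compose2[OF assms continuous_on_circle_proj]) auto

lemma continuous_on_circleI:
  fixes g :: "circle \<Rightarrow> 'b::metric_space"
  assumes "\<And>x. isCont (\<lambda>x. g (circle_proj x)) x"
  shows "continuous_on UNIV g"
  unfolding continuous_on_iff
proof (intro ballI allI impI)
  fix p :: circle and e :: real assume "0 < e"
  obtain x where x: "p = circle_proj x" using surj_circle_proj by blast
  obtain d where d: "d > 0" "\<And>y. dist y x < d \<Longrightarrow> dist (g (circle_proj y)) (g (circle_proj x)) < e"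
    using assms[of x] \<open>0 < e\<close> unfolding continuous_at_eps_delta by (metis)
  show "\<exists>d>0. \<forall>q\<in>UNIV. dist q p < d \<longrightarrow> dist (g q) (g p) < e"
  proof (intro exI[of _ d] conjI d(1) ballI impI)
    fix q assume "dist q p < d"
    obtain y where y: "circle_proj y = q" "\<bar>x - y\<bar> = dist (circle_proj x) q"
      by (rule near_representative)
    have "dist y x < d" using y \<open>dist q p < d\<close> x by (simp add: dist_real_def abs_minus_commute dist_commute)
    from d(2)[OF this] show "dist (g q) (g p) < e" by (simp add: y x)
  qed
qed

lemma compact_circle: "compact (UNIV :: circle set)"
proof -
  have "(UNIV :: circle set) = circle_proj ` {0..1}"
    using circle_coord_bounds circle_proj_coord by (metis UNIV_eq_I atLeastAtMost_iff image_eqI less_imp_le)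
  then show ?thesis
    by (metis compact_continuous_image continuous_on_circle_proj compact_Icc)
qed

lemma continuous_on_circle_bounded:
  fixes g :: "circle \<Rightarrow> real"
  assumes "continuous_on UNIV g"
  obtains B where "B > 0" "\<And>p. \<bar>g p\<bar> \<le> B"
proof -
  have "bounded (range g)"
    by (intro compact_imp_bounded compact_continuous_image[OF assms compact_circle])
  then show ?thesis using that unfolding bounded_pos by auto
qed

lemma circle_proj_measurable [measurable]: "circle_proj \<in> borel_measurable borel"
  by (intro borel_measurable_continuous_onI continuous_on_circle_proj)

text \<open>The coordinate jumps at the base point, so it is not continuous; but it is lower
  semicontinuous, hence Borel.\<close>

lemma circle_coord_measurable [measurable]: "circle_coord \<in> borel_measurable borel"
proof (rule borel_measurable_iff_greater[THEN iffD2], intro allI)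
  fix a :: real
  have "{p. a < circle_coord p} = UNIV" if "a < 0"
    using that circle_coord_bounds(1) by (auto intro: less_le_trans)
  moreover have "open {p. a < circle_coord p}" if "a \<ge> 0"
  proof (rule openI)
    fix p assume p: "p \<in> {p. a < circle_coord p}"
    define e where "e = min (circle_coord p - a) (1 - circle_coord p)"
    have "e > 0" using p circle_coord_bounds(2)[of p] by (simp add: e_def)
    moreover have "ball p e \<subseteq> {p. a < circle_coord p}"
    proof
      fix q assume "q \<in> ball p e"
      then have "dist p q < e" by simp
      then show "q \<in> {p. a < circle_coord p}"
        using circle_coord_bounds[of q] p that
        unfolding dist_circle_def Let_def min_def e_def by (auto split: if_splits simp: abs_if)
    qed
    ultimately show "\<exists>e>0. ball p e \<subseteq> {p. a < circle_coord p}" by blast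
  qed
  ultimately have "{p. a < circle_coord p} \<in> sets borel"
    by (cases "a < 0") auto
  then show "{w \<in> space borel. a < circle_coord w} \<in> sets borel" by simp
qed

text \<open>Measurability of the metric on pairs is obtained from the coordinates, which avoids any
  appeal to second countability of the circle.\<close>

lemma dist_circle_measurable [measurable (raw)]:
  fixes f g :: "'a \<Rightarrow> circle"
  assumes [measurable]: "f \<in> borel_measurable M" "g \<in> borel_measurable M"
  shows "(\<lambda>x. dist (f x) (g x)) \<in> borel_measurable M"
  unfolding dist_circle_def Let_def by measurable

lemma sets_circle_measure [measurable_cong, simp]: "sets circle_measure = sets borel"
  and space_circle_measure [simp]: "space circle_measure = UNIV"
  by (simp_all add: circle_measure_def)

interpretation circle: prob_space circle_measure
  by (rule prob_space_circle_measure)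

lemma nn_integral_translate:
  fixes f :: "real \<Rightarrow> ennreal"
  assumes "f \<in> borel_measurable borel"
  shows "(\<integral>\<^sup>+x. f x \<partial>lborel) = (\<integral>\<^sup>+x. f (x + c) \<partial>lborel)"
  using nn_integral_real_affine[OF assms, of 1 c] by (simp add: add.commute)

lemma nn_integral_circle:
  fixes f :: "circle \<Rightarrow> ennreal"
  assumes [measurable]: "f \<in> borel_measurable borel"
  shows "(\<integral>\<^sup>+p. f p \<partial>circle_measure) = (\<integral>\<^sup>+x. f (circle_proj x) * indicator {a..<a+1} x \<partial>lborel)"
proof -
  define n s where "n = \<lfloor>a\<rfloor>" and "s = frac a"
  have a: "a = of_int n + s" by (simp add: n_def s_def frac_def)
  have s: "0 \<le> s" "s < 1" by (auto simp: s_def frac_lt_1)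
  let ?G = "\<lambda>A x. f (circle_proj x) * indicator A x :: ennreal"
  have shift: "(\<integral>\<^sup>+x. ?G {u + of_int k..<v + of_int k} x \<partial>lborel) = (\<integral>\<^sup>+x. ?G {u..<v} x \<partial>lborel)" for u v k
    by (subst nn_integral_translate[where c = "of_int k"])
       (auto intro!: nn_integral_cong simp: indicator_def)
  have "(\<integral>\<^sup>+p. f p \<partial>circle_measure) = (\<integral>\<^sup>+x. ?G {0..<1} x \<partial>lborel)"
    unfolding circle_measure_def
    by (subst nn_integral_distr[OF Abs_circle_measurable])
       (auto simp: nn_integral_restrict_space indicator_def circle_proj_def frac_eq[THEN iffD2] intro!: nn_integral_cong)
  also have "\<dots> = (\<integral>\<^sup>+x. ?G {0..<s} x + ?G {s..<1} x \<partial>lborel)"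
    using s by (intro nn_integral_cong) (auto simp: indicator_def)
  also have "\<dots> = (\<integral>\<^sup>+x. ?G {0..<s} x \<partial>lborel) + (\<integral>\<^sup>+x. ?G {s..<1} x \<partial>lborel)"
    by (rule nn_integral_add) auto
  also have "\<dots> = (\<integral>\<^sup>+x. ?G {0 + of_int (n+1)..<s + of_int (n+1)} x \<partial>lborel) + (\<integral>\<^sup>+x. ?G {s + of_int n..<1 + of_int n} x \<partial>lborel)"
    by (simp only: shift)
  also have "\<dots> = (\<integral>\<^sup>+x. ?G {0 + of_int (n+1)..<s + of_int (n+1)} x + ?G {s + of_int n..<1 + of_int n} x \<partial>lborel)"
    by (rule nn_integral_add[symmetric]) auto
  also have "\<dots> = (\<integral>\<^sup>+x. ?G {a..<a+1} x \<partial>lborel)"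
    using s by (intro nn_integral_cong) (auto simp: indicator_def a)
  finally show ?thesis .
qed

text \<open>Any fundamental domain gives the same measure. Later the domain is chosen to fit the
  function at hand, for instance to be an image of a lift.\<close>

lemma circle_measure_eq_distr:
  "circle_measure = distr (restrict_space lborel {a..<a+1}) borel circle_proj"
proof (rule measure_eqI)
  fix A assume "A \<in> sets circle_measure"
  then have [measurable]: "A \<in> sets borel" by simp
  have m: "circle_proj \<in> restrict_space lborel {a..<a+1} \<rightarrow>\<^sub>M borel"
    by (rule measurable_restrict_space1) simp
  have "emeasure circle_measure A = (\<integral>\<^sup>+p. indicator A p \<partial>circle_measure)" by simp
  also have "\<dots> = (\<integral>\<^sup>+x. indicator A (circle_proj x) * indicator {a..<a+1} x \<partial>lborel)"
    by (rule nn_integral_circle) simp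
  also have "\<dots> = (\<integral>\<^sup>+x. indicator A (circle_proj x) \<partial>restrict_space lborel {a..<a+1})"
    by (simp add: nn_integral_restrict_space)
  also have "\<dots> = (\<integral>\<^sup>+p. indicator A p \<partial>distr (restrict_space lborel {a..<a+1}) borel circle_proj)"
    by (rule nn_integral_distr[symmetric, OF m]) simp
  finally show "emeasure circle_measure A = emeasure (distr (restrict_space lborel {a..<a+1}) borel circle_proj) A"
    by simp
qed simp

lemma bounded_integrable_circle:
  fixes f :: "circle \<Rightarrow> 'b::{banach, second_countable_topology}"
  assumes "f \<in> borel_measurable borel" "\<And>p. norm (f p) \<le> B"
  shows "integrable circle_measure f"
  by (rule circle.integrable_const_bound[where B = B]) (use assms in auto)

lemma integral_circle:
  fixes f :: "circle \<Rightarrow> real"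
  assumes [measurable]: "f \<in> borel_measurable borel" and B: "\<And>p. \<bar>f p\<bar> \<le> B"
  shows "(\<lambda>x. f (circle_proj x)) absolutely_integrable_on {a..a+1}"
    and "(\<integral>p. f p \<partial>circle_measure) = integral {a..a+1} (\<lambda>x. f (circle_proj x))"
proof -
  have m: "circle_proj \<in> restrict_space lborel {a..<a+1} \<rightarrow>\<^sub>M borel"
    by (rule measurable_restrict_space1) simp
  have *: "set_integrable lborel {a..a+1} (\<lambda>x. f (circle_proj x))"
    unfolding set_integrable_def
  proof (rule integrableI_bounded_set_indicator[where B = B])
    show "emeasure lborel {a..a+1} < \<infinity>" by simp
  qed (use B in auto)
  then show 1: "(\<lambda>x. f (circle_proj x)) absolutely_integrable_on {a..a+1}"
    unfolding set_integrable_def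
    by (metis integrable_completion borel_measurable_integrable)
  have "(\<integral>p. f p \<partial>circle_measure) = (\<integral>x. f (circle_proj x) \<partial>restrict_space lborel {a..<a+1})"
    by (subst circle_measure_eq_distr[of a], rule integral_distr[OF m]) simp
  also have "\<dots> = (LINT x:{a..<a+1}|lborel. f (circle_proj x))"
    by (simp add: integral_restrict_space set_lebesgue_integral_def)
  also have "\<dots> = (LINT x:{a..a+1}|lborel. f (circle_proj x))"
    unfolding set_lebesgue_integral_def
  proof (rule integral_cong_AE)
    show "AE x in lborel. indicat_real {a..<a+1} x *\<^sub>R f (circle_proj x) = indicat_real {a..a+1} x *\<^sub>R f (circle_proj x)"
      using AE_lborel_singleton[of "a+1"] by eventually_elim (auto simp: indicator_def)
  qed auto
  also have "\<dots> = integral {a..a+1} (\<lambda>x. f (circle_proj x))"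
    using * by (rule set_borel_integral_eq_integral)
  finally show "(\<integral>p. f p \<partial>circle_measure) = integral {a..a+1} (\<lambda>x. f (circle_proj x))" .
qed

lemma continuous_measurable_circle:
  fixes g :: "circle \<Rightarrow> real"
  shows "continuous_on UNIV g \<Longrightarrow> g \<in> borel_measurable borel"
  by (rule borel_measurable_continuous_onI)

lemma continuous_integrable_circle:
  fixes g :: "circle \<Rightarrow> real"
  assumes "continuous_on UNIV g"
  shows "integrable circle_measure g"
proof -
  obtain B where "\<And>p. \<bar>g p\<bar> \<le> B" using continuous_on_circle_bounded[OF assms] by metis
  then show ?thesis
    by (intro bounded_integrable_circle[where B=B] continuous_measurable_circle assms) auto
qed

lemma integral_circle_continuous:
  fixes g :: "circle \<Rightarrow> real"
  assumes "continuous_on UNIV g"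
  shows "(\<integral>p. g p \<partial>circle_measure) = integral {a..a+1} (\<lambda>x. g (circle_proj x))"
proof -
  obtain B where "\<And>p. \<bar>g p\<bar> \<le> B" using continuous_on_circle_bounded[OF assms] by metis
  from integral_circle(2)[OF continuous_measurable_circle[OF assms] this] show ?thesis .
qed

lemma continuous_nonneg_integral_zero:
  fixes g :: "circle \<Rightarrow> real"
  assumes g: "continuous_on UNIV g" and nn: "\<And>p. 0 \<le> g p" and z: "(\<integral>p. g p \<partial>circle_measure) = 0"
  shows "g p = 0"
proof -
  obtain x where x: "p = circle_proj x" using surj_circle_proj by blast
  have "integral {x..x+1} (\<lambda>x. g (circle_proj x)) = 0"
    using z integral_circle_continuous[OF g] by simp
  then show ?thesis
    using integral_eq_0_iff[of x "x+1" "\<lambda>x. g (circle_proj x)"] continuous_on_lift[OF g] nn x by auto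
qed

section \<open>Variation tested against derivatives\<close>

abbreviation (input) mean :: "(circle \<Rightarrow> 'b::{banach, second_countable_topology}) \<Rightarrow> 'b" where
  "mean \<equiv> integral\<^sup>L circle_measure"

text \<open>The derivative is carried along as a second function, because it is the derivative,
  not the primitive, that gets paired with densities.\<close>

definition C1_on_circle :: "(circle \<Rightarrow> real) \<Rightarrow> (circle \<Rightarrow> real) \<Rightarrow> bool" where
  "C1_on_circle k h \<longleftrightarrow> continuous_on UNIV h \<and>
     (\<forall>x. ((\<lambda>x. k (circle_proj x)) has_real_derivative h (circle_proj x)) (at x))"

text \<open>For smooth \<open>g\<close> this bounds the total variation \<open>\<integral> \<bar>g'\<bar>\<close>, by integration by parts. The dual form
  needs no derivative of \<open>g\<close> and is stable under averages and uniform limits.\<close>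

definition variation_le :: "real \<Rightarrow> (circle \<Rightarrow> real) \<Rightarrow> bool" where
  "variation_le V g \<longleftrightarrow> (\<forall>k h c. C1_on_circle k h \<longrightarrow> (\<forall>p. \<bar>k p\<bar> \<le> c) \<longrightarrow>
     mean (\<lambda>p. g p * h p) \<le> V * c)"

lemma C1_on_circleD:
  assumes "C1_on_circle k h"
  shows "continuous_on UNIV h" "continuous_on UNIV k"
    "((\<lambda>x. k (circle_proj x)) has_real_derivative h (circle_proj x)) (at x)"
proof -
  show "continuous_on UNIV h"
    and D: "((\<lambda>x. k (circle_proj x)) has_real_derivative h (circle_proj x)) (at x)" for x
    using assms unfolding C1_on_circle_def by blast+
  show "continuous_on UNIV k"
    by (intro continuous_on_circleI DERIV_isCont[OF D])
qed

lemma C1_on_circle_integral_zero: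
  assumes "C1_on_circle k h"
  shows "mean h = 0"
proof -
  have "((\<lambda>x. h (circle_proj x)) has_integral k (circle_proj (0+1)) - k (circle_proj 0)) {0..0+1}"
    using C1_on_circleD(3)[OF assms]
    by (intro fundamental_theorem_of_calculus)
       (auto simp flip: has_real_derivative_iff_has_vector_derivative intro: DERIV_subset)
  then have "integral {0..0+1} (\<lambda>x. h (circle_proj x)) = 0"
    by (simp only: circle_proj_add_one) (simp add: integral_unique)
  then show ?thesis
    using integral_circle_continuous[OF C1_on_circleD(1)[OF assms], of 0] by simp
qed

lemma variation_le_uminus:
  assumes "variation_le V g" shows "variation_le V (\<lambda>p. - g p)"
  unfolding variation_le_def
proof (intro allI impI)
  fix k h :: "circle \<Rightarrow> real" and c :: real
  assume C: "C1_on_circle k h" and b: "\<forall>p. \<bar>k p\<bar> \<le> c"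
  have "C1_on_circle (\<lambda>p. - k p) (\<lambda>p. - h p)"
    using C unfolding C1_on_circle_def by (auto intro!: continuous_intros derivative_eq_intros)
  moreover have "\<forall>p. \<bar>- k p\<bar> \<le> c" using b by simp
  ultimately have "mean (\<lambda>p. g p * - h p) \<le> V * c"
    using assms unfolding variation_le_def by blast
  then show "mean (\<lambda>p. - g p * h p) \<le> V * c" by simp
qed

lemma add_int_of_add_one:
  fixes f :: "real \<Rightarrow> real"
  assumes "\<And>x. f (x + 1) = f x + d"
  shows "f (x + of_int k) = f x + of_int k * d"
proof (induction k rule: int_induct[where k = 0])
  case base then show ?case by simp
next
  case (step1 i)
  then show ?case using assms[of "x + of_int i"] by (simp add: algebra_simps)
next
  case (step2 i)
  then show ?case using assms[of "x + of_int i - 1"] by (simp add: algebra_simps)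
qed

lemma circle_antiderivative:
  fixes h :: "circle \<Rightarrow> real"
  assumes h: "continuous_on UNIV h"
  obtains H where "\<And>x. (H has_real_derivative h (circle_proj x)) (at x)"
    "\<And>x. H (x + 1) = H x + mean h"
proof -
  have "isCont (\<lambda>x. h (circle_proj x)) x" for x
    using continuous_on_lift[OF h, of UNIV] by (simp add: continuous_on_eq_continuous_at)
  then obtain H where "\<forall>x. -\<infinity> < ereal x \<longrightarrow> ereal x < \<infinity> \<longrightarrow> (H has_vector_derivative h (circle_proj x)) (at x)"
    using einterval_antiderivative[of "-\<infinity>" "\<infinity>" "\<lambda>x. h (circle_proj x)"] by auto
  then have H: "(H has_real_derivative h (circle_proj x)) (at x)" for x
    by (simp add: has_real_derivative_iff_has_vector_derivative)
  have "((\<lambda>x. h (circle_proj x)) has_integral H (x+1) - H x) {x..x+1}" for x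
    using H by (intro fundamental_theorem_of_calculus)
       (auto simp flip: has_real_derivative_iff_has_vector_derivative intro: DERIV_subset)
  then have "H (x + 1) - H x = mean h" for x
    unfolding integral_circle_continuous[OF h, of x] by (metis integral_unique)
  then show ?thesis using that H by (metis add.commute diff_add_cancel)
qed

text \<open>An approximate identity. Dividing by the integral, instead of computing it, is enough
  because only positivity, total mass one and the shrinking support matter.\<close>

definition bump :: "real \<Rightarrow> circle \<Rightarrow> circle \<Rightarrow> real" where
  "bump e p q = max 0 (e - dist p q) / mean (\<lambda>r. max 0 (e - dist p r))"

lemma bump_normalizer_pos:
  assumes "e > 0" shows "mean (\<lambda>r. max 0 (e - dist p r)) > 0"
proof -
  have c: "continuous_on UNIV (\<lambda>r. max 0 (e - dist p r))" by (intro continuous_intros)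
  have "mean (\<lambda>r. max 0 (e - dist p r)) \<noteq> 0"
    using continuous_nonneg_integral_zero[OF c, of p] assms by auto
  moreover have "mean (\<lambda>r. max 0 (e - dist p r)) \<ge> 0" by (simp add: integral_nonneg_AE)
  ultimately show ?thesis by linarith
qed

lemma continuous_on_bump: "continuous_on UNIV (bump e p)"
  unfolding bump_def divide_inverse by (intro continuous_intros)

lemma bump_nonneg: "bump e p q \<ge> 0"
  unfolding bump_def by (intro divide_nonneg_nonneg integral_nonneg_AE) auto

lemma bump_eq_0: "e \<le> dist p q \<Longrightarrow> bump e p q = 0"
  by (simp add: bump_def)

lemma bump_integral: "e > 0 \<Longrightarrow> mean (\<lambda>q. bump e p q) = 1"
  using bump_normalizer_pos[of e p] by (simp add: bump_def)

lemma bump_average: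
  fixes u :: "circle \<Rightarrow> real"
  assumes u: "continuous_on UNIV u" and e: "e > 0"
    and near: "\<And>q. dist p q < e \<Longrightarrow> \<bar>u q - u p\<bar> \<le> \<epsilon>"
  shows "\<bar>mean (\<lambda>q. bump e p q * u q) - u p\<bar> \<le> \<epsilon>"
proof -
  note c = continuous_on_bump[of e p]
  have "mean (\<lambda>q. bump e p q * u q) - u p = mean (\<lambda>q. bump e p q * u q - bump e p q * u p)"
    by (subst Bochner_Integration.integral_diff)
       (auto intro!: continuous_integrable_circle continuous_intros u c simp: bump_integral e)
  also have "\<bar>\<dots>\<bar> \<le> mean (\<lambda>q. \<bar>bump e p q * u q - bump e p q * u p\<bar>)" by simp
  also have "\<dots> \<le> mean (\<lambda>q. bump e p q * \<epsilon>)"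
  proof (intro integral_mono continuous_integrable_circle continuous_intros u c)
    fix q
    have "\<bar>bump e p q * u q - bump e p q * u p\<bar> = bump e p q * \<bar>u q - u p\<bar>"
      using bump_nonneg[of e p q] by (simp add: abs_mult flip: right_diff_distrib)
    also have "\<dots> \<le> bump e p q * \<epsilon>"
      using near[of q] bump_nonneg[of e p q] bump_eq_0[of e p q]
      by (cases "dist p q < e") (auto intro: mult_left_mono)
    finally show "\<bar>bump e p q * u q - bump e p q * u p\<bar> \<le> bump e p q * \<epsilon>" .
  qed
  also have "\<dots> = \<epsilon>" by (simp add: bump_integral e)
  finally show ?thesis .
qed

lemma bump_tendsto:
  fixes u :: "circle \<Rightarrow> real"
  assumes u: "continuous_on UNIV u"
  shows "(\<lambda>n. \<integral>q. bump (1 / real (Suc n)) p q * u q \<partial>circle_measure) \<longlonglongrightarrow> u p"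
proof (rule LIMSEQ_I)
  fix \<epsilon> :: real assume "\<epsilon> > 0"
  obtain d where d: "d > 0" "\<And>q. dist q p < d \<Longrightarrow> dist (u q) (u p) < \<epsilon>/2"
    using u \<open>\<epsilon> > 0\<close> unfolding continuous_on_iff by (metis UNIV_I half_gt_zero)
  obtain N where N: "1 / real (Suc N) < d" using d(1) by (metis nat_approx_posE)
  show "\<exists>no. \<forall>n\<ge>no. norm (mean (\<lambda>q. bump (1 / real (Suc n)) p q * u q) - u p) < \<epsilon>"
  proof (intro exI allI impI)
    fix n assume "n \<ge> N"
    then have "1 / real (Suc n) \<le> 1 / real (Suc N)" by (intro divide_left_mono) auto
    then have "\<bar>mean (\<lambda>q. bump (1 / real (Suc n)) p q * u q) - u p\<bar> \<le> \<epsilon>/2"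
    proof (intro bump_average[OF u])
      fix q assume "dist p q < 1 / real (Suc n)"
      then have "dist q p < d" using N \<open>1 / real (Suc n) \<le> 1 / real (Suc N)\<close> by (simp add: dist_commute)
      from d(2)[OF this] show "\<bar>u q - u p\<bar> \<le> \<epsilon>/2" by (simp add: dist_real_def)
    qed simp
    then show "norm (mean (\<lambda>q. bump (1 / real (Suc n)) p q * u q) - u p) < \<epsilon>"
      using \<open>\<epsilon> > 0\<close> by simp
  qed
qed

lemma DERIV_zero_on_interval:
  fixes S :: "real \<Rightarrow> real"
  assumes "a \<le> b" "\<And>x. a \<le> x \<Longrightarrow> x \<le> b \<Longrightarrow> (S has_real_derivative 0) (at x)"
  shows "S b = S a"
proof (rule antisym)
  show "S b \<le> S a"
    by (rule DERIV_nonpos_imp_nonincreasing[OF assms(1)]) (use assms(2) in blast)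
  show "S a \<le> S b"
    by (rule DERIV_nonneg_imp_nondecreasing[OF assms(1)]) (use assms(2) in blast)
qed

text \<open>For a classical function, choosing one point \<open>x j\<close> in each of \<open>K\<close> equal arcs changes the mean by
  at most \<open>1/K\<close> times the total variation. To see this with test functions, note that the
  difference is the pairing of \<open>g\<close> with \<open>1 - (\<Sum>j<K. \<delta>\<^sub>j) / K\<close>, where \<open>\<delta>\<^sub>j\<close> is the point mass at \<open>x j\<close>.
  Its primitive vanishes at the ends of every arc and is bounded by \<open>1/K\<close>. Bumps replace the
  point masses, at the price of an error \<open>\<epsilon>\<close>.\<close>

lemma variation_sample_mean:
  fixes g :: "circle \<Rightarrow> real" and K :: nat
  assumes g: "continuous_on UNIV g" and V: "variation_le V g" and K: "K \<ge> 1"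
    and x: "\<And>j. j < K \<Longrightarrow> a + j / K < x j \<and> x j < a + (real j + 1) / K"
  shows "mean g - (\<Sum>j<K. g (circle_proj (x j))) / K \<le> V / K"
proof (rule field_le_epsilon)
  fix \<epsilon> :: real assume \<epsilon>: "\<epsilon> > 0"
  define p where "p j = circle_proj (x j)" for j
  have "\<exists>e>0. \<forall>j<K. (\<forall>q. dist (p j) q < e \<longrightarrow> \<bar>g q - g (p j)\<bar> \<le> \<epsilon>) \<and> e \<le> x j - (a + j / K) \<and> e \<le> a + (real j + 1) / K - x j"
  proof -
    have "\<exists>e>0. (\<forall>q. dist (p j) q < e \<longrightarrow> \<bar>g q - g (p j)\<bar> \<le> \<epsilon>) \<and> e \<le> x j - (a + j / K) \<and> e \<le> a + (real j + 1) / K - x j" if j: "j < K" for j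
    proof -
      obtain d where d: "d > 0" "\<And>q. dist q (p j) < d \<Longrightarrow> dist (g q) (g (p j)) < \<epsilon>"
        using g \<epsilon> unfolding continuous_on_iff by (metis UNIV_I)
      have "\<bar>g q - g (p j)\<bar> \<le> \<epsilon>" if "dist (p j) q < d" for q
        using d(2)[of q] that by (simp add: dist_commute dist_real_def)
      then show ?thesis using x[OF j] d(1)
        by (intro exI[of _ "min d (min (x j - (a + j / K)) (a + (real j + 1) / K - x j))"])
           (auto simp: min_less_iff_conj min_le_iff_disj)
    qed
    then obtain E where E: "\<And>j. j < K \<Longrightarrow> E j > 0 \<and> (\<forall>q. dist (p j) q < E j \<longrightarrow> \<bar>g q - g (p j)\<bar> \<le> \<epsilon>) \<and> E j \<le> x j - (a + j / K) \<and> E j \<le> a + (real j + 1) / K - x j"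
      by metis
    have ne: "E ` {..<K} \<noteq> {}" using K by (auto simp: lessThan_empty_iff)
    define e where "e = Min (E ` {..<K})"
    have "e > 0" using E ne by (simp add: e_def)
    moreover have "e \<le> E j" if "j < K" for j using that by (simp add: e_def)
    ultimately show ?thesis using E by (intro exI[of _ e]) force
  qed
  then obtain e where e: "e > 0"
    and near: "\<And>j q. j < K \<Longrightarrow> dist (p j) q < e \<Longrightarrow> \<bar>g q - g (p j)\<bar> \<le> \<epsilon>"
    and eL: "\<And>j. j < K \<Longrightarrow> e \<le> x j - (a + j / K)"
    and eR: "\<And>j. j < K \<Longrightarrow> e \<le> a + (real j + 1) / K - x j" by metis
  have "\<exists>S. (\<forall>y. (S has_real_derivative bump e (p j) (circle_proj y)) (at y)) \<and> (\<forall>y. S (y + 1) = S y + 1)" for j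
    using circle_antiderivative[OF continuous_on_bump[of e "p j"]] bump_integral[OF e] by metis
  then obtain S where S: "\<And>j y. (S j has_real_derivative bump e (p j) (circle_proj y)) (at y)"
    and S1: "\<And>j y. S j (y + 1) = S j y + 1" by metis
  have mono: "S j y \<le> S j z" if "y \<le> z" for j y z
    using DERIV_nonneg_imp_nondecreasing[OF that, of "S j"] S bump_nonneg by blast
  have zero: "bump e (p j) (circle_proj y) = 0"
    if j: "j < K" and y: "a \<le> y" "y \<le> a + 1" "y \<le> a + j / K \<or> a + (real j + 1) / K \<le> y" for j y
  proof -
    have "0 \<le> j / K" "(real j + 1) / K \<le> 1" using j by (auto simp: field_simps)
    then have "e \<le> \<bar>x j - y\<bar>" "\<bar>x j - y\<bar> \<le> 1 - e" using y eL[OF j] eR[OF j] e by linarith+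
    then show ?thesis unfolding p_def by (intro bump_eq_0 dist_circle_proj_ge)
  qed
  have left: "S j y = S j a" if j: "j < K" and y: "a \<le> y" "y \<le> a + j / K" for j y
  proof (rule DERIV_zero_on_interval[OF y(1)])
    fix t assume "a \<le> t" "t \<le> y"
    moreover have "j / K \<le> 1" using j by auto
    ultimately show "(S j has_real_derivative 0) (at t)" using S[of j t] zero[OF j, of t] y by auto
  qed
  have right: "S j y = S j a + 1" if j: "j < K" and y: "a + (real j + 1) / K \<le> y" "y \<le> a + 1" for j y
  proof -
    have "S j (a + 1) = S j y"
    proof (rule DERIV_zero_on_interval[OF y(2)])
      fix t assume "y \<le> t" "t \<le> a + 1"
      moreover have "(real j + 1) / K \<ge> 0" by simp
      then have "a \<le> y" using y by linarith
      ultimately show "(S j has_real_derivative 0) (at t)" using S[of j t] zero[OF j, of t] y by auto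
    qed
    then show ?thesis using S1 by simp
  qed
  (* the primitive; S j rises from 0 to 1 within the j-th arc and is constant elsewhere *)
  define H where "H y = y - (\<Sum>j<K. S j y) / K" for y
  have H1: "H (y + 1) = H y + 0" for y
  proof -
    have "(\<Sum>j<K. S j (y + 1)) = (\<Sum>j<K. S j y) + K" by (simp add: S1 sum.distrib)
    then show ?thesis using K by (simp add: H_def add_divide_distrib)
  qed
  have Hfrac: "H (frac y) = H y" for y
    using add_int_of_add_one[of H 0 y "- \<lfloor>y\<rfloor>"] H1 by (simp add: frac_def)
  define k where "k q = H (circle_coord q) - H a" for q
  define h where "h q = 1 - (\<Sum>j<K. bump e (p j) q) / K" for q
  have h: "continuous_on UNIV h"
    unfolding h_def divide_inverse by (intro continuous_intros continuous_on_bump)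
  have C: "C1_on_circle k h"
    unfolding C1_on_circle_def
  proof (intro conjI allI h)
    fix y
    have "(H has_real_derivative h (circle_proj y)) (at y)"
      unfolding H_def h_def by (intro DERIV_diff DERIV_ident DERIV_cdivide DERIV_sum S)
    then show "((\<lambda>x. k (circle_proj x)) has_real_derivative h (circle_proj y)) (at y)"
      by (auto simp: k_def Hfrac intro!: derivative_eq_intros)
  qed
  have bound: "\<bar>k q\<bar> \<le> 1 / K" for q
  proof -
    define y where "y = a + frac (circle_coord q - a)"
    have y: "a \<le> y" "y < a + 1" by (auto simp: y_def frac_lt_1)
    have "y = circle_coord q + of_int (- \<lfloor>circle_coord q - a\<rfloor>)" by (simp add: y_def frac_def)
    then have kq: "k q = H y - H a"
      using add_int_of_add_one[of H 0 "circle_coord q"] H1 unfolding k_def by (metis add_0_right mult_zero_right)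
    define i where "i = nat \<lfloor>K * (y - a)\<rfloor>"
    have i0: "real i = of_int \<lfloor>K * (y - a)\<rfloor>" using y by (simp add: i_def)
    have i1: "i \<le> K * (y - a)" "K * (y - a) < real i + 1" unfolding i0 by linarith+
    have "K * (y - a) < real K * 1" using y K by (intro mult_strict_left_mono) auto
    then have iK: "i < K" using i1 by linarith
    have i2: "i / K \<le> y - a" "y - a \<le> (real i + 1) / K" using i1 K by (auto simp: field_simps)
    define t where "t = S i y - S i a"
    have t: "0 \<le> t" "t \<le> 1" using mono[of a y i] mono[of y "a+1" i] S1[of i a] y by (auto simp: t_def)
    have summand: "S j y - S j a = (if j < i then 1 else if j = i then t else 0)" if j: "j < K" for j
    proof -
      consider "j < i" | "j = i" | "j > i" by linarith
      then show ?thesis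
      proof cases
        case 1
        then have "(real j + 1) / K \<le> i / K" using K by (intro divide_right_mono) auto
        then show ?thesis using right[OF j, of y] i2 y 1 by auto
      next
        case 2 then show ?thesis by (simp add: t_def)
      next
        case 3
        then have "(real i + 1) / K \<le> j / K" using K by (intro divide_right_mono) auto
        then show ?thesis using left[OF j, of y] i2 y 3 by auto
      qed
    qed
    have "(\<Sum>j<K. S j y - S j a) = (\<Sum>j<K. if j < i then 1 else if j = i then t else 0)"
      by (rule sum.cong) (use summand in auto)
    also have "\<dots> = (\<Sum>j<K. (if j < i then 1 else 0) + (if j = i then t else 0))"
      by (rule sum.cong) auto
    also have "\<dots> = real i + t"
    proof -
      have "{..<K} \<inter> {j. j < i} = {..<i}" using iK by auto
      then show ?thesis using iK by (simp add: sum.distrib sum.If_cases)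
    qed
    finally have sum_diff: "(\<Sum>j<K. S j y) - (\<Sum>j<K. S j a) = i + t" by (simp add: sum_subtractf)
    have "k q = (y - a) - ((\<Sum>j<K. S j y) - (\<Sum>j<K. S j a)) / K"
      unfolding kq H_def diff_divide_distrib by simp
    then have "k q = (y - a) - (i + t) / K" unfolding sum_diff .
    moreover have "(i + t) / K = i / K + t / K" "(real i + 1) / K = i / K + 1 / K" "0 \<le> t / K" "t / K \<le> 1 / K"
      using t K by (auto simp: add_divide_distrib divide_right_mono)
    ultimately show ?thesis using i2 by linarith
  qed
  have "mean (\<lambda>q. g q * h q) \<le> V * (1 / K)"
    using V C bound unfolding variation_le_def by blast
  moreover have "mean (\<lambda>q. g q * h q) = mean g - (\<Sum>j<K. \<integral>q. bump e (p j) q * g q \<partial>circle_measure) / K"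
  proof -
    have "mean (\<lambda>q. g q * h q) = mean (\<lambda>q. g q - (\<Sum>j<K. bump e (p j) q * g q) / K)"
      by (rule Bochner_Integration.integral_cong) (auto simp: h_def algebra_simps sum_distrib_left)
    also have "\<dots> = mean g - mean (\<lambda>q. (\<Sum>j<K. bump e (p j) q * g q) / K)"
      by (rule Bochner_Integration.integral_diff)
         (auto intro!: continuous_integrable_circle continuous_intros g continuous_on_bump simp: divide_inverse)
    also have "mean (\<lambda>q. (\<Sum>j<K. bump e (p j) q * g q) / K) = (\<Sum>j<K. \<integral>q. bump e (p j) q * g q \<partial>circle_measure) / K"
      by (simp, subst Bochner_Integration.integral_sum)
         (auto intro!: continuous_integrable_circle continuous_intros g continuous_on_bump)
    finally show ?thesis .
  qed
  moreover have "(\<Sum>j<K. \<integral>q. bump e (p j) q * g q \<partial>circle_measure) \<le> (\<Sum>j<K. g (p j) + \<epsilon>)"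
  proof (rule sum_mono)
    fix j assume "j \<in> {..<K}"
    then have "\<bar>mean (\<lambda>q. bump e (p j) q * g q) - g (p j)\<bar> \<le> \<epsilon>"
      by (intro bump_average[OF g e]) (auto intro: near)
    then show "mean (\<lambda>q. bump e (p j) q * g q) \<le> g (p j) + \<epsilon>" by linarith
  qed
  then have "(\<Sum>j<K. \<integral>q. bump e (p j) q * g q \<partial>circle_measure) / K \<le> (\<Sum>j<K. g (p j)) / K + \<epsilon>"
    using K by (simp add: sum.distrib field_simps)
  ultimately show "mean g - (\<Sum>j<K. g (circle_proj (x j))) / K \<le> V / K + \<epsilon>"
    by (simp add: p_def)
qed

text \<open>The case of a single arc, centred at the point: the oscillation is at most the variation.\<close>

lemma variation_le_sup_bound:
  assumes g: "continuous_on UNIV g" and V: "variation_le V g"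
  shows "\<bar>g p - mean g\<bar> \<le> V"
proof -
  obtain x where x: "p = circle_proj x" using surj_circle_proj by blast
  have "mean g - g p \<le> V"
    using variation_sample_mean[OF g V, of 1 "x - 1/2" "\<lambda>_. x"] by (simp add: x)
  moreover have "continuous_on UNIV (\<lambda>q. - g q)" by (intro continuous_intros g)
  from variation_sample_mean[OF this variation_le_uminus[OF V], of 1 "x - 1/2" "\<lambda>_. x"]
  have "g p - mean g \<le> V" by (simp add: x)
  ultimately show ?thesis by linarith
qed

text \<open>If \<open>g\<close> fell below \<open>1/2\<close> somewhere in each arc, sampling it at these points would give a mean
  below \<open>1/2\<close>, too far from the true mean 1.\<close>

lemma arc_with_half_mass:
  fixes g :: "circle \<Rightarrow> real" and K :: nat and B :: real
  assumes g: "continuous_on UNIV g" and V: "variation_le B g" and int: "mean g = 1"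
    and K: "K \<ge> 1" "2 * B \<le> K"
  shows "\<exists>j<K. \<forall>x. j / K < x \<longrightarrow> x < (real j + 1) / K \<longrightarrow> 1/2 \<le> g (circle_proj x)"
proof (rule ccontr)
  assume no_arc: "\<not> ?thesis"
  define Q where "Q j x \<longleftrightarrow> j / K < x \<and> x < (real j + 1) / K \<and> g (circle_proj x) < 1/2" for j :: nat and x
  have "\<exists>x. Q j x" if j: "j < K" for j
  proof (rule ccontr)
    assume "\<nexists>x. Q j x"
    then have "\<forall>x. j / K < x \<longrightarrow> x < (real j + 1) / K \<longrightarrow> 1/2 \<le> g (circle_proj x)"
      unfolding Q_def by (meson not_less)
    with j no_arc show False by blast
  qed
  then obtain x where "\<And>j. j < K \<Longrightarrow> Q j (x j)" by metis
  then have x: "j / K < x j \<and> x j < (real j + 1) / K \<and> g (circle_proj (x j)) < 1/2" if "j < K" for j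
    using that unfolding Q_def by blast
  have "0 + j / K < x j \<and> x j < 0 + (real j + 1) / K" if "j < K" for j
    using x[OF that] by simp
  from variation_sample_mean[of g B K 0 x, OF g V K(1) this]
  have "1 - (\<Sum>j<K. g (circle_proj (x j))) / K \<le> B / K" unfolding int .
  moreover have "(\<Sum>j<K. g (circle_proj (x j))) < (\<Sum>j<K. 1/2)"
  proof (rule sum_strict_mono)
    show "{..<K} \<noteq> {}" using K(1) by (simp add: lessThan_empty_iff)
  qed (use x in blast)+
  then have "(\<Sum>j<K. g (circle_proj (x j))) / K < 1/2" using K by (simp add: field_simps)
  moreover have "B / K \<le> 1/2" using K by (simp add: field_simps)
  ultimately show False by linarith
qed

section \<open>A single circle map\<close>

text \<open>Folding a long interval onto a fundamental domain; this is where the sum over preimages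
  in the transfer operator comes from.\<close>

lemma integral_unit_pieces:
  fixes \<Phi> :: "real \<Rightarrow> real"
  assumes "\<Phi> integrable_on {\<alpha>..\<alpha> + real m}"
  shows "integral {\<alpha>..\<alpha> + real m} \<Phi> = integral {\<alpha>..\<alpha> + 1} (\<lambda>t. \<Sum>j<m. \<Phi> (t + real j))"
proof -
  have piece: "(\<lambda>t. \<Phi> (t + real j)) integrable_on {\<alpha>..\<alpha> + 1}"
    "integral {\<alpha>..\<alpha> + 1} (\<lambda>t. \<Phi> (t + real j)) = integral {\<alpha> + real j..\<alpha> + real (Suc j)} \<Phi>" if "j < m" for j
  proof -
    have "\<Phi> integrable_on {\<alpha> + real j..\<alpha> + real (Suc j)}"
      by (rule integrable_subinterval_real[OF assms]) (use that in auto)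
    then have "(\<Phi> has_integral integral {\<alpha> + real j..\<alpha> + real (Suc j)} \<Phi>) {\<alpha> + real j..\<alpha> + real (Suc j)}"
      by (rule integrable_integral)
    then have "(\<Phi> has_integral integral {\<alpha> + real j..\<alpha> + real (Suc j)} \<Phi>) {\<alpha> + real j..(\<alpha> + 1) + real j}"
      by (simp add: add_ac)
    then have *: "((\<lambda>t. \<Phi> (t + real j)) has_integral integral {\<alpha> + real j..\<alpha> + real (Suc j)} \<Phi>) {\<alpha>..\<alpha> + 1}"
      using has_integral_shift_Icc_real[of \<Phi> "real j" _ \<alpha> "\<alpha> + 1"] by (simp add: o_def add_ac)
    then show "(\<lambda>t. \<Phi> (t + real j)) integrable_on {\<alpha>..\<alpha> + 1}" by blast
    show "integral {\<alpha>..\<alpha> + 1} (\<lambda>t. \<Phi> (t + real j)) = integral {\<alpha> + real j..\<alpha> + real (Suc j)} \<Phi>"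
      by (rule integral_unique[OF *])
  qed
  have "integral {\<alpha>..\<alpha> + real n} \<Phi> = (\<Sum>j<n. integral {\<alpha> + real j..\<alpha> + real (Suc j)} \<Phi>)" if "n \<le> m" for n
    using that
  proof (induction n)
    case 0 then show ?case by simp
  next
    case (Suc n)
    have "integral {\<alpha>..\<alpha> + real n} \<Phi> + integral {\<alpha> + real n..\<alpha> + real (Suc n)} \<Phi> = integral {\<alpha>..\<alpha> + real (Suc n)} \<Phi>"
      by (rule Henstock_Kurzweil_Integration.integral_combine)
         (use Suc.prems in \<open>auto intro: integrable_subinterval_real[OF assms]\<close>)
    then show ?case using Suc by simp
  qed
  then have "integral {\<alpha>..\<alpha> + real m} \<Phi> = (\<Sum>j<m. integral {\<alpha>..\<alpha> + 1} (\<lambda>t. \<Phi> (t + real j)))"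
    using piece(2) by simp
  also have "\<dots> = integral {\<alpha>..\<alpha> + 1} (\<lambda>t. \<Sum>j<m. \<Phi> (t + real j))"
    by (rule integral_sum[symmetric]) (use piece(1) in auto)
  finally show ?thesis .
qed

locale circle_map =
  fixes T :: "circle \<Rightarrow> circle"
  assumes C2: "C2_circle_map T" and nonzero: "circle_deriv T p \<noteq> 0"
begin

lemma has_circle_deriv: "has_circle_derivative T (circle_deriv T p) p"
proof -
  obtain D where "has_circle_derivative T D p" using C2 by (auto simp: C2_circle_map_def)
  then show ?thesis unfolding circle_deriv_def
    by (rule theI) (rule has_circle_derivative_unique[OF _ \<open>has_circle_derivative T D p\<close>])
qed

text \<open>Differentiability on the circle supplies, at every point, some lift that is differentiable
  there; it may be discontinuous elsewhere.\<close>

lemma pointwise_lift: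
  obtains G where "\<And>y. circle_proj (G y) = T (circle_proj y)"
    "(G has_real_derivative circle_deriv T (circle_proj x)) (at x)"
proof -
  obtain G where G: "\<And>y. circle_proj (G y) = T (circle_proj y)"
    "(G has_real_derivative circle_deriv T (circle_proj x)) (at (frac x))"
    using has_circle_deriv[of "circle_proj x"] by (auto simp: has_circle_derivative_def)
  define k where "k = - \<lfloor>x\<rfloor>"
  have "x + of_int k = frac x" by (simp add: k_def frac_def)
  then have "((\<lambda>y. G (y + of_int k)) has_real_derivative circle_deriv T (circle_proj x)) (at x)"
    using G(2) DERIV_shift[of G _ x "of_int k"] by simp
  then show ?thesis using that[of "\<lambda>y. G (y + of_int k)"] G(1) by simp
qed

lemma C1_circle_deriv: "C1_on_circle (circle_deriv T) (circle_deriv2 T)"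
  unfolding C1_on_circle_def
proof (intro conjI allI)
  show "continuous_on UNIV (circle_deriv2 T)" using C2 by (simp add: C2_circle_map_def)
  fix x
  let ?\<tau> = "\<lambda>x. circle_deriv T (circle_proj x)"
  have "?\<tau> field_differentiable at (circle_coord (circle_proj x))"
    using C2 by (simp only: C2_circle_map_def)
  then have D: "(?\<tau> has_real_derivative circle_deriv2 T (circle_proj x)) (at (frac x))"
    using DERIV_deriv_iff_field_differentiable[of ?\<tau> "frac x"] unfolding circle_deriv2_def by simp
  define k where "k = - \<lfloor>x\<rfloor>"
  have "x + of_int k = frac x" by (simp add: k_def frac_def)
  then have "((\<lambda>y. ?\<tau> (y + of_int k)) has_real_derivative circle_deriv2 T (circle_proj x)) (at x)"
    using D DERIV_shift[of ?\<tau> _ x "of_int k"] by simp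
  then show "(?\<tau> has_real_derivative circle_deriv2 T (circle_proj x)) (at x)" by simp
qed

lemmas continuous_circle_deriv = C1_on_circleD(2)[OF C1_circle_deriv]
lemmas continuous_circle_deriv2 = C1_on_circleD(1)[OF C1_circle_deriv]

text \<open>A global \<open>C\<^sup>1\<close> lift of the map, together with its degree.\<close>

definition lift :: "(real \<Rightarrow> real) \<Rightarrow> int \<Rightarrow> bool" where
  "lift F d \<longleftrightarrow> (\<forall>x. (F has_real_derivative circle_deriv T (circle_proj x)) (at x)) \<and>
     (\<forall>x. circle_proj (F x) = T (circle_proj x)) \<and> (\<forall>x. F (x + 1) = F x + of_int d)"

lemma liftD:
  assumes "lift F d"
  shows "(F has_real_derivative circle_deriv T (circle_proj x)) (at x)"
    "circle_proj (F x) = T (circle_proj x)" "F (x + 1) = F x + of_int d" "isCont F x"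
proof -
  show D: "(F has_real_derivative circle_deriv T (circle_proj x)) (at x)"
    and "circle_proj (F x) = T (circle_proj x)" "F (x + 1) = F x + of_int d"
    using assms unfolding lift_def by blast+
  show "isCont F x" by (rule DERIV_isCont[OF D])
qed

text \<open>A primitive of the derivative is the only candidate. To compare it with \<open>T\<close>, take the cosine of
  \<open>2 \<pi>\<close> times the difference between the coordinate of \<open>T\<close> and the candidate. Since the cosine ignores integer
  shifts, the coordinate may be replaced near any point by a lift that is differentiable there,
  and the derivative vanishes. So the cosine is constantly 1, and the difference is an integer.\<close>

lemma lift_exists: "\<exists>F d. lift F d"
proof -
  obtain F0 where F0: "\<And>x. (F0 has_real_derivative circle_deriv T (circle_proj x)) (at x)"
    "\<And>x. F0 (x + 1) = F0 x + mean (\<lambda>p. circle_deriv T p)"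
    using circle_antiderivative[OF continuous_circle_deriv] by metis
  define c where "c x = circle_coord (T (circle_proj x))" for x
  define F where "F x = F0 x + (c 0 - F0 0)" for x
  have F: "(F has_real_derivative circle_deriv T (circle_proj x)) (at x)" for x
    unfolding F_def by (rule derivative_eq_intros F0 refl | simp)+
  define e where "e x = cos (2 * pi * (c x - F x))" for x
  have "(e has_real_derivative 0) (at x)" for x
  proof -
    obtain G where G: "\<And>y. circle_proj (G y) = T (circle_proj y)"
      and GD: "(G has_real_derivative circle_deriv T (circle_proj x)) (at x)"
      using pointwise_lift[of x] by blast
    have "e = (\<lambda>y. cos (2 * pi * (G y - F y)))"
    proof
      fix y
      have "circle_proj (G y) = circle_proj (c y)" by (simp add: G c_def)
      then obtain k where k: "G y - c y = of_int k" by (auto simp: circle_proj_eq_iff elim: Ints_cases)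
      have "2 * pi * (G y - F y) = 2 * pi * (c y - F y) + 2 * pi * of_int k"
        using k by (simp flip: k add: algebra_simps)
      then show "e y = cos (2 * pi * (G y - F y))"
        by (simp add: e_def cos_add cos_one_2pi_int sin_integer_2pi cos_integer_2pi)
    qed
    moreover have "((\<lambda>y. cos (2 * pi * (G y - F y))) has_real_derivative
        - sin (2 * pi * (G x - F x)) * (2 * pi * (circle_deriv T (circle_proj x) - circle_deriv T (circle_proj x)))) (at x)"
      by (auto intro!: derivative_eq_intros GD F)
    ultimately show ?thesis by simp
  qed
  then have "e x = e 0" for x by (rule DERIV_isconst_all[rule_format])
  moreover have "e 0 = 1" by (simp add: e_def F_def)
  ultimately have "cos (2 * pi * (c x - F x)) = 1" for x by (simp add: e_def)
  then have cos1: "\<exists>n::int. 2 * pi * (c x - F x) = of_int n * 2 * pi" for x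
    by (simp only: cos_one_2pi_int)
  have "\<exists>n::int. c x - F x = of_int n" for x
  proof -
    obtain n :: int where "2 * pi * (c x - F x) = of_int n * 2 * pi" using cos1 by blast
    then have "(2 * pi) * (c x - F x) = (2 * pi) * of_int n" by simp
    then have "c x - F x = of_int n" by (subst (asm) mult_left_cancel) simp_all
    then show ?thesis by blast
  qed
  then have "circle_proj (c x) = circle_proj (F x)" for x
    by (metis circle_proj_eq_iff Ints_of_int)
  then have covers: "circle_proj (F x) = T (circle_proj x)" for x by (simp add: c_def)
  have "circle_proj (F (0 + 1)) = circle_proj (F 0)" by (simp only: covers circle_proj_add_one)
  then have "F (0 + 1) - F 0 \<in> \<int>" by (simp only: circle_proj_eq_iff)
  then obtain d where "mean (\<lambda>p. circle_deriv T p) = of_int d"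
    using F0(2)[of 0] by (auto simp: F_def elim: Ints_cases)
  then have "F (x + 1) = F x + of_int d" for x using F0(2)[of x] by (simp add: F_def)
  then show ?thesis unfolding lift_def using F covers by blast
qed

lemma continuous_map: "continuous_on UNIV T"
proof -
  obtain F d where F: "lift F d" using lift_exists by blast
  have "isCont (\<lambda>x. circle_proj (F x)) x" for x
  proof (rule isCont_o2[where f = F and g = circle_proj])
    show "isCont F x" by (rule liftD(4)[OF F])
    show "isCont circle_proj (F x)"
      using continuous_on_circle_proj[of UNIV] by (simp add: continuous_on_eq_continuous_at)
  qed
  then show ?thesis by (intro continuous_on_circleI) (simp add: liftD(2)[OF F])
qed

lemma measurable_map [measurable]: "T \<in> borel_measurable borel"
  by (rule borel_measurable_continuous_onI[OF continuous_map])

lemma lift_add_int: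
  assumes "lift F d" shows "F (x + of_int k) = F x + of_int k * of_int d"
  by (rule add_int_of_add_one[of F]) (rule liftD(3)[OF assms])

text \<open>By Rolle's theorem, as the derivative has no zero.\<close>

lemma inj_lift:
  assumes F: "lift F d" shows "inj F"
proof -
  have neq: "F x \<noteq> F y" if "x < y" for x y
  proof
    assume eq: "F x = F y"
    have "\<exists>z. x < z \<and> z < y \<and> (\<lambda>v. circle_deriv T (circle_proj z) * v) = (\<lambda>v. 0)"
      by (rule Rolle_deriv[OF that eq, of "\<lambda>z v. circle_deriv T (circle_proj z) * v"])
         (use liftD(1,4)[OF F] in \<open>auto simp: has_field_derivative_def continuous_at_imp_continuous_on\<close>)
    then obtain z where "(\<lambda>v. circle_deriv T (circle_proj z) * v) = (\<lambda>v. 0)" by blast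
    from fun_cong[OF this, of 1] nonzero[of "circle_proj z"] show False by simp
  qed
  then show ?thesis by (metis injI linorder_neqE_linordered_idom)
qed

lemma lift_degree_nonzero:
  assumes F: "lift F d" shows "d \<noteq> 0"
  using liftD(3)[OF F, of 0] injD[OF inj_lift[OF F], of 1 0] by auto

lemma surj_lift:
  assumes F: "lift F d" shows "surj F"
proof -
  have surj: "\<exists>x. F x = y" for y
  proof -
    obtain n :: nat where n: "\<bar>y - F 0\<bar> \<le> n" using real_arch_simple by blast
    have cr: "connected (range F)"
      by (intro connected_continuous_image continuous_at_imp_continuous_on) (use liftD(4)[OF F] in auto)
    have "F (0 + of_int (- int n * sgn d)) = F 0 - real n * \<bar>of_int d\<bar>" "F (0 + of_int (int n * sgn d)) = F 0 + real n * \<bar>of_int d\<bar>"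
      unfolding lift_add_int[OF F] by (auto simp: abs_if sgn_if)
    moreover have "real n * 1 \<le> real n * \<bar>of_int d\<bar>" using lift_degree_nonzero[OF F] by (intro mult_left_mono) linarith+
    ultimately have "F (0 + of_int (- int n * sgn d)) \<le> y" "y \<le> F (0 + of_int (int n * sgn d))"
      using n by linarith+
    then have "y \<in> range F" using connectedD_interval[OF cr] by blast
    then show ?thesis by blast
  qed
  then show ?thesis by (metis surjI)
qed

lemma inv_lift:
  assumes F: "lift F d" shows "F (inv F t) = t" "inv F (F x) = x" "isCont (inv F) t"
proof -
  show 1: "F (inv F t) = t" by (rule surj_f_inv_f[OF surj_lift[OF F]])
  show 2: "inv F (F x) = x" for x by (rule inv_f_f[OF inj_lift[OF F]])
  show "isCont (inv F) t"
    using isCont_inverse_function[of 1 "inv F t" "inv F" F] 1 2 liftD(4)[OF F] by simp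
qed

text \<open>The preimages of a point are read off from \<open>\<bar>d\<bar>\<close> consecutive values of the inverse lift: shifting
  the argument by \<open>d\<close> shifts the inverse lift by 1, which is the same point of the circle.\<close>

lemma preimage_bij:
  assumes F: "lift F d"
  shows "bij_betw (\<lambda>j. circle_proj (inv F (t + real j))) {..<nat \<bar>d\<bar>} (T -` {circle_proj t})"
proof -
  define E where "E = inv F"
  note FE = inv_lift(1)[OF F, folded E_def] and EF = inv_lift(2)[OF F, folded E_def]
    and shift = lift_add_int[OF F] and covers = liftD(2)[OF F] and d = lift_degree_nonzero[OF F]
  define m where "m = nat \<bar>d\<bar>"
  have m: "int m = \<bar>d\<bar>" "m > 0" using d by (auto simp: m_def)
  show ?thesis
    unfolding bij_betw_def E_def[symmetric] m_def[symmetric]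
  proof (intro conjI inj_onI equalityI subsetI)
    fix i j assume ij: "i \<in> {..<m}" "j \<in> {..<m}" and eq: "circle_proj (E (t + real i)) = circle_proj (E (t + real j))"
    then obtain k where k: "E (t + real i) - E (t + real j) = of_int k"
      by (auto simp: circle_proj_eq_iff elim: Ints_cases)
    then have "E (t + real i) = E (t + real j) + of_int k" by simp
    then have "F (E (t + real i)) = F (E (t + real j)) + of_int k * of_int d" by (simp add: shift)
    then have "real_of_int (int i - int j) = of_int (k * d)" by (simp add: FE)
    then have *: "int i - int j = k * d" by (simp only: of_int_eq_iff)
    have "\<bar>k\<bar> * \<bar>d\<bar> < \<bar>d\<bar>" using ij m unfolding abs_mult[symmetric] *[symmetric] by auto
    then have "\<bar>k\<bar> < 1" using mult_le_cancel_right1[of "\<bar>d\<bar>" "\<bar>k\<bar>"] by linarith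
    then show "i = j" using * by simp
  next
    fix p assume "p \<in> (\<lambda>j. circle_proj (E (t + real j))) ` {..<m}"
    then obtain j :: nat where "p = circle_proj (E (t + real j))" by blast
    then have "T p = circle_proj (t + of_int (int j))" by (simp add: covers[symmetric] FE)
    then show "p \<in> T -` {circle_proj t}" by (simp only: circle_proj_add_int) simp
  next
    fix p assume p: "p \<in> T -` {circle_proj t}"
    obtain s where s: "p = circle_proj s" using surj_circle_proj by blast
    then have "circle_proj (F s) = circle_proj t" using p covers by simp
    then obtain z where z: "F s - t = of_int z" by (auto simp: circle_proj_eq_iff elim: Ints_cases)
    define j where "j = nat (z mod \<bar>d\<bar>)"
    define k where "k = (z div \<bar>d\<bar>) * sgn d"
    have j: "int j = z mod \<bar>d\<bar>" "j < m" using d m by (auto simp: j_def nat_less_iff)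
    have "z = int j + k * d"
      unfolding j k_def by (simp add: mult.assoc[of _ "sgn d" d] sgn_mult_self_eq abs_sgn[symmetric] mult.commute[of "sgn d"])
    then have "F s = t + real j + of_int k * of_int d" using z by (simp add: algebra_simps)
    then have "F (s + of_int (- k)) = t + real j" by (simp only: shift)
    then have "E (t + real j) = s + of_int (- k)" by (metis EF)
    then have "circle_proj (E (t + real j)) = p" by (simp only: circle_proj_add_int s)
    then show "p \<in> (\<lambda>j. circle_proj (E (t + real j))) ` {..<m}" using j by blast
  qed
qed

lemma transfer_op_formula:
  fixes g :: "circle \<Rightarrow> real"
  assumes F: "lift F d"
  shows "transfer_op T g (circle_proj t) =
    (\<Sum>j<nat \<bar>d\<bar>. g (circle_proj (inv F (t + real j))) / \<bar>circle_deriv T (circle_proj (inv F (t + real j)))\<bar>)"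
  unfolding transfer_op_def
  by (subst sum.reindex_bij_betw[OF preimage_bij[OF F], symmetric]) (simp add: divide_inverse mult.commute)

lemma finite_preimage: "finite (T -` {p})"
proof -
  obtain F d where F: "lift F d" using lift_exists by blast
  obtain t where "p = circle_proj t" using surj_circle_proj by blast
  then show ?thesis using bij_betw_finite[OF preimage_bij[OF F, of t]] by simp
qed

lemma continuous_transfer_op:
  fixes g :: "circle \<Rightarrow> real"
  assumes g: "continuous_on UNIV g"
  shows "continuous_on UNIV (transfer_op T g)"
proof (rule continuous_on_circleI)
  fix t
  obtain F d where F: "lift F d" using lift_exists by blast
  define E where "E = inv F"
  note E = inv_lift(3)[OF F, folded E_def]
  have c: "isCont (\<lambda>t. u (circle_proj (E (t + real j)))) t" if u: "continuous_on UNIV u" for u :: "circle \<Rightarrow> real" and j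
  proof -
    have "isCont (\<lambda>x. u (circle_proj x)) x" for x
      using continuous_on_lift[OF u, of UNIV] by (simp add: continuous_on_eq_continuous_at)
    moreover have "isCont (\<lambda>t. E (t + real j)) t"
      by (rule isCont_o2[where g = E and f = "\<lambda>t. t + real j"]) (auto intro!: E continuous_intros)
    ultimately show ?thesis
      by (intro isCont_o2[where g = "\<lambda>x. u (circle_proj x)" and f = "\<lambda>t. E (t + real j)"])
  qed
  show "isCont (\<lambda>t. transfer_op T g (circle_proj t)) t"
    unfolding transfer_op_formula[OF F] E_def[symmetric] using c[OF g] c[OF continuous_circle_deriv] nonzero
    by (intro continuous_intros) auto
qed

text \<open>The change of variables along a lift, whose image of the unit interval has length \<open>\<bar>d\<bar>\<close>, followed by
  folding. The second factor is allowed to be discontinuous since indicators of arcs are needed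
  later.\<close>

lemma transfer_op_duality:
  fixes f g :: "circle \<Rightarrow> real"
  assumes f [measurable]: "f \<in> borel_measurable borel" and f_bound: "\<And>p. \<bar>f p\<bar> \<le> A"
    and g [measurable]: "g \<in> borel_measurable borel" and g_bound: "\<And>p. \<bar>g p\<bar> \<le> B"
  shows "mean (\<lambda>p. f (T p) * g p) = mean (\<lambda>p. f p * transfer_op T g p)"
    and "transfer_op T g \<in> borel_measurable borel" and "\<exists>C. \<forall>p. \<bar>transfer_op T g p\<bar> \<le> C"
proof -
  obtain F d where Fd: "lift F d" using lift_exists by blast
  define E where "E = inv F"
  define m where "m = nat \<bar>d\<bar>"
  note F = liftD(1)[OF Fd] and covers = liftD(2)[OF Fd] and inj = inj_lift[OF Fd]
    and EF = inv_lift(2)[OF Fd, folded E_def] and E = inv_lift(3)[OF Fd, folded E_def]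
    and form = transfer_op_formula[OF Fd, folded E_def m_def]
  have m: "\<bar>F 1 - F 0\<bar> = real m" using liftD(3)[OF Fd, of 0] by (simp add: m_def)
  have [measurable]: "E \<in> borel_measurable borel"
    by (intro borel_measurable_continuous_onI continuous_at_imp_continuous_on) (use E in auto)
  have [measurable]: "circle_deriv T \<in> borel_measurable borel"
    by (rule continuous_measurable_circle[OF continuous_circle_deriv])
  let ?g = "\<lambda>t. transfer_op T g (circle_proj t)"
  have mg: "?g \<in> borel_measurable borel" unfolding form by measurable
  have "(\<lambda>p. ?g (circle_coord p)) \<in> borel_measurable borel"
    by (rule measurable_compose[OF circle_coord_measurable mg])
  then show Lg [measurable]: "transfer_op T g \<in> borel_measurable borel" by simp
  have "continuous_on UNIV (\<lambda>p. 1 / circle_deriv T p)"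
    by (intro continuous_intros continuous_circle_deriv) (use nonzero in auto)
  then obtain D where D: "\<And>p. \<bar>1 / circle_deriv T p\<bar> \<le> D"
    by (rule continuous_on_circle_bounded) auto
  have Lb: "\<bar>transfer_op T g p\<bar> \<le> real m * (B * D)" for p
  proof -
    obtain t where t: "p = circle_proj t" using surj_circle_proj by blast
    have "\<bar>g q / \<bar>circle_deriv T q\<bar>\<bar> \<le> B * D" for q
    proof -
      have "\<bar>g q / \<bar>circle_deriv T q\<bar>\<bar> = \<bar>g q\<bar> * \<bar>1 / circle_deriv T q\<bar>" by (simp add: abs_divide)
      also have "\<dots> \<le> B * D" using g_bound[of q] D[of q] by (intro mult_mono) auto
      finally show ?thesis .
    qed
    then show ?thesis unfolding t form
      by (intro order_trans[OF sum_abs] order_trans[OF sum_bounded_above[of "{..<m}" _ "B * D"]]) auto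
  qed
  then show "\<exists>C. \<forall>p. \<bar>transfer_op T g p\<bar> \<le> C" by blast
  have A0: "A \<ge> 0" using f_bound[of undefined] by linarith
  define \<Phi> where "\<Phi> t = f (circle_proj t) * (g (circle_proj (E t)) / \<bar>circle_deriv T (circle_proj (E t))\<bar>)" for t
  have pull: "\<bar>circle_deriv T (circle_proj s)\<bar> * \<Phi> (F s) = f (T (circle_proj s)) * g (circle_proj s)" for s
    using nonzero[of "circle_proj s"] by (simp add: \<Phi>_def EF covers)
  have bnd: "\<bar>f (T p) * g p\<bar> \<le> A * B" for p
    using f_bound[of "T p"] g_bound[of p] A0 by (auto simp: abs_mult intro!: mult_mono)
  have mfg: "(\<lambda>p. f (T p) * g p) \<in> borel_measurable borel" by measurable
  note lhs = integral_circle[of "\<lambda>p. f (T p) * g p" "A * B" 0, OF mfg bnd]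
  have img: "F ` {0..1} = {min (F 0) (F 1)..min (F 0) (F 1) + real m}"
  proof -
    have "F ` closed_segment 0 1 = closed_segment (F 0) (F 1)"
      by (intro continuous_injective_image_segment_1 continuous_at_imp_continuous_on ballI DERIV_isCont[OF F] inj_on_subset[OF inj]) auto
    then show ?thesis using m by (auto simp: closed_segment_eq_real_ivl min_def abs_if split: if_splits)
  qed
  have "(\<lambda>s. \<bar>circle_deriv T (circle_proj s)\<bar> * \<Phi> (F s)) absolutely_integrable_on {0..1} \<and>
           integral {0..1} (\<lambda>s. \<bar>circle_deriv T (circle_proj s)\<bar> * \<Phi> (F s)) = mean (\<lambda>p. f (T p) * g p)"
    unfolding pull using lhs by simp
  then have "\<Phi> absolutely_integrable_on F ` {0..1} \<and> integral (F ` {0..1}) \<Phi> = mean (\<lambda>p. f (T p) * g p)"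
    by (subst (asm) has_absolute_integral_change_of_variables_1'[of "{0..1}" F "\<lambda>s. circle_deriv T (circle_proj s)"])
       (auto intro: DERIV_subset[OF F] inj_on_subset[OF inj])
  then have "\<Phi> integrable_on {min (F 0) (F 1)..min (F 0) (F 1) + real m}"
    and "mean (\<lambda>p. f (T p) * g p) = integral {min (F 0) (F 1)..min (F 0) (F 1) + real m} \<Phi>"
    unfolding img by (auto dest: set_lebesgue_integral_eq_integral(1))
  then have "mean (\<lambda>p. f (T p) * g p) = integral {min (F 0) (F 1)..min (F 0) (F 1) + 1} (\<lambda>t. \<Sum>j<m. \<Phi> (t + real j))"
    by (simp only: integral_unit_pieces)
  also have "(\<lambda>t. \<Sum>j<m. \<Phi> (t + real j)) = (\<lambda>t. f (circle_proj t) * transfer_op T g (circle_proj t))"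
  proof
    fix t
    have "circle_proj (t + real j) = circle_proj t" for j using circle_proj_add_int[of t "int j"] by simp
    then show "(\<Sum>j<m. \<Phi> (t + real j)) = f (circle_proj t) * transfer_op T g (circle_proj t)"
      by (simp add: \<Phi>_def form sum_distrib_left)
  qed
  also have "integral {min (F 0) (F 1)..min (F 0) (F 1) + 1} \<dots> = mean (\<lambda>p. f p * transfer_op T g p)"
  proof (rule integral_circle(2)[symmetric])
    show "(\<lambda>p. f p * transfer_op T g p) \<in> borel_measurable borel" by measurable
    show "\<bar>f p * transfer_op T g p\<bar> \<le> A * (real m * (B * D))" for p
      unfolding abs_mult by (rule mult_mono[OF f_bound Lb A0 abs_ge_zero])
  qed
  finally show "mean (\<lambda>p. f (T p) * g p) = mean (\<lambda>p. f p * transfer_op T g p)" .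
qed

end

definition arc :: "real \<Rightarrow> real \<Rightarrow> circle set" where
  "arc a b = circle_proj ` {a..b}"

lemma arc_measurable [measurable, simp]: "arc a b \<in> sets borel"
  unfolding arc_def
  by (intro borel_closed compact_imp_closed compact_continuous_image continuous_on_circle_proj compact_Icc)

lemma arc_full:
  assumes "a + 1 \<le> b" shows "arc a b = UNIV"
proof -
  have "p \<in> arc a b" for p
  proof -
    define k where "k = - \<lfloor>circle_coord p - a\<rfloor>"
    have "a \<le> circle_coord p + of_int k" "circle_coord p + of_int k \<le> b"
      using assms unfolding k_def by (simp_all, linarith+)
    then show ?thesis unfolding arc_def by (intro image_eqI[of _ _ "circle_coord p + of_int k"]) auto
  qed
  then show ?thesis by blast
qed

context circle_map
begin

lemma min_expansion_le: "min_expansion T \<le> \<bar>circle_deriv T p\<bar>"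
  unfolding min_expansion_def by (rule cINF_lower) (auto intro: bdd_belowI[where m = 0])

lemma min_expansion_pos: "0 < min_expansion T"
proof -
  obtain p where p: "\<And>q. \<bar>circle_deriv T p\<bar> \<le> \<bar>circle_deriv T q\<bar>"
    using continuous_attains_inf[OF compact_circle UNIV_not_empty, of "\<lambda>p. \<bar>circle_deriv T p\<bar>"]
      continuous_on_rabs[OF continuous_circle_deriv] by auto
  have "\<bar>circle_deriv T p\<bar> \<le> min_expansion T"
    unfolding min_expansion_def by (rule cINF_greatest) (auto intro: p)
  then show ?thesis using nonzero[of p] by linarith
qed

lemma distortion_ge: "\<bar>circle_deriv2 T p / (circle_deriv T p)\<^sup>2\<bar> \<le> distortion T"
proof -
  have "continuous_on UNIV (\<lambda>p. circle_deriv2 T p / (circle_deriv T p)\<^sup>2)"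
    by (intro continuous_intros continuous_circle_deriv continuous_circle_deriv2) (use nonzero in auto)
  then obtain B where "\<And>p. \<bar>circle_deriv2 T p / (circle_deriv T p)\<^sup>2\<bar> \<le> B"
    by (rule continuous_on_circle_bounded) auto
  then show ?thesis
    unfolding distortion_def by (intro cSUP_upper bdd_aboveI[where M = B]) auto
qed

text \<open>The quotient rule for \<open>k \<circ> T / T'\<close>. It writes \<open>h \<circ> T\<close> as the derivative of a function
  whose size is that of \<open>k\<close> divided by the expansion of \<open>T\<close>, plus a distortion term.\<close>

lemma C1_pullback:
  assumes "C1_on_circle k h"
  shows "C1_on_circle (\<lambda>p. k (T p) / circle_deriv T p)
    (\<lambda>p. h (T p) - k (T p) * (circle_deriv2 T p / (circle_deriv T p)\<^sup>2))"
  unfolding C1_on_circle_def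
proof (intro conjI allI)
  note k = C1_on_circleD[OF assms]
  show "continuous_on UNIV (\<lambda>p. h (T p) - k (T p) * (circle_deriv2 T p / (circle_deriv T p)\<^sup>2))"
    by (intro continuous_intros continuous_circle_deriv continuous_circle_deriv2
        continuous_on_compose2[OF k(1) continuous_map] continuous_on_compose2[OF k(2) continuous_map])
       (use nonzero in auto)
  fix x
  obtain F d where F: "lift F d" using lift_exists by blast
  let ?\<tau> = "\<lambda>x. circle_deriv T (circle_proj x)"
  have "((\<lambda>x. k (circle_proj (F x))) has_real_derivative h (circle_proj (F x)) * ?\<tau> x) (at x)"
    by (rule DERIV_chain2[where f = "\<lambda>x. k (circle_proj x)"]) (rule k(3) liftD(1)[OF F])+
  then have 1: "((\<lambda>x. k (T (circle_proj x))) has_real_derivative h (T (circle_proj x)) * ?\<tau> x) (at x)"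
    by (simp only: liftD(2)[OF F])
  have 2: "(?\<tau> has_real_derivative circle_deriv2 T (circle_proj x)) (at x)"
    by (rule C1_on_circleD(3)[OF C1_circle_deriv])
  have "(h (T (circle_proj x)) * ?\<tau> x * ?\<tau> x - k (T (circle_proj x)) * circle_deriv2 T (circle_proj x)) / (?\<tau> x * ?\<tau> x)
      = h (T (circle_proj x)) - k (T (circle_proj x)) * (circle_deriv2 T (circle_proj x) / (?\<tau> x)\<^sup>2)"
    using nonzero[of "circle_proj x"] by (simp add: field_simps power2_eq_square)
  then show "((\<lambda>x. k (T (circle_proj x)) / ?\<tau> x) has_real_derivative
     h (T (circle_proj x)) - k (T (circle_proj x)) * (circle_deriv2 T (circle_proj x) / (?\<tau> x)\<^sup>2)) (at x)"
    using DERIV_divide[OF 1 2 nonzero] by simp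
qed

text \<open>The Lasota-Yorke inequality of one map in dual form: the left-hand side is the pairing of
  \<open>transfer_op T g\<close> with \<open>h\<close>.\<close>

lemma test_integral_pullback_le:
  assumes g: "continuous_on UNIV g" and V: "variation_le V g"
    and C: "C1_on_circle k h" and c: "\<And>p. \<bar>k p\<bar> \<le> c"
  shows "mean (\<lambda>p. g p * h (T p))
    \<le> (V / min_expansion T + distortion T * mean (\<lambda>p. \<bar>g p\<bar>)) * c"
proof -
  define D where "D p = circle_deriv2 T p / (circle_deriv T p)\<^sup>2" for p
  let ?H = "\<lambda>p. h (T p) - k (T p) * D p"
  note k = C1_on_circleD[OF C]
  have c0: "0 \<le> c" using c[of undefined] by linarith
  have cD: "continuous_on UNIV D"
    unfolding D_def by (intro continuous_intros continuous_circle_deriv continuous_circle_deriv2) (use nonzero in auto)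
  have ckT: "continuous_on UNIV (\<lambda>p. k (T p))" "continuous_on UNIV (\<lambda>p. h (T p))"
    by (rule continuous_on_compose2[OF k(2) continuous_map] continuous_on_compose2[OF k(1) continuous_map]; simp)+
  have "\<bar>k (T p) / circle_deriv T p\<bar> \<le> c / min_expansion T" for p
    unfolding abs_divide
    using c[of "T p"] min_expansion_le[of p] min_expansion_pos c0 by (intro frac_le) auto
  then have 1: "mean (\<lambda>p. g p * ?H p) \<le> V * (c / min_expansion T)"
    using V C1_pullback[OF C, folded D_def] unfolding variation_le_def by blast
  have "mean (\<lambda>p. g p * (k (T p) * D p)) \<le> mean (\<lambda>p. \<bar>g p\<bar> * (c * distortion T))"
  proof (intro integral_mono continuous_integrable_circle continuous_intros g ckT cD)
    fix p
    have "g p * (k (T p) * D p) \<le> \<bar>g p\<bar> * (\<bar>k (T p)\<bar> * \<bar>D p\<bar>)" by (metis abs_ge_self abs_mult)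
    also have "\<dots> \<le> \<bar>g p\<bar> * (c * distortion T)"
      unfolding D_def by (intro mult_left_mono mult_mono c distortion_ge) (use c0 in auto)
    finally show "g p * (k (T p) * D p) \<le> \<bar>g p\<bar> * (c * distortion T)" .
  qed
  then have 2: "mean (\<lambda>p. g p * (k (T p) * D p)) \<le> mean (\<lambda>p. \<bar>g p\<bar>) * (c * distortion T)" by simp
  have "mean (\<lambda>p. g p * h (T p)) = mean (\<lambda>p. g p * ?H p + g p * (k (T p) * D p))"
    by (simp add: algebra_simps)
  also have "\<dots> = mean (\<lambda>p. g p * ?H p) + mean (\<lambda>p. g p * (k (T p) * D p))"
    by (intro Bochner_Integration.integral_add continuous_integrable_circle continuous_intros g ckT cD)
  finally show ?thesis using 1 2 by (simp add: algebra_simps)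
qed

text \<open>The transferred constant has mean one and, by \<open>test_integral_pullback_le\<close> applied to a
  constant, which has variation zero, variation at most the distortion. This bound is integrable over the maps,
  while nothing controls the number of preimages.\<close>

lemma transfer_op_one_le: "transfer_op T (\<lambda>_. 1) p \<le> 1 + distortion T"
proof -
  let ?u = "transfer_op T (\<lambda>_. 1::real)"
  have u: "continuous_on UNIV ?u" by (rule continuous_transfer_op) simp
  have dual: "mean (\<lambda>p. h (T p)) = mean (\<lambda>p. h p * ?u p)"
    if h: "continuous_on UNIV h" for h :: "circle \<Rightarrow> real"
  proof -
    obtain B where "\<And>p. \<bar>h p\<bar> \<le> B" using h by (rule continuous_on_circle_bounded) auto
    then show ?thesis using transfer_op_duality(1)[of h B "\<lambda>_. 1" 1] continuous_measurable_circle[OF h] by simp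
  qed
  have "variation_le (distortion T) ?u"
    unfolding variation_le_def
  proof (intro allI impI)
    fix k h :: "circle \<Rightarrow> real" and c assume C: "C1_on_circle k h" and c: "\<forall>p. \<bar>k p\<bar> \<le> c"
    have V: "variation_le 0 (\<lambda>_. 1)"
      unfolding variation_le_def using C1_on_circle_integral_zero by simp
    have "mean (\<lambda>p. 1 * h (T p)) \<le> (0 / min_expansion T + distortion T * mean (\<lambda>p. \<bar>1\<bar>)) * c"
      using c by (intro test_integral_pullback_le[where k = k] V C) auto
    then show "mean (\<lambda>p. ?u p * h p) \<le> distortion T * c"
      using dual[OF C1_on_circleD(1)[OF C]] circle.prob_space by (simp add: mult.commute)
  qed
  from variation_le_sup_bound[OF u this, of p] show ?thesis
    using dual[of "\<lambda>_. 1"] circle.prob_space by simp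
qed

lemma abs_transfer_op_le:
  fixes g :: "circle \<Rightarrow> real"
  assumes "\<And>p. \<bar>g p\<bar> \<le> B"
  shows "\<bar>transfer_op T g p\<bar> \<le> B * (1 + distortion T)"
proof -
  have B: "B \<ge> 0" using assms[of undefined] by linarith
  have "\<bar>transfer_op T g p\<bar> \<le> (\<Sum>y\<in>T -` {p}. B * (1 /\<^sub>R \<bar>circle_deriv T y\<bar>))"
    unfolding transfer_op_def
    by (intro order_trans[OF sum_abs] sum_mono) (use assms in \<open>auto simp: abs_mult divide_inverse mult.commute intro!: mult_right_mono\<close>)
  also have "\<dots> = B * transfer_op T (\<lambda>_. 1) p"
    unfolding transfer_op_def sum_distrib_left[symmetric] ..
  also have "\<dots> \<le> B * (1 + distortion T)" by (rule mult_left_mono[OF transfer_op_one_le B])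
  finally show ?thesis .
qed

text \<open>The length of an arc is that of its parameter interval, which may exceed 1 once the arc wraps
  around the circle; so lengths grow at the full rate until the circle is covered.\<close>

lemma image_arc:
  assumes ab: "a \<le> b" and l: "\<And>p. l \<le> \<bar>circle_deriv T p\<bar>"
  shows "\<exists>a' b'. a' \<le> b' \<and> l * (b - a) \<le> b' - a' \<and> T ` arc a b = arc a' b'"
proof -
  obtain F d where F: "lift F d" using lift_exists by blast
  define a' b' where "a' = min (F a) (F b)" and "b' = max (F a) (F b)"
  have "F ` closed_segment a b = closed_segment (F a) (F b)"
    by (intro continuous_injective_image_segment_1 continuous_at_imp_continuous_on ballI liftD(4)[OF F]
        inj_on_subset[OF inj_lift[OF F]]) auto
  then have "F ` {a..b} = {a'..b'}"
    using ab by (auto simp: closed_segment_eq_real_ivl a'_def b'_def)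
  then have "T ` arc a b = arc a' b'"
    unfolding arc_def by (simp only: image_image flip: liftD(2)[OF F]) (metis image_image)
  moreover have "l * (b - a) \<le> b' - a'"
  proof (cases "a = b")
    case False
    then obtain z where "F b - F a = (b - a) * circle_deriv T (circle_proj z)"
      using MVT2[of a b F "\<lambda>x. circle_deriv T (circle_proj x)"] liftD(1)[OF F] ab by auto
    then have "\<bar>F b - F a\<bar> = (b - a) * \<bar>circle_deriv T (circle_proj z)\<bar>" using ab by (simp add: abs_mult)
    moreover have "l * (b - a) \<le> (b - a) * \<bar>circle_deriv T (circle_proj z)\<bar>"
      using mult_left_mono[OF l[of "circle_proj z"], of "b - a"] ab by (simp add: mult.commute)
    ultimately show ?thesis by (auto simp: a'_def b'_def)
  qed (simp add: a'_def b'_def)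
  ultimately show ?thesis by (intro exI[of _ a'] exI[of _ b']) (auto simp: a'_def b'_def)
qed

text \<open>Every point of the image of \<open>A\<close> has a preimage in \<open>A\<close>, which contributes at least \<open>1/M\<close> to the
  transferred indicator of \<open>A\<close>.\<close>

lemma integral_over_arc_ge:
  fixes u :: "circle \<Rightarrow> real"
  assumes M: "\<And>p. \<bar>circle_deriv T p\<bar> \<le> M"
    and A [measurable]: "A \<in> sets borel" "T ` A \<in> sets borel"
    and u [measurable]: "u \<in> borel_measurable borel" and u0: "\<And>p. 0 \<le> u p" and uB: "\<And>p. u p \<le> B"
  shows "mean (\<lambda>p. u p * indicator (T ` A) p) / M \<le> mean (\<lambda>p. u (T p) * indicator A p)"
proof -
  have M0: "M > 0" using M[of undefined] nonzero[of undefined] by linarith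
  have ind: "indicator (T ` A) p / M \<le> transfer_op T (indicator A) p" for p
  proof (cases "p \<in> T ` A")
    case True
    then obtain y where y: "y \<in> A" "T y = p" by blast
    have "1 / M \<le> indicator A y /\<^sub>R \<bar>circle_deriv T y\<bar>"
      using M[of y] nonzero[of y] y M0 by (simp add: divide_inverse)
    also have "\<dots> \<le> transfer_op T (indicator A) p"
      unfolding transfer_op_def using finite_preimage y by (intro member_le_sum) auto
    finally show ?thesis using True by simp
  next
    case False
    then show ?thesis unfolding transfer_op_def by (auto intro!: sum_nonneg)
  qed
  have ub: "\<bar>u p\<bar> \<le> B" for p using u0 uB by simp
  note dual = transfer_op_duality[of u B "indicator A" 1, OF u ub]
  have [measurable]: "transfer_op T (indicator A :: circle \<Rightarrow> real) \<in> borel_measurable borel"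
    by (rule dual(2)) (auto simp: indicator_def)
  obtain C where C: "\<And>p. \<bar>transfer_op T (indicator A) p :: real\<bar> \<le> C"
    using dual(3) by (auto simp: indicator_def)
  have B0: "B \<ge> 0" using u0[of undefined] uB[of undefined] by linarith
  have "mean (\<lambda>p. u p * indicator (T ` A) p) / M = mean (\<lambda>p. u p * (indicator (T ` A) p / M))"
    by simp
  also have "\<dots> \<le> mean (\<lambda>p. u p * transfer_op T (indicator A) p)"
  proof (rule integral_mono)
    show "integrable circle_measure (\<lambda>p. u p * (indicator (T ` A) p / M))"
      by (rule bounded_integrable_circle[where B = "B * (1 / M)"])
         (use M0 ub B0 in \<open>auto simp: abs_mult indicator_def divide_right_mono\<close>)
    show "integrable circle_measure (\<lambda>p. u p * transfer_op T (indicator A) p)"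
    proof (rule bounded_integrable_circle[where B = "B * C"])
      show "norm (u p * transfer_op T (indicator A) p) \<le> B * C" for p
        unfolding real_norm_def abs_mult by (rule mult_mono[OF ub C B0 abs_ge_zero])
    qed measurable
  qed (rule mult_left_mono[OF ind u0])
  also have "\<dots> = mean (\<lambda>p. u (T p) * indicator A p)"
    by (rule dual(1)[symmetric]) (auto simp: indicator_def)
  finally show ?thesis .
qed

end

section \<open>The averaged operators\<close>

lemma measurable_bump [measurable (raw)]:
  fixes f g :: "'a \<Rightarrow> circle"
  assumes [measurable]: "f \<in> borel_measurable M" "g \<in> borel_measurable M"
  shows "(\<lambda>x. bump e (f x) (g x)) \<in> borel_measurable M"
proof -
  have [measurable]: "(\<lambda>x. \<integral>r. max 0 (e - dist (f x) r) \<partial>circle_measure) \<in> borel_measurable M"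
    by (rule circle.borel_measurable_lebesgue_integral) measurable
  show ?thesis unfolding bump_def by measurable
qed

locale random_circle_maps = noise: prob_space \<eta> for \<eta> :: "'w measure" +
  fixes T :: "'w \<Rightarrow> circle \<Rightarrow> circle"
  assumes C2: "\<omega> \<in> space \<eta> \<Longrightarrow> C2_circle_map (T \<omega>)"
    and nonzero: "\<omega> \<in> space \<eta> \<Longrightarrow> circle_deriv (T \<omega>) p \<noteq> 0"
    and measurable_pair: "(\<lambda>(\<omega>, p). T \<omega> p) \<in> \<eta> \<Otimes>\<^sub>M borel \<rightarrow>\<^sub>M borel"
    and integrable_contraction: "integrable \<eta> (\<lambda>\<omega>. 1 / (min_expansion (T \<omega>))\<^sup>2)"
    and contraction_lt_1: "(\<integral>\<omega>. 1 / (min_expansion (T \<omega>))\<^sup>2 \<partial>\<eta>) < 1"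
    and integrable_distortion: "integrable \<eta> (\<lambda>\<omega>. (distortion (T \<omega>))\<^sup>2)"
begin

sublocale pair: pair_sigma_finite \<eta> circle_measure ..

lemma circle_map: "\<omega> \<in> space \<eta> \<Longrightarrow> circle_map (T \<omega>)"
  using C2 nonzero by unfold_locales auto

abbreviation "P \<equiv> annealed_transfer_op \<eta> T"
abbreviation "Q \<equiv> annealed_koopman_op \<eta> T"

text \<open>This dominates the mean of \<open>1/\<lambda>\<close>, by the inequality between arithmetic and geometric means.\<close>

definition contraction_rate :: real where "contraction_rate = (\<integral>\<omega>. (1 + 1 / (min_expansion (T \<omega>))\<^sup>2) / 2 \<partial>\<eta>)"

text \<open>A bound for \<open>1 + \<Delta>\<close> whose integrability and measurability follow directly from those of \<open>\<Delta>\<^sup>2\<close>.\<close>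

definition distortion_majorant :: "'w \<Rightarrow> real" where "distortion_majorant \<omega> = 2 + (distortion (T \<omega>))\<^sup>2"

definition mean_distortion :: real where "mean_distortion = (\<integral>\<omega>. distortion_majorant \<omega> \<partial>\<eta>)"

lemma contraction_rate_bounds: "0 \<le> contraction_rate" "contraction_rate < 1"
proof -
  define I where "I = (\<integral>\<omega>. 1 / (min_expansion (T \<omega>))\<^sup>2 \<partial>\<eta>)"
  have eq: "contraction_rate = (1 + I) / 2"
    unfolding contraction_rate_def I_def using integrable_contraction by (simp add: noise.prob_space)
  have "0 \<le> I" unfolding I_def by (intro integral_nonneg_AE) auto
  then show "0 \<le> contraction_rate" unfolding eq by simp
  have "I < 1" unfolding I_def by (rule contraction_lt_1)
  then show "contraction_rate < 1" unfolding eq by simp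
qed

lemma integrable_distortion_majorant: "integrable \<eta> distortion_majorant"
  unfolding distortion_majorant_def using integrable_distortion by simp

lemma mean_distortion_nonneg: "0 \<le> mean_distortion"
  unfolding mean_distortion_def by (intro integral_nonneg_AE) (simp add: distortion_majorant_def)

lemma distortion_le_majorant: "1 + distortion (T \<omega>) \<le> distortion_majorant \<omega>" "distortion (T \<omega>) \<le> distortion_majorant \<omega>"
proof -
  have "0 \<le> (distortion (T \<omega>) - 1/2)\<^sup>2" by simp
  then have "distortion (T \<omega>) \<le> (distortion (T \<omega>))\<^sup>2 + 1/4" by (simp add: power2_eq_square algebra_simps)
  then show "1 + distortion (T \<omega>) \<le> distortion_majorant \<omega>" "distortion (T \<omega>) \<le> distortion_majorant \<omega>" by (auto simp: distortion_majorant_def)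
qed

lemma measurable_maps [measurable (raw)]:
  assumes [measurable]: "f \<in> measurable M \<eta>" "h \<in> borel_measurable M"
  shows "(\<lambda>x. T (f x) (h x)) \<in> borel_measurable M"
proof -
  have "(\<lambda>x. (f x, h x)) \<in> measurable M (\<eta> \<Otimes>\<^sub>M borel)" by measurable
  from measurable_compose[OF this measurable_pair] show ?thesis by simp
qed

text \<open>The hypotheses give measurability of \<open>T \<omega> p\<close> and say nothing about preimages. By duality the
  average of \<open>transfer_op (T \<omega>) g\<close> against a bump is an integral of the bump composed with \<open>T \<omega>\<close>,
  which is measurable by Fubini's theorem; by continuity these averages converge to the value itself.\<close>

lemma measurable_transfer_op [measurable (raw)]:
  assumes g: "continuous_on UNIV (g :: circle \<Rightarrow> real)"
    and [measurable]: "f \<in> measurable M \<eta>" "h \<in> borel_measurable M"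
  shows "(\<lambda>x. transfer_op (T (f x)) g (h x)) \<in> borel_measurable M"
proof (rule borel_measurable_LIMSEQ_real)
  note [measurable] = continuous_measurable_circle[OF g]
  let ?A = "\<lambda>n x. \<integral>y. bump (1 / real (Suc n)) (h x) (T (f x) y) * g y \<partial>circle_measure"
  show "?A n \<in> borel_measurable M" for n
    by (rule circle.borel_measurable_lebesgue_integral) measurable
  fix x assume "x \<in> space M"
  then have "f x \<in> space \<eta>" by (rule measurable_space[OF assms(2)])
  then interpret circle_map "T (f x)" by (rule circle_map)
  have "?A n x = mean (\<lambda>q. bump (1 / real (Suc n)) (h x) q * transfer_op (T (f x)) g q)" for n
  proof -
    obtain A where "\<And>q. \<bar>bump (1 / real (Suc n)) (h x) q\<bar> \<le> A"
      using continuous_on_bump by (rule continuous_on_circle_bounded) auto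
    moreover obtain B where "\<And>q. \<bar>g q\<bar> \<le> B"
      using g by (rule continuous_on_circle_bounded) auto
    ultimately show ?thesis
      by (intro transfer_op_duality(1) continuous_measurable_circle continuous_on_bump g)
  qed
  then show "(\<lambda>n. ?A n x) \<longlonglongrightarrow> transfer_op (T (f x)) g (h x)"
    using bump_tendsto[OF continuous_transfer_op[OF g], of "h x"] by simp
qed

lemma abs_transfer_op_le_majorant:
  fixes g :: "circle \<Rightarrow> real"
  assumes "\<And>p. \<bar>g p\<bar> \<le> B" and \<omega>: "\<omega> \<in> space \<eta>"
  shows "\<bar>transfer_op (T \<omega>) g p\<bar> \<le> B * distortion_majorant \<omega>"
proof -
  interpret circle_map "T \<omega>" by (rule circle_map[OF \<omega>])
  have "B \<ge> 0" using assms(1)[of undefined] by linarith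
  then show ?thesis
    using abs_transfer_op_le[of g B, OF assms(1)] mult_left_mono[OF distortion_le_majorant(1), of B \<omega>] order_trans by blast
qed

lemma integrable_transfer_op:
  fixes g :: "circle \<Rightarrow> real"
  assumes g: "continuous_on UNIV g"
  shows "integrable \<eta> (\<lambda>\<omega>. transfer_op (T \<omega>) g p)"
proof -
  obtain B where B: "\<And>q. \<bar>g q\<bar> \<le> B" using g by (rule continuous_on_circle_bounded) auto
  show ?thesis
  proof (rule Bochner_Integration.integrable_bound[where f = "\<lambda>\<omega>. B * distortion_majorant \<omega>"])
    show "integrable \<eta> (\<lambda>\<omega>. B * distortion_majorant \<omega>)" using integrable_distortion_majorant by simp
    show "(\<lambda>\<omega>. transfer_op (T \<omega>) g p) \<in> borel_measurable \<eta>" using g by measurable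
    show "AE \<omega> in \<eta>. norm (transfer_op (T \<omega>) g p) \<le> norm (B * distortion_majorant \<omega>)"
    proof (rule AE_I2)
      fix \<omega> assume "\<omega> \<in> space \<eta>"
      from abs_transfer_op_le_majorant[of g B, OF B this, where p = p]
      show "norm (transfer_op (T \<omega>) g p) \<le> norm (B * distortion_majorant \<omega>)" by simp
    qed
  qed
qed

lemma continuous_P:
  fixes g :: "circle \<Rightarrow> real"
  assumes g: "continuous_on UNIV g"
  shows "continuous_on UNIV (P g)"
proof (rule continuous_on_sequentiallyI)
  fix u and a :: circle assume u: "u \<longlonglongrightarrow> a"
  obtain B where B: "\<And>q. \<bar>g q\<bar> \<le> B" using g by (rule continuous_on_circle_bounded) auto
  show "(\<lambda>n. P g (u n)) \<longlonglongrightarrow> P g a"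
    unfolding annealed_transfer_op_def
  proof (rule integral_dominated_convergence[where w = "\<lambda>\<omega>. B * distortion_majorant \<omega>"])
    show "integrable \<eta> (\<lambda>\<omega>. B * distortion_majorant \<omega>)" using integrable_distortion_majorant by simp
    show "AE \<omega> in \<eta>. (\<lambda>n. transfer_op (T \<omega>) g (u n)) \<longlonglongrightarrow> transfer_op (T \<omega>) g a"
    proof (rule AE_I2)
      fix \<omega> assume \<omega>: "\<omega> \<in> space \<eta>"
      have "continuous_on UNIV (transfer_op (T \<omega>) g)"
        by (rule circle_map.continuous_transfer_op[OF circle_map[OF \<omega>] g])
      then show "(\<lambda>n. transfer_op (T \<omega>) g (u n)) \<longlonglongrightarrow> transfer_op (T \<omega>) g a"
        using u by (rule continuous_on_tendsto_compose) auto
    qed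
    show "AE \<omega> in \<eta>. norm (transfer_op (T \<omega>) g (u n)) \<le> B * distortion_majorant \<omega>" for n
      using abs_transfer_op_le_majorant[of g B, OF B] by (intro AE_I2) simp
  qed (use g in measurable)
qed

lemma measurable_Q [measurable]:
  fixes f :: "circle \<Rightarrow> 'b::{banach, second_countable_topology}"
  assumes [measurable]: "f \<in> borel_measurable borel"
  shows "Q f \<in> borel_measurable borel"
  unfolding annealed_koopman_op_def
  by (rule noise.borel_measurable_lebesgue_integral) measurable

lemma norm_Q_le:
  fixes f :: "circle \<Rightarrow> 'b::{banach, second_countable_topology}"
  assumes [measurable]: "f \<in> borel_measurable borel" and B: "\<And>p. norm (f p) \<le> B"
  shows "norm (Q f p) \<le> B"
proof -
  have i: "integrable \<eta> (\<lambda>\<omega>. f (T \<omega> p))"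
    by (rule noise.integrable_const_bound[where B = B]) (use B in auto)
  have "norm (Q f p) \<le> (\<integral>\<omega>. norm (f (T \<omega> p)) \<partial>\<eta>)"
    unfolding annealed_koopman_op_def by (rule integral_norm_bound)
  also have "\<dots> \<le> (\<integral>\<omega>. B \<partial>\<eta>)"
    using i B by (intro integral_mono) auto
  finally show ?thesis by (simp add: noise.prob_space)
qed

lemma integrable_pair_bounded:
  fixes F :: "'w \<Rightarrow> circle \<Rightarrow> real"
  assumes [measurable]: "case_prod F \<in> borel_measurable (\<eta> \<Otimes>\<^sub>M circle_measure)"
    and b: "\<And>\<omega> p. \<omega> \<in> space \<eta> \<Longrightarrow> \<bar>F \<omega> p\<bar> \<le> w \<omega>" and w: "integrable \<eta> w"
  shows "integrable (\<eta> \<Otimes>\<^sub>M circle_measure) (case_prod F)"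
proof (rule Bochner_Integration.integrable_bound[where f = "\<lambda>(\<omega>, p). w \<omega>"])
  have [measurable]: "w \<in> borel_measurable \<eta>" using w by simp
  show "integrable (\<eta> \<Otimes>\<^sub>M circle_measure) (\<lambda>(\<omega>, p). w \<omega>)"
    by (rule pair.Fubini_integrable) (use w in \<open>auto simp: circle.prob_space\<close>)
  show "AE x in \<eta> \<Otimes>\<^sub>M circle_measure. norm (case_prod F x) \<le> norm (case x of (\<omega>, p) \<Rightarrow> w \<omega>)"
  proof (rule AE_I2)
    fix x assume "x \<in> space (\<eta> \<Otimes>\<^sub>M circle_measure)"
    then have "fst x \<in> space \<eta>" by (auto simp: space_pair_measure)
    from b[OF this, of "snd x"] show "norm (case_prod F x) \<le> norm (case x of (\<omega>, p) \<Rightarrow> w \<omega>)"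
      by (simp add: case_prod_beta)
  qed
qed measurable

lemma P_pairing:
  fixes f g :: "circle \<Rightarrow> real"
  assumes f [measurable]: "f \<in> borel_measurable borel" and A: "\<And>p. \<bar>f p\<bar> \<le> A"
    and g: "continuous_on UNIV g"
  shows "mean (\<lambda>p. f p * P g p) = (\<integral>\<omega>. \<integral>p. f (T \<omega> p) * g p \<partial>circle_measure \<partial>\<eta>)"
proof -
  obtain B where B: "\<And>q. \<bar>g q\<bar> \<le> B" using g by (rule continuous_on_circle_bounded) auto
  have A0: "0 \<le> A" using A[of undefined] by linarith
  have int: "integrable (\<eta> \<Otimes>\<^sub>M circle_measure) (\<lambda>(\<omega>, p). f p * transfer_op (T \<omega>) g p)"
  proof (rule integrable_pair_bounded[where w = "\<lambda>\<omega>. A * (B * distortion_majorant \<omega>)"])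
    show "(\<lambda>(\<omega>, p). f p * transfer_op (T \<omega>) g p) \<in> borel_measurable (\<eta> \<Otimes>\<^sub>M circle_measure)"
      using g by measurable
    show "\<bar>f p * transfer_op (T \<omega>) g p\<bar> \<le> A * (B * distortion_majorant \<omega>)" if "\<omega> \<in> space \<eta>" for \<omega> p
      unfolding abs_mult by (rule mult_mono[OF A abs_transfer_op_le_majorant[of g B, OF B that] A0 abs_ge_zero])
    show "integrable \<eta> (\<lambda>\<omega>. A * (B * distortion_majorant \<omega>))" using integrable_distortion_majorant by simp
  qed
  have "mean (\<lambda>p. f p * P g p) = mean (\<lambda>p. \<integral>\<omega>. f p * transfer_op (T \<omega>) g p \<partial>\<eta>)"
    by (simp add: annealed_transfer_op_def)
  also have "\<dots> = (\<integral>\<omega>. \<integral>p. f p * transfer_op (T \<omega>) g p \<partial>circle_measure \<partial>\<eta>)"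
    by (rule pair.Fubini_integral[OF int])
  also have "\<dots> = (\<integral>\<omega>. \<integral>p. f (T \<omega> p) * g p \<partial>circle_measure \<partial>\<eta>)"
  proof (rule Bochner_Integration.integral_cong[OF refl])
    fix \<omega> assume "\<omega> \<in> space \<eta>"
    then interpret circle_map "T \<omega>" by (rule circle_map)
    show "mean (\<lambda>p. f p * transfer_op (T \<omega>) g p) = mean (\<lambda>p. f (T \<omega> p) * g p)"
      by (rule transfer_op_duality(1)[OF f A continuous_measurable_circle[OF g] B, symmetric])
  qed
  finally show ?thesis .
qed

lemma Q_pairing:
  fixes f g :: "circle \<Rightarrow> real"
  assumes f [measurable]: "f \<in> borel_measurable borel" and A: "\<And>p. \<bar>f p\<bar> \<le> A"
    and g [measurable]: "g \<in> borel_measurable borel" and B: "\<And>p. \<bar>g p\<bar> \<le> B"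
  shows "mean (\<lambda>p. Q f p * g p) = (\<integral>\<omega>. \<integral>p. f (T \<omega> p) * g p \<partial>circle_measure \<partial>\<eta>)"
    and "integrable \<eta> (\<lambda>\<omega>. \<integral>p. f (T \<omega> p) * g p \<partial>circle_measure)"
proof -
  have A0: "0 \<le> A" using A[of undefined] by linarith
  have int: "integrable (\<eta> \<Otimes>\<^sub>M circle_measure) (\<lambda>(\<omega>, p). f (T \<omega> p) * g p)"
  proof (rule integrable_pair_bounded[where w = "\<lambda>\<omega>. A * B"])
    show "(\<lambda>(\<omega>, p). f (T \<omega> p) * g p) \<in> borel_measurable (\<eta> \<Otimes>\<^sub>M circle_measure)"
      by measurable
    show "\<bar>f (T \<omega> p) * g p\<bar> \<le> A * B" for \<omega> p
      unfolding abs_mult by (rule mult_mono[OF A B A0 abs_ge_zero])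
  qed simp
  have "mean (\<lambda>p. Q f p * g p) = mean (\<lambda>p. \<integral>\<omega>. f (T \<omega> p) * g p \<partial>\<eta>)"
    by (simp add: annealed_koopman_op_def)
  also have "\<dots> = (\<integral>\<omega>. \<integral>p. f (T \<omega> p) * g p \<partial>circle_measure \<partial>\<eta>)"
    by (rule pair.Fubini_integral[OF int])
  finally show "mean (\<lambda>p. Q f p * g p) = (\<integral>\<omega>. \<integral>p. f (T \<omega> p) * g p \<partial>circle_measure \<partial>\<eta>)" .
  show "integrable \<eta> (\<lambda>\<omega>. \<integral>p. f (T \<omega> p) * g p \<partial>circle_measure)"
    using pair.integrable_fst'[OF int] by simp
qed

lemma duality:
  fixes f g :: "circle \<Rightarrow> real"
  assumes f: "f \<in> borel_measurable borel" and A: "\<And>p. \<bar>f p\<bar> \<le> A"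
    and g: "continuous_on UNIV g"
  shows "mean (\<lambda>p. f p * P g p) = mean (\<lambda>p. Q f p * g p)"
proof -
  obtain B where B: "\<And>q. \<bar>g q\<bar> \<le> B" using g by (rule continuous_on_circle_bounded) auto
  show ?thesis
    unfolding P_pairing[OF assms] Q_pairing(1)[OF f A continuous_measurable_circle[OF g] B] ..
qed

lemma integral_P:
  fixes g :: "circle \<Rightarrow> real"
  assumes g: "continuous_on UNIV g"
  shows "mean (\<lambda>p. P g p) = mean g"
  using duality[of "\<lambda>_. 1" 1 g] g by (simp add: annealed_koopman_op_def noise.prob_space)

lemma P_diff:
  fixes g1 g2 :: "circle \<Rightarrow> real"
  assumes "continuous_on UNIV g1" "continuous_on UNIV g2"
  shows "P (\<lambda>p. g1 p - g2 p) = (\<lambda>p. P g1 p - P g2 p)"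
  unfolding annealed_transfer_op_def transfer_op_def scaleR_diff_right sum_subtractf
  by (intro ext Bochner_Integration.integral_diff integrable_transfer_op[unfolded transfer_op_def] assms)

lemma P_cmult: "P (\<lambda>p. c * g p) = (\<lambda>p. c * P g p :: real)"
proof -
  have "transfer_op t (\<lambda>p. c * g p) q = c * transfer_op t g q" for t q
    unfolding transfer_op_def by (simp add: sum_distrib_left algebra_simps)
  then show ?thesis unfolding annealed_transfer_op_def by simp
qed

lemma P_L1_contraction:
  fixes g :: "circle \<Rightarrow> real"
  assumes g: "continuous_on UNIV g"
  shows "mean (\<lambda>p. \<bar>P g p\<bar>) \<le> mean (\<lambda>p. \<bar>g p\<bar>)"
proof -
  have ag: "continuous_on UNIV (\<lambda>p. \<bar>g p\<bar>)" by (intro continuous_intros g)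
  have "\<bar>P g p\<bar> \<le> P (\<lambda>p. \<bar>g p\<bar>) p" for p
  proof -
    have "\<bar>P g p\<bar> \<le> (\<integral>\<omega>. \<bar>transfer_op (T \<omega>) g p\<bar> \<partial>\<eta>)"
      unfolding annealed_transfer_op_def by simp
    also have "\<dots> \<le> P (\<lambda>p. \<bar>g p\<bar>) p"
      unfolding annealed_transfer_op_def
    proof (intro integral_mono integrable_abs integrable_transfer_op g ag)
      show "\<bar>transfer_op (T \<omega>) g p\<bar> \<le> transfer_op (T \<omega>) (\<lambda>p. \<bar>g p\<bar>) p" for \<omega>
        unfolding transfer_op_def by (rule order_trans[OF sum_abs]) (simp add: abs_mult)
    qed
    finally show ?thesis .
  qed
  then have "mean (\<lambda>p. \<bar>P g p\<bar>) \<le> mean (\<lambda>p. P (\<lambda>p. \<bar>g p\<bar>) p)"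
    by (intro integral_mono continuous_integrable_circle continuous_intros continuous_P g ag)
  then show ?thesis using integral_P[OF ag] by simp
qed

text \<open>The Lasota-Yorke inequality for the averaged operator, by integrating that of each map.\<close>

lemma variation_P:
  fixes g :: "circle \<Rightarrow> real"
  assumes g: "continuous_on UNIV g" and V: "variation_le V g" and V0: "0 \<le> V"
  shows "variation_le (contraction_rate * V + mean_distortion * mean (\<lambda>p. \<bar>g p\<bar>)) (P g)"
  unfolding variation_le_def
proof (intro allI impI)
  fix k h :: "circle \<Rightarrow> real" and c :: real
  assume C: "C1_on_circle k h" and c: "\<forall>p. \<bar>k p\<bar> \<le> c"
  note h = C1_on_circleD(1)[OF C]
  have c0: "0 \<le> c" using c by (meson abs_ge_zero order_trans)
  define I where "I = mean (\<lambda>p. \<bar>g p\<bar>)"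
  have I0: "0 \<le> I" unfolding I_def by (intro integral_nonneg_AE) auto
  obtain A where A: "\<And>q. \<bar>h q\<bar> \<le> A" using h by (rule continuous_on_circle_bounded) auto
  obtain B where B: "\<And>q. \<bar>g q\<bar> \<le> B" using g by (rule continuous_on_circle_bounded) auto
  define a where "a \<omega> = (1 + 1 / (min_expansion (T \<omega>))\<^sup>2) / 2" for \<omega>
  have a: "integrable \<eta> a" "contraction_rate = (\<integral>\<omega>. a \<omega> \<partial>\<eta>)"
    unfolding a_def contraction_rate_def using integrable_contraction by simp_all
  have "mean (\<lambda>p. P g p * h p) = mean (\<lambda>p. h p * P g p)"
    by (simp add: mult.commute)
  also have "\<dots> = (\<integral>\<omega>. \<integral>p. h (T \<omega> p) * g p \<partial>circle_measure \<partial>\<eta>)"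
    by (rule P_pairing[OF continuous_measurable_circle[OF h] A g])
  also have "\<dots> \<le> (\<integral>\<omega>. (V * a \<omega> + distortion_majorant \<omega> * I) * c \<partial>\<eta>)"
  proof (rule integral_mono)
    show "integrable \<eta> (\<lambda>\<omega>. \<integral>p. h (T \<omega> p) * g p \<partial>circle_measure)"
      by (rule Q_pairing(2)[OF continuous_measurable_circle[OF h] A continuous_measurable_circle[OF g] B])
    show "integrable \<eta> (\<lambda>\<omega>. (V * a \<omega> + distortion_majorant \<omega> * I) * c)"
      using integrable_distortion_majorant a(1) by simp
    fix \<omega> assume "\<omega> \<in> space \<eta>"
    then interpret circle_map "T \<omega>" by (rule circle_map)
    have "0 \<le> (1 / min_expansion (T \<omega>) - 1)\<^sup>2" by simp
    then have "1 / min_expansion (T \<omega>) \<le> a \<omega>" by (simp add: a_def power2_eq_square algebra_simps)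
    then have 1: "V / min_expansion (T \<omega>) \<le> V * a \<omega>" using mult_left_mono[OF _ V0] by fastforce
    have 2: "distortion (T \<omega>) * I \<le> distortion_majorant \<omega> * I"
      by (rule mult_right_mono[OF distortion_le_majorant(2) I0])
    have "(V / min_expansion (T \<omega>) + distortion (T \<omega>) * I) * c \<le> (V * a \<omega> + distortion_majorant \<omega> * I) * c"
      by (rule mult_right_mono[OF add_mono[OF 1 2] c0])
    moreover have "mean (\<lambda>p. g p * h (T \<omega> p)) \<le> (V / min_expansion (T \<omega>) + distortion (T \<omega>) * I) * c"
      unfolding I_def using c by (intro test_integral_pullback_le[where k = k] g V C) auto
    ultimately show "mean (\<lambda>p. h (T \<omega> p) * g p) \<le> (V * a \<omega> + distortion_majorant \<omega> * I) * c"
      by (simp add: mult.commute)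
  qed
  also have "\<dots> = (contraction_rate * V + mean_distortion * I) * c"
    unfolding a(2) mean_distortion_def using integrable_distortion_majorant a(1) by simp
  finally show "mean (\<lambda>p. P g p * h p) \<le> (contraction_rate * V + mean_distortion * mean (\<lambda>p. \<bar>g p\<bar>)) * c"
    unfolding I_def .
qed

end

section \<open>Coupling of densities of bounded variation\<close>

lemma variation_le_mono:
  assumes "variation_le V g" "V \<le> W" shows "variation_le W g"
  unfolding variation_le_def
proof (intro allI impI)
  fix k h :: "circle \<Rightarrow> real" and c :: real
  assume C: "C1_on_circle k h" and c: "\<forall>p. \<bar>k p\<bar> \<le> c"
  have "0 \<le> c" using c by (meson abs_ge_zero order_trans)
  then have "V * c \<le> W * c" by (rule mult_right_mono[OF assms(2)])
  moreover have "mean (\<lambda>p. g p * h p) \<le> V * c"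
    using assms(1) C c unfolding variation_le_def by blast
  ultimately show "mean (\<lambda>p. g p * h p) \<le> W * c" by linarith
qed

lemma variation_le_affine:
  fixes g :: "circle \<Rightarrow> real"
  assumes g: "continuous_on UNIV g" and V: "variation_le V g" and a: "0 \<le> a"
  shows "variation_le (a * V) (\<lambda>p. a * g p + b)"
  unfolding variation_le_def
proof (intro allI impI)
  fix k h :: "circle \<Rightarrow> real" and c :: real
  assume C: "C1_on_circle k h" and c: "\<forall>p. \<bar>k p\<bar> \<le> c"
  note h = C1_on_circleD(1)[OF C]
  have "mean (\<lambda>p. (a * g p + b) * h p) = mean (\<lambda>p. a * (g p * h p) + b * h p)"
    by (simp add: algebra_simps)
  also have "\<dots> = mean (\<lambda>p. a * (g p * h p)) + mean (\<lambda>p. b * h p)"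
    by (intro Bochner_Integration.integral_add continuous_integrable_circle continuous_intros g h)
  also have "\<dots> = a * mean (\<lambda>p. g p * h p)"
    using C1_on_circle_integral_zero[OF C] by simp
  also have "\<dots> \<le> a * (V * c)"
    using V C c a unfolding variation_le_def by (intro mult_left_mono) auto
  finally show "mean (\<lambda>p. (a * g p + b) * h p) \<le> a * V * c" by simp
qed

text \<open>The class of densities that coupling preserves.\<close>

definition regular_density :: "real \<Rightarrow> (circle \<Rightarrow> real) \<Rightarrow> bool" where
  "regular_density B g \<longleftrightarrow> continuous_on UNIV g \<and> (\<forall>p. 0 \<le> g p) \<and>
     mean g = 1 \<and> variation_le B g"

lemma regular_densityD:
  assumes "regular_density B g"
  shows "continuous_on UNIV g" "0 \<le> g p" "mean g = 1" "variation_le B g"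
  using assms by (auto simp: regular_density_def)

text \<open>This exhibits the absolute value of the derivative as a limit of expressions that contain only values
  of the map, and so as a measurable function of the random map.\<close>

lemma (in circle_map) derivative_as_limit:
  "(\<lambda>n. real (Suc n) * dist (T (circle_proj (x + 1 / real (Suc n)))) (T (circle_proj x)))
     \<longlonglongrightarrow> \<bar>circle_deriv T (circle_proj x)\<bar>"
proof -
  obtain F d where F: "lift F d" using lift_exists by blast
  let ?e = "\<lambda>n. 1 / real (Suc n)"
  have e0: "?e \<longlonglongrightarrow> 0" using LIMSEQ_inverse_real_of_nat by (simp add: inverse_eq_divide)
  have "filterlim ?e (at 0) sequentially"
    using e0 by (intro filterlim_atI) auto
  moreover have "((\<lambda>h. (F (x + h) - F x) / h) \<longlongrightarrow> circle_deriv T (circle_proj x)) (at 0)"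
    using liftD(1)[OF F, of x] by (simp add: DERIV_def)
  ultimately have "(\<lambda>n. (F (x + ?e n) - F x) / ?e n) \<longlonglongrightarrow> circle_deriv T (circle_proj x)"
    by (rule filterlim_compose[rotated])
  then have lim: "(\<lambda>n. \<bar>(F (x + ?e n) - F x) / ?e n\<bar>) \<longlonglongrightarrow> \<bar>circle_deriv T (circle_proj x)\<bar>"
    by (rule tendsto_rabs)
  have "(\<lambda>n. F (x + ?e n) - F x) \<longlonglongrightarrow> F (x + 0) - F x"
    by (intro tendsto_diff isCont_tendsto_compose[of "x + 0" F] liftD(4)[OF F] tendsto_add e0 tendsto_const)
  then have "eventually (\<lambda>n. \<bar>F (x + ?e n) - F x\<bar> < 1/2) sequentially"
    using order_tendstoD(2)[OF tendsto_rabs, of "\<lambda>n. F (x + ?e n) - F x" 0 sequentially "1/2"] by simp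
  then have "eventually (\<lambda>n. \<bar>(F (x + ?e n) - F x) / ?e n\<bar> =
      real (Suc n) * dist (T (circle_proj (x + ?e n))) (T (circle_proj x))) sequentially"
  proof eventually_elim
    case (elim n)
    then have "dist (T (circle_proj (x + ?e n))) (T (circle_proj x)) = \<bar>F (x + ?e n) - F x\<bar>"
      unfolding liftD(2)[OF F, symmetric] by (intro dist_circle_proj) simp
    then show ?case by (simp add: abs_mult)
  qed
  from Lim_transform_eventually[OF lim this] show ?thesis .
qed

context random_circle_maps
begin

lemma measurable_abs_circle_deriv [measurable]:
  "(\<lambda>\<omega>. \<bar>circle_deriv (T \<omega>) (circle_proj x)\<bar>) \<in> borel_measurable \<eta>"
proof (rule borel_measurable_LIMSEQ_real)
  fix \<omega> assume "\<omega> \<in> space \<eta>"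
  then interpret circle_map "T \<omega>" by (rule circle_map)
  show "(\<lambda>n. real (Suc n) * dist (T \<omega> (circle_proj (x + 1 / real (Suc n)))) (T \<omega> (circle_proj x)))
     \<longlonglongrightarrow> \<bar>circle_deriv (T \<omega>) (circle_proj x)\<bar>"
    by (rule derivative_as_limit)
qed measurable

text \<open>The maps that stretch every arc by at least the factor \<open>l\<close> without diluting mass by more
  than the factor \<open>M\<close>.\<close>

definition expanding_event :: "real \<Rightarrow> real \<Rightarrow> 'w set" where
  "expanding_event l M = {\<omega> \<in> space \<eta>. l \<le> min_expansion (T \<omega>) \<and> (\<forall>p. \<bar>circle_deriv (T \<omega>) p\<bar> \<le> M)}"

lemma expanding_event_sets [measurable]:
  assumes "l > 0" shows "expanding_event l M \<in> sets \<eta>"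
proof -
  have "expanding_event l M = {\<omega> \<in> space \<eta>. 1 / (min_expansion (T \<omega>))\<^sup>2 \<le> 1 / l\<^sup>2 \<and>
      (\<forall>r::rat. \<bar>circle_deriv (T \<omega>) (circle_proj (of_rat r))\<bar> \<le> M)}"
    unfolding expanding_event_def
  proof (rule Collect_cong, rule conj_cong[OF refl])
    fix \<omega> assume "\<omega> \<in> space \<eta>"
    then interpret circle_map "T \<omega>" by (rule circle_map)
    have "(1 / (min_expansion (T \<omega>))\<^sup>2 \<le> 1 / l\<^sup>2) = (l\<^sup>2 \<le> (min_expansion (T \<omega>))\<^sup>2)"
      using min_expansion_pos assms by (simp add: field_simps)
    also have "\<dots> = (l \<le> min_expansion (T \<omega>))"
      using min_expansion_pos assms by (intro power_mono_iff) auto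
    finally have 1: "(l \<le> min_expansion (T \<omega>)) = (1 / (min_expansion (T \<omega>))\<^sup>2 \<le> 1 / l\<^sup>2)" by simp
    have "\<bar>circle_deriv (T \<omega>) p\<bar> \<le> M" if r: "\<And>r::rat. \<bar>circle_deriv (T \<omega>) (circle_proj (of_rat r))\<bar> \<le> M" for p
    proof -
      obtain x where x: "p = circle_proj x" using surj_circle_proj by blast
      have "closed {x. \<bar>circle_deriv (T \<omega>) (circle_proj x)\<bar> \<le> M}"
        by (intro closed_Collect_le continuous_intros continuous_on_lift continuous_circle_deriv)
      moreover have "\<rat> \<subseteq> {x. \<bar>circle_deriv (T \<omega>) (circle_proj x)\<bar> \<le> M}"
        using r by (auto elim: Rats_cases)
      ultimately have "closure \<rat> \<subseteq> {x. \<bar>circle_deriv (T \<omega>) (circle_proj x)\<bar> \<le> M}"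
        by (intro closure_minimal)
      then show ?thesis unfolding x Rats_closure_real by blast
    qed
    then show "(l \<le> min_expansion (T \<omega>) \<and> (\<forall>p. \<bar>circle_deriv (T \<omega>) p\<bar> \<le> M)) =
      (1 / (min_expansion (T \<omega>))\<^sup>2 \<le> 1 / l\<^sup>2 \<and> (\<forall>r::rat. \<bar>circle_deriv (T \<omega>) (circle_proj (of_rat r))\<bar> \<le> M))"
      unfolding 1 by blast
  qed
  also have "\<dots> \<in> sets \<eta>"
    using borel_measurable_integrable[OF integrable_contraction] by measurable
  finally show ?thesis .
qed

text \<open>If \<open>\<lambda> \<le> 1\<close> held almost surely, the mean of \<open>1/\<lambda>\<^sup>2\<close> would be at least 1. So \<open>\<lambda> > 1\<close> has positive
  probability, and this event is a countable union of events with uniform bounds.\<close>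

lemma expanding_event_positive:
  obtains l M where "l > 1" "M > 0" "noise.prob (expanding_event l M) > 0"
proof -
  define G where "G n = expanding_event (1 + 1 / real (Suc n)) (real (Suc n))" for n
  have G: "G n \<in> sets \<eta>" for n unfolding G_def by (rule expanding_event_sets) (simp add: add_pos_pos)
  have "\<exists>n. noise.prob (G n) > 0"
  proof (rule ccontr)
    assume "\<nexists>n. noise.prob (G n) > 0"
    then have "noise.prob (G n) = 0" for n by (metis measure_nonneg order_le_less)
    then have "AE \<omega> in \<eta>. \<omega> \<notin> G n" for n
      using G by (intro AE_not_in) (simp add: null_sets_def noise.emeasure_eq_measure)
    then have "AE \<omega> in \<eta>. \<forall>n. \<omega> \<notin> G n" unfolding AE_all_countable by blast
    then have "AE \<omega> in \<eta>. 1 \<le> 1 / (min_expansion (T \<omega>))\<^sup>2"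
      using AE_space
    proof eventually_elim
      case (elim \<omega>)
      interpret circle_map "T \<omega>" by (rule circle_map[OF elim(2)])
      have "min_expansion (T \<omega>) \<le> 1"
      proof (rule ccontr)
        assume "\<not> ?thesis"
        then have "min_expansion (T \<omega>) - 1 > 0" by simp
        then obtain n1 where n1: "1 / real (Suc n1) < min_expansion (T \<omega>) - 1" by (rule nat_approx_posE)
        obtain C where C: "\<And>p. \<bar>circle_deriv (T \<omega>) p\<bar> \<le> C"
          using continuous_circle_deriv by (rule continuous_on_circle_bounded) auto
        obtain n2 :: nat where n2: "C \<le> n2" using real_arch_simple by blast
        define n where "n = max n1 n2"
        have "1 / real (Suc n) \<le> 1 / real (Suc n1)" by (intro divide_left_mono) (auto simp: n_def)
        then have "1 + 1 / real (Suc n) \<le> min_expansion (T \<omega>)" using n1 by linarith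
        moreover have "\<bar>circle_deriv (T \<omega>) p\<bar> \<le> real (Suc n)" for p
          using C[of p] n2 by (auto simp: n_def)
        ultimately have "\<omega> \<in> G n" unfolding G_def expanding_event_def using elim(2) by blast
        then show False using elim(1) by blast
      qed
      then have "(min_expansion (T \<omega>))\<^sup>2 \<le> 1\<^sup>2" using min_expansion_pos by (intro power_mono) auto
      then show ?case using min_expansion_pos by simp
    qed
    then have "(\<integral>\<omega>. 1 \<partial>\<eta>) \<le> (\<integral>\<omega>. 1 / (min_expansion (T \<omega>))\<^sup>2 \<partial>\<eta>)"
      by (intro integral_mono_AE integrable_contraction) auto
    then show False using contraction_lt_1 by (simp add: noise.prob_space)
  qed
  then obtain n where "noise.prob (G n) > 0" by blast
  then show ?thesis by (intro that[of "1 + 1 / real (Suc n)" "real (Suc n)"]) (auto simp: G_def)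
qed

lemma continuous_P_iterate:
  fixes g :: "circle \<Rightarrow> real"
  shows "continuous_on UNIV g \<Longrightarrow> continuous_on UNIV ((P ^^ n) g)"
  by (induction n) (auto intro: continuous_P)

lemma integral_P_iterate:
  fixes g :: "circle \<Rightarrow> real"
  assumes "continuous_on UNIV g"
  shows "mean (\<lambda>p. (P ^^ n) g p) = mean g"
  by (induction n) (simp_all add: integral_P continuous_P_iterate assms)

lemma P_iterate_diff:
  fixes g1 g2 :: "circle \<Rightarrow> real"
  assumes "continuous_on UNIV g1" "continuous_on UNIV g2"
  shows "(P ^^ n) (\<lambda>p. g1 p - g2 p) = (\<lambda>p. (P ^^ n) g1 p - (P ^^ n) g2 p)"
  by (induction n) (simp_all add: P_diff continuous_P_iterate assms)

lemma P_iterate_cmult: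
  fixes g :: "circle \<Rightarrow> real"
  shows "(P ^^ n) (\<lambda>p. c * g p) = (\<lambda>p. c * (P ^^ n) g p)"
  by (induction n) (simp_all add: P_cmult)

lemma P_iterate_L1_contraction:
  fixes g :: "circle \<Rightarrow> real"
  assumes "continuous_on UNIV g"
  shows "mean (\<lambda>p. \<bar>(P ^^ n) g p\<bar>) \<le> mean (\<lambda>p. \<bar>g p\<bar>)"
proof (induction n)
  case (Suc n)
  then show ?case using P_L1_contraction[OF continuous_P_iterate[OF assms], of n] by simp
qed simp

lemma Q_iterate_norm_bounded:
  fixes f :: "circle \<Rightarrow> 'b::{banach, second_countable_topology}"
  assumes f: "f \<in> borel_measurable borel" and A: "\<And>p. norm (f p) \<le> A"
  shows "(Q ^^ n) f \<in> borel_measurable borel \<and> (\<forall>p. norm ((Q ^^ n) f p) \<le> A)"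
proof (induction n)
  case 0 then show ?case using f A by simp
next
  case (Suc n)
  then show ?case using measurable_Q[of "(Q ^^ n) f"] norm_Q_le[of "(Q ^^ n) f" A] by simp
qed

lemma Q_iterate_bounded:
  fixes f :: "circle \<Rightarrow> real"
  assumes f: "f \<in> borel_measurable borel" and A: "\<And>p. \<bar>f p\<bar> \<le> A"
  shows "(Q ^^ n) f \<in> borel_measurable borel" "\<bar>(Q ^^ n) f p\<bar> \<le> A"
  using Q_iterate_norm_bounded[of f A n] f A by auto

lemma Q_iterate_nonneg:
  fixes f :: "circle \<Rightarrow> real"
  assumes "\<And>p. 0 \<le> f p" shows "0 \<le> (Q ^^ n) f p"
  using assms by (induction n arbitrary: p) (auto simp: annealed_koopman_op_def intro!: integral_nonneg_AE)

lemma duality_iterate: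
  fixes f g :: "circle \<Rightarrow> real"
  assumes f: "f \<in> borel_measurable borel" and A: "\<And>p. \<bar>f p\<bar> \<le> A" and g: "continuous_on UNIV g"
  shows "mean (\<lambda>p. f p * (P ^^ n) g p) = mean (\<lambda>p. (Q ^^ n) f p * g p)"
  using f A
proof (induction n arbitrary: f)
  case 0 then show ?case by simp
next
  case (Suc n)
  have "mean (\<lambda>p. f p * (P ^^ Suc n) g p) = mean (\<lambda>p. Q f p * (P ^^ n) g p)"
    using duality[OF Suc.prems continuous_P_iterate[OF g]] by simp
  also have "\<dots> = mean (\<lambda>p. (Q ^^ n) (Q f) p * g p)"
    using Suc.IH[of "Q f"] Q_iterate_bounded[OF Suc.prems, of 1] by simp
  finally show ?case by (simp add: funpow_swap1)
qed

text \<open>The geometric series of the Lasota-Yorke inequality: the initial variation is forgotten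
  exponentially fast, and what remains is proportional to the mass.\<close>

lemma variation_P_iterate:
  fixes g :: "circle \<Rightarrow> real"
  assumes g: "continuous_on UNIV g" and V: "variation_le V g" and V0: "0 \<le> V"
  shows "variation_le (contraction_rate ^ n * V + mean_distortion / (1 - contraction_rate) * mean (\<lambda>p. \<bar>g p\<bar>)) ((P ^^ n) g)"
proof (induction n)
  define I where "I = mean (\<lambda>p. \<bar>g p\<bar>)"
  have I0: "0 \<le> I" unfolding I_def by (intro integral_nonneg_AE) auto
  define \<kappa> where "\<kappa> = mean_distortion / (1 - contraction_rate)"
  have \<kappa>: "0 \<le> \<kappa>" "contraction_rate * \<kappa> + mean_distortion = \<kappa>"
    using contraction_rate_bounds mean_distortion_nonneg by (auto simp: \<kappa>_def field_simps)
  {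
    case 0
    have "V \<le> contraction_rate ^ 0 * V + \<kappa> * I" using \<kappa>(1) I0 by simp
    from variation_le_mono[OF V this] show ?case unfolding I_def \<kappa>_def by simp
  next
    case (Suc n)
    let ?V = "contraction_rate ^ n * V + \<kappa> * I"
    have "0 \<le> ?V" using contraction_rate_bounds V0 \<kappa> I0 by simp
    then have 1: "variation_le (contraction_rate * ?V + mean_distortion * mean (\<lambda>p. \<bar>(P ^^ n) g p\<bar>)) (P ((P ^^ n) g))"
      using Suc unfolding I_def[symmetric] \<kappa>_def[symmetric] by (intro variation_P continuous_P_iterate g)
    have "mean_distortion * mean (\<lambda>p. \<bar>(P ^^ n) g p\<bar>) \<le> mean_distortion * I"
      unfolding I_def by (rule mult_left_mono[OF P_iterate_L1_contraction[OF g] mean_distortion_nonneg])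
    moreover have "contraction_rate * ?V + mean_distortion * I = contraction_rate ^ Suc n * V + (contraction_rate * \<kappa> + mean_distortion) * I"
      by (simp add: algebra_simps)
    ultimately have "contraction_rate * ?V + mean_distortion * mean (\<lambda>p. \<bar>(P ^^ n) g p\<bar>) \<le> contraction_rate ^ Suc n * V + \<kappa> * I"
      unfolding \<kappa>(2) by linarith
    from variation_le_mono[OF 1 this] show ?case unfolding I_def \<kappa>_def by simp
  }
qed

text \<open>By induction on the number of steps. If the first map is in the expanding event, it maps the arc onto
  one that is longer by the factor \<open>l\<close> and dilutes mass by at most \<open>M\<close>, and the induction
  hypothesis applies to the new arc whatever its position. All other maps are discarded.\<close>

lemma arcs_spread:
  fixes u :: "circle \<Rightarrow> real"
  assumes l: "l > 0" and M: "M > 0"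
    and u: "u \<in> borel_measurable borel" and u0: "\<And>p. 0 \<le> u p" and uB: "\<And>p. u p \<le> B"
  defines "c \<equiv> noise.prob (expanding_event l M) / M"
  assumes "a \<le> b" "1 \<le> l ^ k * (b - a)"
  shows "c ^ k * mean u \<le> mean (\<lambda>p. (Q ^^ k) u p * indicator (arc a b) p)"
  using assms(7,8)
proof (induction k arbitrary: a b)
  case 0
  then have "arc a b = UNIV" by (intro arc_full) simp
  then show ?case by simp
next
  case (Suc k)
  define v where "v = (Q ^^ k) u"
  define K where "K = c ^ k * mean u"
  have uabs: "\<bar>u p\<bar> \<le> B" for p using u0 uB by simp
  have v: "v \<in> borel_measurable borel" "\<And>p. \<bar>v p\<bar> \<le> B" "\<And>p. 0 \<le> v p"
    unfolding v_def using Q_iterate_bounded[OF u uabs] Q_iterate_nonneg[of u, OF u0] by auto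
  have vB: "v p \<le> B" for p using v(2)[of p] by linarith
  note ind = Q_pairing[of v B "indicator (arc a b)" 1, OF v(1,2)]
  have meas: "indicator (arc a b) \<in> borel_measurable borel" "\<And>p. \<bar>indicator (arc a b) p :: real\<bar> \<le> 1"
    by (auto simp: indicator_def)
  have "c ^ Suc k * mean u = (\<integral>\<omega>. indicator (expanding_event l M) \<omega> * (K / M) \<partial>\<eta>)"
    using expanding_event_sets[OF l, of M] sets.sets_into_space by (simp add: K_def c_def noise.emeasure_eq_measure Int_absorb2)
  also have "\<dots> \<le> (\<integral>\<omega>. \<integral>p. v (T \<omega> p) * indicator (arc a b) p \<partial>circle_measure \<partial>\<eta>)"
  proof (rule integral_mono)
    show "integrable \<eta> (\<lambda>\<omega>. indicator (expanding_event l M) \<omega> * (K / M))"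
      using expanding_event_sets[OF l, of M] by (intro integrable_mult_left integrable_real_indicator) (auto simp: noise.emeasure_eq_measure)
    show "integrable \<eta> (\<lambda>\<omega>. \<integral>p. v (T \<omega> p) * indicator (arc a b) p \<partial>circle_measure)"
      by (rule ind(2)[OF meas])
    fix \<omega> assume \<omega>: "\<omega> \<in> space \<eta>"
    then interpret circle_map "T \<omega>" by (rule circle_map)
    show "indicator (expanding_event l M) \<omega> * (K / M) \<le> mean (\<lambda>p. v (T \<omega> p) * indicator (arc a b) p)"
    proof (cases "\<omega> \<in> expanding_event l M")
      case True
      then have e: "l \<le> \<bar>circle_deriv (T \<omega>) p\<bar>" "\<bar>circle_deriv (T \<omega>) p\<bar> \<le> M" for p
        using min_expansion_le[of p] unfolding expanding_event_def by auto
      obtain a' b' where ab': "a' \<le> b'" "l * (b - a) \<le> b' - a'" "T \<omega> ` arc a b = arc a' b'"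
        using image_arc[OF Suc.prems(1) e(1)] by blast
      have "1 \<le> l ^ k * (l * (b - a))" using Suc.prems(2) by (simp add: mult_ac)
      also have "\<dots> \<le> l ^ k * (b' - a')" using l ab'(2) by (intro mult_left_mono) auto
      finally have "K \<le> mean (\<lambda>p. v p * indicator (T \<omega> ` arc a b) p)"
        unfolding K_def v_def ab'(3) by (intro Suc.IH ab'(1))
      then have "K / M \<le> mean (\<lambda>p. v p * indicator (T \<omega> ` arc a b) p) / M"
        using M by (simp add: divide_right_mono)
      also have "\<dots> \<le> mean (\<lambda>p. v (T \<omega> p) * indicator (arc a b) p)"
        by (rule integral_over_arc_ge[OF e(2) _ _ v(1,3) vB]) (auto simp: ab'(3))
      finally show ?thesis using True by simp
    next
      case False
      have "0 \<le> mean (\<lambda>p. v (T \<omega> p) * indicator (arc a b) p)"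
        using v(3) by (intro integral_nonneg_AE) auto
      then show ?thesis using False by simp
    qed
  qed
  also have "\<dots> = mean (\<lambda>p. (Q ^^ Suc k) u p * indicator (arc a b) p)"
    using ind(1)[OF meas] by (simp add: v_def)
  finally show ?case .
qed

text \<open>The lower bound is first obtained in integrated form, against any nonnegative function. Testing with
  the positive part of \<open>\<epsilon> - (P ^^ N) g\<close> makes it pointwise.\<close>

lemma P_iterate_positive:
  "\<exists>N0. \<forall>N\<ge>N0. \<exists>\<epsilon>>0. \<epsilon> \<le> 1/2 \<and> (\<forall>g p. regular_density B g \<longrightarrow> \<epsilon> \<le> (P ^^ N) g p)"
proof -
  obtain l M where l: "l > 1" and M: "M > 0" and pos: "noise.prob (expanding_event l M) > 0"
    by (rule expanding_event_positive)
  define c where "c = noise.prob (expanding_event l M) / M"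
  have c: "c > 0" using pos M by (simp add: c_def)
  obtain K0 :: nat where K0: "2 * B \<le> K0" using real_arch_simple by blast
  define K where "K = Suc K0"
  have K: "K \<ge> 1" "2 * B \<le> K" using K0 by (auto simp: K_def)
  obtain N0 where N0: "2 * real K < l ^ N0" using real_arch_pow[OF l] by blast
  show ?thesis
  proof (intro exI[of _ N0] allI impI)
    fix N assume "N0 \<le> N"
    then have "l ^ N0 \<le> l ^ N" using l by (intro power_increasing) auto
    then have N: "2 * real K \<le> l ^ N" using N0 by linarith
    define \<epsilon> where "\<epsilon> = min (1/2) (c ^ N / 2)"
    have \<epsilon>: "\<epsilon> > 0" "\<epsilon> \<le> 1/2" "\<epsilon> \<le> c ^ N / 2" using c by (auto simp: \<epsilon>_def)
    have "\<epsilon> \<le> (P ^^ N) g p" if reg: "regular_density B g" for g p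
    proof -
      note [simp] = regular_densityD(2)[OF reg]
      note g = regular_densityD(1)[OF reg] and int = regular_densityD(3)[OF reg] and var = regular_densityD(4)[OF reg]
      obtain j where j: "\<And>x. j / K < x \<Longrightarrow> x < (real j + 1) / K \<Longrightarrow> 1/2 \<le> g (circle_proj x)"
        using arc_with_half_mass[OF g var int K] by blast
      (* the lower bound holds in an open arc, so shrink it to a closed one *)
      define a b where "a = (real j + 1/4) / K" and "b = (real j + 3/4) / K"
      have ab: "j / K < a" "b < (real j + 1) / K" "a \<le> b" "b - a = 1 / (2 * K)"
        using K(1) by (auto simp: a_def b_def field_simps)
      have half: "indicator (arc a b) q / 2 \<le> g q" for q
        using j ab by (force simp: arc_def indicator_def)
      have long: "1 \<le> l ^ N * (b - a)" using N K(1) by (simp add: ab(4) field_simps)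
      define u where "u q = max 0 (\<epsilon> - (P ^^ N) g q)" for q
      note Pg = continuous_P_iterate[OF g, of N]
      have u: "continuous_on UNIV u" unfolding u_def by (intro continuous_intros Pg)
      have um: "u \<in> borel_measurable borel" by (rule continuous_measurable_circle[OF u])
      have u0: "0 \<le> u q" for q by (simp add: u_def)
      obtain A where A: "\<And>q. \<bar>u q\<bar> \<le> A" using u by (rule continuous_on_circle_bounded) auto
      have uA: "u q \<le> A" for q using A[of q] by linarith
      note Qu = Q_iterate_bounded[OF um A, of N]
      have A0: "0 \<le> A" using A[of undefined] by linarith
      obtain Bg where Bg: "\<And>q. \<bar>g q\<bar> \<le> Bg" using g by (rule continuous_on_circle_bounded) auto
      have iu: "0 \<le> mean u" using u0 by (intro integral_nonneg_AE) auto
      have "\<epsilon> * mean u \<le> (c ^ N / 2) * mean u"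
        by (rule mult_right_mono[OF \<epsilon>(3) iu])
      also have "\<dots> \<le> mean (\<lambda>q. (Q ^^ N) u q * indicator (arc a b) q) / 2"
        using arcs_spread[of l M u A a b N, OF _ M um u0 uA ab(3) long] l by (simp add: c_def)
      also have "\<dots> = mean (\<lambda>q. (Q ^^ N) u q * (indicator (arc a b) q / 2))" by simp
      also have "\<dots> \<le> mean (\<lambda>q. (Q ^^ N) u q * g q)"
      proof (rule integral_mono)
        show "integrable circle_measure (\<lambda>q. (Q ^^ N) u q * (indicator (arc a b) q / 2))"
        proof (rule bounded_integrable_circle[where B = "A * 1"])
          show "(\<lambda>q. (Q ^^ N) u q * (indicator (arc a b) q / 2)) \<in> borel_measurable borel"
            using Qu(1) by measurable
          show "norm ((Q ^^ N) u q * (indicator (arc a b) q / 2)) \<le> A * 1" for q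
            unfolding real_norm_def abs_mult by (rule mult_mono[OF Qu(2) _ A0]) (auto simp: indicator_def)
        qed
        show "integrable circle_measure (\<lambda>q. (Q ^^ N) u q * g q)"
        proof (rule bounded_integrable_circle[where B = "A * Bg"])
          show "(\<lambda>q. (Q ^^ N) u q * g q) \<in> borel_measurable borel"
            using Qu(1) continuous_measurable_circle[OF g] by measurable
          show "norm ((Q ^^ N) u q * g q) \<le> A * Bg" for q
            unfolding real_norm_def abs_mult by (rule mult_mono[OF Qu(2) Bg A0]) auto
        qed
        show "(Q ^^ N) u q * (indicator (arc a b) q / 2) \<le> (Q ^^ N) u q * g q" for q
          by (rule mult_left_mono[OF half Q_iterate_nonneg[of u, OF u0]])
      qed
      also have "\<dots> = mean (\<lambda>q. u q * (P ^^ N) g q)"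
        by (rule duality_iterate[OF um A g, symmetric])
      finally have "0 \<le> mean (\<lambda>q. u q * (P ^^ N) g q) - mean (\<lambda>q. u q * \<epsilon>)"
        by (simp add: mult.commute)
      also have "\<dots> = mean (\<lambda>q. u q * (P ^^ N) g q - u q * \<epsilon>)"
        by (intro Bochner_Integration.integral_diff[symmetric] continuous_integrable_circle continuous_intros u Pg)
      also have "\<dots> = mean (\<lambda>q. - (u q * u q))"
        by (rule Bochner_Integration.integral_cong) (auto simp: u_def max_def algebra_simps)
      finally have "mean (\<lambda>q. u q * u q) \<le> 0" by simp
      moreover have "0 \<le> mean (\<lambda>q. u q * u q)" by (intro integral_nonneg_AE) auto
      ultimately have "mean (\<lambda>q. u q * u q) = 0" by linarith
      then have "u p * u p = 0"
        by (rule continuous_nonneg_integral_zero[rotated 2]) (auto intro!: continuous_intros u)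
      then show ?thesis by (simp add: u_def max_def split: if_splits)
    qed
    then show "\<exists>\<epsilon>>0. \<epsilon> \<le> 1/2 \<and> (\<forall>g p. regular_density B g \<longrightarrow> \<epsilon> \<le> (P ^^ N) g p)"
      using \<epsilon> by blast
  qed
qed

text \<open>Let \<open>\<kappa>\<close> be the variation that remains in the long run by \<open>variation_P_iterate\<close>. First \<open>B\<close> is
  chosen so large that \<open>\<kappa> \<le> B/4\<close>, and then \<open>N\<close> so large that \<open>(P ^^ N) g\<close> has
  variation at most \<open>B/2\<close>. Removing the constant \<open>\<epsilon>\<close> leaves the variation unchanged, and since
  \<open>\<epsilon> \<le> 1/2\<close>, renormalising at most doubles it.\<close>

lemma coupling_step:
  obtains B N \<epsilon> where "1 \<le> B" "0 < N" "0 < \<epsilon>" "\<epsilon> < 1"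
    "\<And>g. regular_density B g \<Longrightarrow>
       \<exists>h. regular_density B h \<and> (P ^^ N) g = (\<lambda>p. \<epsilon> + (1 - \<epsilon>) * h p)"
proof -
  define \<kappa> where "\<kappa> = mean_distortion / (1 - contraction_rate)"
  have \<kappa>: "0 \<le> \<kappa>" using contraction_rate_bounds mean_distortion_nonneg by (simp add: \<kappa>_def)
  define B where "B = 4 * \<kappa> + 4"
  obtain N0 where N0: "\<And>N. N \<ge> N0 \<Longrightarrow> \<exists>\<epsilon>>0. \<epsilon> \<le> 1/2 \<and> (\<forall>g p. regular_density B g \<longrightarrow> \<epsilon> \<le> (P ^^ N) g p)"
    using P_iterate_positive[of B] by blast
  obtain N1 where N1: "contraction_rate ^ N1 < 1/4"
    using real_arch_pow_inv[of "1/4" contraction_rate] contraction_rate_bounds by auto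
  define N where "N = Suc (max N0 N1)"
  have "contraction_rate ^ N \<le> contraction_rate ^ N1" using contraction_rate_bounds by (intro power_decreasing) (auto simp: N_def)
  then have rN: "contraction_rate ^ N \<le> 1/4" using N1 by linarith
  have "N \<ge> N0" by (simp add: N_def)
  from N0[OF this] obtain \<epsilon> where \<epsilon>: "\<epsilon> > 0" "\<epsilon> \<le> 1/2"
    and low: "\<And>g p. regular_density B g \<Longrightarrow> \<epsilon> \<le> (P ^^ N) g p" by blast
  have step: "\<exists>h. regular_density B h \<and> (P ^^ N) g = (\<lambda>p. \<epsilon> + (1 - \<epsilon>) * h p)" if reg: "regular_density B g" for g
  proof -
    note g = regular_densityD(1)[OF reg] and int = regular_densityD(3)[OF reg] and var = regular_densityD(4)[OF reg]
    note Pg = continuous_P_iterate[OF g, of N]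
    define a b where "a = 1 / (1 - \<epsilon>)" and "b = - \<epsilon> / (1 - \<epsilon>)"
    have ab: "0 \<le> a" "a \<le> 2" "b = - \<epsilon> * a" "(1 - \<epsilon>) * a = 1" using \<epsilon> by (auto simp: a_def b_def field_simps)
    define h where "h p = a * (P ^^ N) g p + b" for p
    have h: "continuous_on UNIV h" unfolding h_def by (intro continuous_intros Pg)
    have h_eq: "h p = a * ((P ^^ N) g p - \<epsilon>)" for p by (simp add: h_def ab(3) algebra_simps)
    have h0: "0 \<le> h p" for p
      unfolding h_eq using low[OF reg, of p] ab(1) by simp
    have "mean h = a * mean (\<lambda>p. (P ^^ N) g p - \<epsilon>)"
      unfolding h_eq by simp
    also have "mean (\<lambda>p. (P ^^ N) g p - \<epsilon>) = 1 - \<epsilon>"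
      using continuous_integrable_circle[OF Pg] integral_P_iterate[OF g, of N] int circle.prob_space by simp
    finally have hint: "mean h = 1" using ab(4) by (simp add: mult.commute)
    have B0: "0 \<le> B" using \<kappa> by (simp add: B_def)
    have "mean (\<lambda>p. \<bar>g p\<bar>) = 1" using int regular_densityD(2)[OF reg] by simp
    with variation_P_iterate[OF g var B0, of N] have "variation_le (contraction_rate ^ N * B + \<kappa>) ((P ^^ N) g)"
      by (simp add: \<kappa>_def)
    moreover have "contraction_rate ^ N * B + \<kappa> \<le> B / 2"
      using mult_right_mono[OF rN B0] by (simp add: B_def)
    ultimately have "variation_le (B / 2) ((P ^^ N) g)" by (rule variation_le_mono)
    from variation_le_affine[OF Pg this ab(1), of b] have "variation_le (a * (B / 2)) h"
      by (simp only: h_def[abs_def])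
    moreover have "a * (B / 2) \<le> B" using mult_right_mono[OF ab(2), of "B / 2"] B0 by simp
    ultimately have hvar: "variation_le B h" by (rule variation_le_mono)
    have "(1 - \<epsilon>) * h p = ((1 - \<epsilon>) * a) * ((P ^^ N) g p - \<epsilon>)" for p
      unfolding h_eq by (simp only: mult.assoc)
    then have "(P ^^ N) g = (\<lambda>p. \<epsilon> + (1 - \<epsilon>) * h p)" unfolding ab(4) by (intro ext) simp
    then show ?thesis using h h0 hint hvar unfolding regular_density_def by blast
  qed
  show ?thesis
    by (rule that[of B N \<epsilon>, OF _ _ \<epsilon>(1) _ step]) (use \<epsilon> \<kappa> in \<open>auto simp: B_def N_def\<close>)
qed

lemma regular_densities_merge:
  obtains B \<theta> C where "1 \<le> B" "0 < \<theta>" "\<theta> < 1" "0 < C"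
    "\<And>g1 g2 n. regular_density B g1 \<Longrightarrow> regular_density B g2 \<Longrightarrow>
       mean (\<lambda>p. \<bar>(P ^^ n) g1 p - (P ^^ n) g2 p\<bar>) \<le> C * \<theta> ^ n"
proof -
  obtain B N \<epsilon> where B: "1 \<le> B" and N: "0 < N" and \<epsilon>: "0 < \<epsilon>" "\<epsilon> < 1"
    and step: "\<And>g. regular_density B g \<Longrightarrow>
       \<exists>h. regular_density B h \<and> (P ^^ N) g = (\<lambda>p. \<epsilon> + (1 - \<epsilon>) * h p)"
    by (rule coupling_step) blast
  have blocks: "mean (\<lambda>p. \<bar>(P ^^ (N * k)) g1 p - (P ^^ (N * k)) g2 p\<bar>) \<le> 2 * (1 - \<epsilon>) ^ k"
    if "regular_density B g1" "regular_density B g2" for g1 g2 k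
    using that
  proof (induction k arbitrary: g1 g2)
    case 0
    have c: "continuous_on UNIV g1" "continuous_on UNIV g2" using 0 by (auto dest: regular_densityD(1))
    have "mean (\<lambda>p. \<bar>g1 p - g2 p\<bar>) \<le> mean (\<lambda>p. g1 p + g2 p)"
    proof (intro integral_mono continuous_integrable_circle continuous_intros c)
      fix p
      have "0 \<le> g1 p" "0 \<le> g2 p" using 0 by (auto simp: regular_density_def)
      then show "\<bar>g1 p - g2 p\<bar> \<le> g1 p + g2 p" by linarith
    qed
    also have "\<dots> = mean g1 + mean g2"
      by (intro Bochner_Integration.integral_add continuous_integrable_circle c)
    also have "\<dots> = 2" using 0 by (simp add: regular_density_def)
    finally show ?case by simp
  next
    case (Suc k)
    obtain h1 where h1: "regular_density B h1" "(P ^^ N) g1 = (\<lambda>p. \<epsilon> + (1 - \<epsilon>) * h1 p)"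
      using step[OF Suc.prems(1)] by blast
    obtain h2 where h2: "regular_density B h2" "(P ^^ N) g2 = (\<lambda>p. \<epsilon> + (1 - \<epsilon>) * h2 p)"
      using step[OF Suc.prems(2)] by blast
    have c: "continuous_on UNIV g1" "continuous_on UNIV g2" "continuous_on UNIV h1" "continuous_on UNIV h2"
      using Suc.prems h1 h2 by (auto simp: regular_density_def)
    have "(\<lambda>p. (P ^^ (N * Suc k)) g1 p - (P ^^ (N * Suc k)) g2 p) = (P ^^ (N * k + N)) (\<lambda>p. g1 p - g2 p)"
      unfolding P_iterate_diff[OF c(1,2)] by (simp add: add.commute)
    also have "\<dots> = (P ^^ (N * k)) (\<lambda>p. (P ^^ N) g1 p - (P ^^ N) g2 p)"
      unfolding funpow_add o_apply P_iterate_diff[OF c(1,2)] ..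
    also have "(\<lambda>p. (P ^^ N) g1 p - (P ^^ N) g2 p) = (\<lambda>p. (1 - \<epsilon>) * (h1 p - h2 p))"
      unfolding h1(2) h2(2) by (simp add: algebra_simps)
    also have "(P ^^ (N * k)) \<dots> = (\<lambda>p. (1 - \<epsilon>) * ((P ^^ (N * k)) h1 p - (P ^^ (N * k)) h2 p))"
      unfolding P_iterate_cmult P_iterate_diff[OF c(3,4)] ..
    finally have eq: "(P ^^ (N * Suc k)) g1 p - (P ^^ (N * Suc k)) g2 p =
        (1 - \<epsilon>) * ((P ^^ (N * k)) h1 p - (P ^^ (N * k)) h2 p)" for p
      by (rule fun_cong)
    have "mean (\<lambda>p. \<bar>(P ^^ (N * Suc k)) g1 p - (P ^^ (N * Suc k)) g2 p\<bar>)
      = (1 - \<epsilon>) * mean (\<lambda>p. \<bar>(P ^^ (N * k)) h1 p - (P ^^ (N * k)) h2 p\<bar>)"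
      unfolding eq abs_mult using \<epsilon> by simp
    also have "\<dots> \<le> (1 - \<epsilon>) * (2 * (1 - \<epsilon>) ^ k)"
      using Suc.IH[OF h1(1) h2(1)] \<epsilon> by (intro mult_left_mono) auto
    finally show ?case by simp
  qed
  define \<theta> where "\<theta> = root N (1 - \<epsilon>)"
  have \<theta>: "0 < \<theta>" "\<theta> < 1" "\<theta> ^ N = 1 - \<epsilon>"
    using N \<epsilon> real_root_lt_1_iff[OF N, of "1 - \<epsilon>"] by (auto simp: \<theta>_def real_root_pow_pos2)
  show ?thesis
  proof (rule that[OF B \<theta>(1,2), of "2 / (1 - \<epsilon>)"])
    show "0 < 2 / (1 - \<epsilon>)" using \<epsilon> by simp
    fix g1 g2 n assume g: "regular_density B g1" "regular_density B g2"
    have c: "continuous_on UNIV g1" "continuous_on UNIV g2"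
      using g by (auto simp: regular_density_def)
    define k r where "k = n div N" and "r = n mod N"
    have n: "n = r + N * k" by (simp add: k_def r_def)
    have "(P ^^ n) (\<lambda>p. g1 p - g2 p) = (P ^^ r) ((P ^^ (N * k)) (\<lambda>p. g1 p - g2 p))"
      unfolding n funpow_add by simp
    then have "mean (\<lambda>p. \<bar>(P ^^ n) (\<lambda>p. g1 p - g2 p) p\<bar>)
      \<le> mean (\<lambda>p. \<bar>(P ^^ (N * k)) (\<lambda>p. g1 p - g2 p) p\<bar>)"
      using P_iterate_L1_contraction[OF continuous_P_iterate[of "\<lambda>p. g1 p - g2 p" "N * k"], of r] c
      by (auto intro!: continuous_intros)
    also have "\<dots> \<le> 2 * (1 - \<epsilon>) ^ k"
      using blocks[OF g, of k] by (simp add: P_iterate_diff[OF c])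
    also have "\<dots> = 2 / (1 - \<epsilon>) * \<theta> ^ (N * Suc k)"
      using \<epsilon> by (simp add: power_mult \<theta>(3) del: mult_Suc_right)
    also have "\<dots> \<le> 2 / (1 - \<epsilon>) * \<theta> ^ n"
    proof (intro mult_left_mono power_decreasing)
      have "r \<le> N" unfolding r_def using N by (simp add: less_imp_le)
      then show "n \<le> N * Suc k" unfolding n by simp
    qed (use \<theta> \<epsilon> in auto)
    finally show "mean (\<lambda>p. \<bar>(P ^^ n) g1 p - (P ^^ n) g2 p\<bar>) \<le> 2 / (1 - \<epsilon>) * \<theta> ^ n"
      by (simp add: P_iterate_diff[OF c])
  qed
qed

text \<open>If \<open>u\<close> is bounded by \<open>V\<close>, both in absolute value and in variation, then \<open>1 + u/V\<close> is a regular density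
  and \<open>u\<close> is \<open>V\<close> times its difference from the constant density.\<close>

lemma mean_zero_decay:
  obtains \<theta> C where "0 < \<theta>" "\<theta> < 1" "0 < C"
    "\<And>u V n. continuous_on UNIV u \<Longrightarrow> mean u = 0 \<Longrightarrow> 0 < V \<Longrightarrow>
       (\<And>p. \<bar>u p\<bar> \<le> V) \<Longrightarrow> variation_le V u \<Longrightarrow>
       mean (\<lambda>p. \<bar>(P ^^ n) u p\<bar>) \<le> C * V * \<theta> ^ n"
proof -
  obtain B \<theta> C where B: "1 \<le> B" and \<theta>: "0 < \<theta>" "\<theta> < 1" and C: "0 < C"
    and merge: "\<And>g1 g2 n. regular_density B g1 \<Longrightarrow> regular_density B g2 \<Longrightarrow>
       mean (\<lambda>p. \<bar>(P ^^ n) g1 p - (P ^^ n) g2 p\<bar>) \<le> C * \<theta> ^ n"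
    by (rule regular_densities_merge) blast
  show ?thesis
  proof (rule that[OF \<theta> C])
    fix u V n
    assume u: "continuous_on UNIV u" and int: "mean u = 0" and V: "0 < V"
      and bound: "\<And>p. \<bar>u p\<bar> \<le> V" and var: "variation_le V u"
    define g where "g p = 1 / V * u p + 1" for p
    have g: "continuous_on UNIV g" unfolding g_def by (intro continuous_intros u)
    have "variation_le (1 / V * V) g"
      unfolding g_def by (rule variation_le_affine[OF u var]) (use V in simp)
    then have "variation_le B g" by (rule variation_le_mono) (use V B in simp)
    moreover have "0 \<le> g p" for p using bound[of p] V by (simp add: g_def field_simps abs_le_iff)
    moreover have "mean g = 1"
      unfolding g_def using continuous_integrable_circle[OF u] int circle.prob_space by simp
    ultimately have rg: "regular_density B g" using g unfolding regular_density_def by blast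
    have "variation_le 0 (\<lambda>_. 1)" unfolding variation_le_def using C1_on_circle_integral_zero by simp
    then have "variation_le B (\<lambda>_. 1)" by (rule variation_le_mono) (use B in simp)
    then have r1: "regular_density B (\<lambda>_. 1)"
      unfolding regular_density_def using circle.prob_space by simp
    have "u = (\<lambda>p. V * (g p - 1))" using V by (auto simp: g_def)
    then have "(P ^^ n) u = (\<lambda>p. V * ((P ^^ n) g p - (P ^^ n) (\<lambda>_. 1) p))"
      using P_iterate_cmult[of n V "\<lambda>p. g p - 1"] P_iterate_diff[OF g, of "\<lambda>_. 1" n] by simp
    then have "mean (\<lambda>p. \<bar>(P ^^ n) u p\<bar>) = V * mean (\<lambda>p. \<bar>(P ^^ n) g p - (P ^^ n) (\<lambda>_. 1) p\<bar>)"
      using V by (simp add: abs_mult)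
    also have "\<dots> \<le> V * (C * \<theta> ^ n)" using merge[OF rg r1, of n] V by (intro mult_left_mono) auto
    finally show "mean (\<lambda>p. \<bar>(P ^^ n) u p\<bar>) \<le> C * V * \<theta> ^ n" by (simp add: mult_ac)
  qed
qed

end

section \<open>From bounded variation to Hoelder regularity\<close>

lemma variation_le_C1:
  assumes w: "C1_on_circle w w'" and L: "\<And>p. \<bar>w' p\<bar> \<le> L"
  shows "variation_le L w"
  unfolding variation_le_def
proof (intro allI impI)
  fix k h :: "circle \<Rightarrow> real" and c :: real
  assume C: "C1_on_circle k h" and c: "\<forall>p. \<bar>k p\<bar> \<le> c"
  note cont = C1_on_circleD(1,2)[OF C] C1_on_circleD(1,2)[OF w]
  have L0: "0 \<le> L" using L[of undefined] by linarith
  have "C1_on_circle (\<lambda>p. w p * k p) (\<lambda>p. w p * h p + w' p * k p)"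
    unfolding C1_on_circle_def
  proof (intro conjI allI)
    show "continuous_on UNIV (\<lambda>p. w p * h p + w' p * k p)" by (intro continuous_intros cont)
    show "((\<lambda>x. w (circle_proj x) * k (circle_proj x)) has_real_derivative
        w (circle_proj x) * h (circle_proj x) + w' (circle_proj x) * k (circle_proj x)) (at x)" for x
      using DERIV_mult[OF C1_on_circleD(3)[OF w, of x] C1_on_circleD(3)[OF C, of x]] by (simp add: algebra_simps)
  qed
  then have "mean (\<lambda>p. w p * h p + w' p * k p) = 0" by (rule C1_on_circle_integral_zero)
  moreover have "mean (\<lambda>p. w p * h p + w' p * k p)
      = mean (\<lambda>p. w p * h p) + mean (\<lambda>p. w' p * k p)"
    by (intro Bochner_Integration.integral_add continuous_integrable_circle continuous_intros cont)
  ultimately have "mean (\<lambda>p. w p * h p) = mean (\<lambda>p. - (w' p * k p))" by simp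
  also have "\<dots> \<le> mean (\<lambda>p. L * c)"
  proof (intro integral_mono continuous_integrable_circle continuous_intros cont)
    fix p
    have "- (w' p * k p) \<le> \<bar>w' p\<bar> * \<bar>k p\<bar>" by (simp flip: abs_mult)
    also have "\<dots> \<le> L * c" by (rule mult_mono[OF L _ L0]) (use c in auto)
    finally show "- (w' p * k p) \<le> L * c" .
  qed
  finally show "mean (\<lambda>p. w p * h p) \<le> L * c" using circle.prob_space by simp
qed

lemma holder_continuous:
  fixes u :: "circle \<Rightarrow> 'b::real_normed_vector"
  assumes \<alpha>: "0 < \<alpha>" and holder: "\<And>p q. norm (u p - u q) \<le> H * dist p q powr \<alpha>"
  shows "continuous_on UNIV u"
  unfolding continuous_on_iff
proof (intro ballI allI impI)
  fix p :: circle and e :: real assume e: "0 < e"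
  define d where "d = (e / (\<bar>H\<bar> + 1)) powr (1 / \<alpha>)"
  have d: "d > 0" "d powr \<alpha> = e / (\<bar>H\<bar> + 1)" using e \<alpha> by (auto simp: d_def powr_powr)
  show "\<exists>d>0. \<forall>q\<in>UNIV. dist q p < d \<longrightarrow> dist (u q) (u p) < e"
  proof (intro exI[of _ d] conjI ballI impI d(1))
    fix q assume q: "dist q p < d"
    have "dist (u q) (u p) \<le> H * dist q p powr \<alpha>" using holder[of q p] by (simp add: dist_norm)
    also have "\<dots> \<le> \<bar>H\<bar> * d powr \<alpha>"
      using q \<alpha> by (intro mult_mono powr_mono2) auto
    also have "\<dots> < (\<bar>H\<bar> + 1) * d powr \<alpha>" using d(1) by (intro mult_strict_right_mono) auto
    also have "\<dots> = e" using d(2) by simp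
    finally show "dist (u q) (u p) < e" .
  qed
qed

text \<open>The smoothed function \<open>w\<close> at \<open>p\<close> is the mean of \<open>u\<close> over the arc of length \<open>s\<close> that starts at \<open>p\<close>.\<close>

lemma holder_smoothing:
  fixes u :: "circle \<Rightarrow> real"
  assumes \<alpha>: "0 < \<alpha>" and bound: "\<And>p. \<bar>u p\<bar> \<le> H"
    and holder: "\<And>p q. \<bar>u p - u q\<bar> \<le> H * dist p q powr \<alpha>" and s: "0 < s"
  obtains w where "continuous_on UNIV w" "\<And>p. \<bar>w p\<bar> \<le> H" "variation_le (2 * H / s) w"
    "\<And>p. \<bar>u p - w p\<bar> \<le> H * s powr \<alpha>"
proof -
  have u: "continuous_on UNIV u" by (rule holder_continuous[OF \<alpha>, of u H]) (simp add: holder)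
  have H: "0 \<le> H" using bound[of undefined] by linarith
  obtain U where U: "\<And>x. (U has_real_derivative u (circle_proj x)) (at x)"
    "\<And>x. U (x + 1) = U x + mean u"
    using circle_antiderivative[OF u] by blast
  define w where "w p = (U (circle_coord p + s) - U (circle_coord p)) / s" for p
  define w' where "w' p = (u (circle_proj (circle_coord p + s)) - u p) / s" for p
  have Uint: "U (x + of_int k) = U x + of_int k * mean u" for x k
    by (rule add_int_of_add_one[of U]) (rule U(2))
  have w_proj: "w (circle_proj x) = (U (x + s) - U x) / s" for x
  proof -
    define k where "k = - \<lfloor>x\<rfloor>"
    have "frac x = x + of_int k" "frac x + s = (x + s) + of_int k" by (auto simp: k_def frac_def)
    then have "w (circle_proj x) = (U ((x + s) + of_int k) - U (x + of_int k)) / s"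
      by (simp only: w_def circle_coord_proj)
    then show ?thesis unfolding Uint by simp
  qed
  have w'_proj: "w' (circle_proj x) = (u (circle_proj (x + s)) - u (circle_proj x)) / s" for x
  proof -
    have "circle_proj (frac x + s) = circle_proj (x + s)"
      by (simp add: circle_proj_eq_iff frac_def)
    then show ?thesis by (simp add: w'_def)
  qed
  have cu: "isCont (\<lambda>x. u (circle_proj x)) x" for x
    using continuous_on_lift[OF u, of UNIV] by (simp add: continuous_on_eq_continuous_at)
  have cus: "isCont (\<lambda>x. u (circle_proj (x + s))) x" for x
    by (rule isCont_o2[where g = "\<lambda>x. u (circle_proj x)" and f = "\<lambda>x. x + s"]) (auto intro!: continuous_intros cu)
  have C1: "C1_on_circle w w'"
    unfolding C1_on_circle_def
  proof (intro conjI allI)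
    show "continuous_on UNIV w'"
    proof (rule continuous_on_circleI)
      show "isCont (\<lambda>x. w' (circle_proj x)) x" for x
        unfolding w'_proj by (intro continuous_intros cu cus) (use s in auto)
    qed
    fix x
    have "((\<lambda>x. U (x + s)) has_real_derivative u (circle_proj (x + s))) (at x)"
      using U(1)[of "x + s"] by (simp add: DERIV_shift)
    then show "((\<lambda>x. w (circle_proj x)) has_real_derivative w' (circle_proj x)) (at x)"
      unfolding w_proj w'_proj by (intro DERIV_cdivide DERIV_diff U(1))
  qed
  have mvt: "\<exists>q. w p = u q \<and> dist p q \<le> s" for p
  proof -
    obtain x where x: "p = circle_proj x" using surj_circle_proj by blast
    obtain z where z: "x < z" "z < x + s" "U (x + s) - U x = (x + s - x) * u (circle_proj z)"
      using MVT2[of x "x + s" U "\<lambda>x. u (circle_proj x)"] U(1) s by auto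
    then have "w p = u (circle_proj z)" using s by (simp add: x w_proj)
    moreover have "dist p (circle_proj z) \<le> s"
      using dist_circle_proj_le[of x z] z by (simp add: x)
    ultimately show ?thesis by blast
  qed
  show ?thesis
  proof (rule that)
    show "continuous_on UNIV w" by (rule C1_on_circleD(2)[OF C1])
    show "\<bar>w p\<bar> \<le> H" for p using mvt[of p] bound by metis
    show "variation_le (2 * H / s) w"
    proof (rule variation_le_C1[OF C1])
      fix p
      have "\<bar>u (circle_proj (circle_coord p + s)) - u p\<bar> \<le> 2 * H"
        using bound[of "circle_proj (circle_coord p + s)"] bound[of p] by linarith
      then show "\<bar>w' p\<bar> \<le> 2 * H / s" unfolding w'_def abs_divide using s by (simp add: divide_right_mono)
    qed
    fix p
    obtain q where q: "w p = u q" "dist p q \<le> s" using mvt by blast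
    have "\<bar>u p - w p\<bar> \<le> H * dist p q powr \<alpha>" unfolding q(1) by (rule holder)
    also have "\<dots> \<le> H * s powr \<alpha>" using q(2) \<alpha> H by (intro mult_left_mono powr_mono2) auto
    finally show "\<bar>u p - w p\<bar> \<le> H * s powr \<alpha>" .
  qed
qed

text \<open>The Hoelder constant is a supremum over pairs of distinct points. It is not negative
  because the circle has two distinct points.\<close>

lemma holder_norm_bounds:
  fixes f :: "circle \<Rightarrow> 'b::real_normed_vector"
  assumes "holder_on_circle \<alpha> f" "0 < \<alpha>"
  shows "norm (f p) \<le> holder_norm \<alpha> f" "norm (f p - f q) \<le> holder_norm \<alpha> f * dist p q powr \<alpha>"
proof -
  obtain K where K: "\<And>x y. norm (f x - f y) \<le> K * dist x y powr \<alpha>"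
    using assms(1) unfolding holder_on_circle_def by blast
  let ?S = "{norm (f x - f y) / dist x y powr \<alpha> | x y. x \<noteq> y}"
  have "bdd_above ?S"
    by (rule bdd_aboveI[of _ K]) (use K in \<open>auto simp: divide_le_eq\<close>)
  then have quot: "norm (f x - f y) / dist x y powr \<alpha> \<le> holder_const \<alpha> f" if "x \<noteq> y" for x y
    unfolding holder_const_def using that by (intro cSup_upper) auto
  have "circle_proj 0 \<noteq> circle_proj (1/2)"
    using dist_circle_proj[of 0 "1/2"] by auto
  from order_trans[OF _ quot[OF this]] have c0: "0 \<le> holder_const \<alpha> f" by simp
  have "continuous_on UNIV f" by (rule holder_continuous[OF assms(2) K])
  then have "bounded (range f)" by (intro compact_imp_bounded compact_continuous_image compact_circle)
  then obtain A where "\<And>x. norm (f x) \<le> A" unfolding bounded_iff by auto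
  then have sup: "norm (f p) \<le> (SUP x. norm (f x))" for p
    by (intro cSUP_upper bdd_aboveI2[where M = A]) auto
  then show "norm (f p) \<le> holder_norm \<alpha> f" using c0 by (simp add: holder_norm_def add_increasing)
  have s0: "0 \<le> (SUP x. norm (f x))" using sup[of undefined] norm_ge_zero order_trans by blast
  show "norm (f p - f q) \<le> holder_norm \<alpha> f * dist p q powr \<alpha>"
  proof (cases "p = q")
    case False
    then have "norm (f p - f q) \<le> holder_const \<alpha> f * dist p q powr \<alpha>"
      using quot[OF False] by (simp add: divide_le_eq)
    also have "\<dots> \<le> holder_norm \<alpha> f * dist p q powr \<alpha>"
      unfolding holder_norm_def using s0 by (intro mult_right_mono) auto
    finally show ?thesis .
  qed simp
qed

context random_circle_maps
begin

text \<open>The final form of the contraction, with constants uniform in the exponent.\<close>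

definition holder_decay :: "real \<Rightarrow> real \<Rightarrow> bool" where
  "holder_decay \<theta> C \<longleftrightarrow> (\<forall>\<alpha> H u n. 0 < \<alpha> \<longrightarrow> \<alpha> < 1 \<longrightarrow> mean u = 0 \<longrightarrow>
     (\<forall>p. \<bar>u p\<bar> \<le> H) \<longrightarrow> (\<forall>p q. \<bar>u p - u q\<bar> \<le> H * dist p q powr \<alpha>) \<longrightarrow>
     mean (\<lambda>p. \<bar>(P ^^ n) u p\<bar>) \<le> C * H * \<theta> powr (\<alpha> * real n))"

text \<open>With decay \<open>\<theta>\<close> for functions of bounded variation, smooth at scale \<open>s = \<rho> ^ n\<close> where
  \<open>\<rho>\<^sup>2 = \<theta>\<close>. The smooth part contributes \<open>\<theta> ^ n / s = \<rho> ^ n\<close> and the error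
  \<open>s powr \<alpha> = \<rho> powr (\<alpha> n)\<close>. Smoothing may change the mean, which is therefore subtracted again;
  this is another error of the same size.\<close>

lemma holder_decay_exists:
  obtains \<theta> C where "0 < \<theta>" "\<theta> < 1" "0 < C" "holder_decay \<theta> C"
proof -
  obtain \<theta> C where \<theta>: "0 < \<theta>" "\<theta> < 1" and C: "0 < C"
    and decay: "\<And>u V n. continuous_on UNIV u \<Longrightarrow> mean u = 0 \<Longrightarrow> 0 < V \<Longrightarrow>
       (\<And>p. \<bar>u p\<bar> \<le> V) \<Longrightarrow> variation_le V u \<Longrightarrow>
       mean (\<lambda>p. \<bar>(P ^^ n) u p\<bar>) \<le> C * V * \<theta> ^ n"
    by (rule mean_zero_decay) blast
  define \<rho> where "\<rho> = sqrt \<theta>"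
  have \<rho>: "0 < \<rho>" "\<rho> < 1" "\<theta> = \<rho> * \<rho>" using \<theta> by (auto simp: \<rho>_def)
  have "holder_decay \<rho> (2 * C + 2)"
    unfolding holder_decay_def
  proof (intro allI impI)
    fix \<alpha> H u n
    assume \<alpha>: "0 < \<alpha>" "\<alpha> < 1" and int: "mean u = 0"
      and bound: "\<forall>p. \<bar>u p\<bar> \<le> H" and holder: "\<forall>p q. \<bar>u p - u q\<bar> \<le> H * dist p q powr \<alpha>"
    have u: "continuous_on UNIV u" by (rule holder_continuous[OF \<alpha>(1), of u H]) (simp add: holder)
    have H0: "0 \<le> H" using bound abs_ge_zero order_trans by blast
    show "mean (\<lambda>p. \<bar>(P ^^ n) u p\<bar>) \<le> (2 * C + 2) * H * \<rho> powr (\<alpha> * real n)"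
    proof (cases "H = 0")
      case True
      then have "mean (\<lambda>p. \<bar>u p\<bar>) = 0" using bound by simp
      then show ?thesis using P_iterate_L1_contraction[OF u, of n] True by simp
    next
      case False
      then have H: "0 < H" using H0 by simp
      define s where "s = \<rho> ^ n"
      have s: "0 < s" "s \<le> 1" using \<rho> by (auto simp: s_def power_le_one)
      have s\<alpha>: "s powr \<alpha> = \<rho> powr (\<alpha> * real n)"
        using \<rho>(1) by (simp add: s_def powr_realpow[symmetric] powr_powr mult.commute)
      obtain w where w: "continuous_on UNIV w" and wb: "\<And>p. \<bar>w p\<bar> \<le> H" and wv: "variation_le (2 * H / s) w"
        and uw: "\<And>p. \<bar>u p - w p\<bar> \<le> H * s powr \<alpha>"
        by (rule holder_smoothing[OF \<alpha>(1), of u H s]) (use bound holder s in auto)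
      define m where "m = mean w"
      define v where "v p = 1 * w p + (- m)" for p
      have m1: "\<bar>m\<bar> \<le> H * s powr \<alpha>"
      proof -
        have "m = mean (\<lambda>p. w p - u p)"
          unfolding m_def using continuous_integrable_circle[OF w] continuous_integrable_circle[OF u] int by simp
        also have "\<bar>\<dots>\<bar> \<le> mean (\<lambda>p. \<bar>w p - u p\<bar>)" by simp
        also have "\<dots> \<le> mean (\<lambda>p. H * s powr \<alpha>)"
          by (intro integral_mono continuous_integrable_circle continuous_intros u w) (simp add: uw abs_minus_commute)
        finally show ?thesis using circle.prob_space by simp
      qed
      have m2: "\<bar>m\<bar> \<le> H"
      proof -
        have "\<bar>m\<bar> \<le> mean (\<lambda>p. \<bar>w p\<bar>)" unfolding m_def by simp
        also have "\<dots> \<le> mean (\<lambda>p. H)"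
          by (intro integral_mono continuous_integrable_circle continuous_intros w wb)
        finally show ?thesis using circle.prob_space by simp
      qed
      have v: "continuous_on UNIV v" unfolding v_def by (intro continuous_intros w)
      have vint: "mean v = 0"
        unfolding v_def using continuous_integrable_circle[OF w] circle.prob_space by (simp add: m_def)
      have vvar: "variation_le (2 * H / s) v"
        unfolding v_def[abs_def] using variation_le_affine[OF w wv, of 1 "- m"] by simp
      have "2 * H \<le> 2 * H / s" using s H by (simp add: le_divide_eq)
      then have vb: "\<bar>v p\<bar> \<le> 2 * H / s" for p using wb[of p] m2 unfolding v_def by linarith
      have "mean (\<lambda>p. \<bar>(P ^^ n) v p\<bar>) \<le> C * (2 * H / s) * \<theta> ^ n"
        by (rule decay[OF v vint _ vb vvar]) (use H s in simp)
      also have "\<dots> = 2 * C * H * s" using s(1) by (simp add: s_def \<rho>(3) power_mult_distrib)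
      also have "\<dots> \<le> 2 * C * H * \<rho> powr (\<alpha> * real n)"
      proof -
        have "s = s powr 1" using s by simp
        also have "\<dots> \<le> s powr \<alpha>" using s \<alpha> by (intro powr_mono') auto
        finally show ?thesis using C H by (intro mult_left_mono) (auto simp: s\<alpha>)
      qed
      finally have 1: "mean (\<lambda>p. \<bar>(P ^^ n) v p\<bar>) \<le> 2 * C * H * \<rho> powr (\<alpha> * real n)" .
      have duv: "continuous_on UNIV (\<lambda>p. u p - v p)" by (intro continuous_intros u v)
      have "mean (\<lambda>p. \<bar>(P ^^ n) (\<lambda>p. u p - v p) p\<bar>) \<le> mean (\<lambda>p. \<bar>u p - v p\<bar>)"
        by (rule P_iterate_L1_contraction[OF duv])
      also have "\<dots> \<le> mean (\<lambda>p. 2 * H * s powr \<alpha>)"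
      proof (intro integral_mono continuous_integrable_circle continuous_intros u v)
        show "\<bar>u p - v p\<bar> \<le> 2 * H * s powr \<alpha>" for p
          using uw[of p] m1 unfolding v_def by linarith
      qed
      finally have 2: "mean (\<lambda>p. \<bar>(P ^^ n) (\<lambda>p. u p - v p) p\<bar>) \<le> 2 * H * \<rho> powr (\<alpha> * real n)"
        using circle.prob_space by (simp add: s\<alpha>)
      note Pn = continuous_P_iterate[OF v, of n] continuous_P_iterate[OF duv, of n] continuous_P_iterate[OF u, of n]
      have "mean (\<lambda>p. \<bar>(P ^^ n) u p\<bar>)
        \<le> mean (\<lambda>p. \<bar>(P ^^ n) v p\<bar> + \<bar>(P ^^ n) (\<lambda>p. u p - v p) p\<bar>)"
      proof (intro integral_mono continuous_integrable_circle continuous_intros Pn)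
        show "\<bar>(P ^^ n) u p\<bar> \<le> \<bar>(P ^^ n) v p\<bar> + \<bar>(P ^^ n) (\<lambda>p. u p - v p) p\<bar>" for p
          unfolding P_iterate_diff[OF u v] by linarith
      qed
      also have "\<dots> = mean (\<lambda>p. \<bar>(P ^^ n) v p\<bar>) + mean (\<lambda>p. \<bar>(P ^^ n) (\<lambda>p. u p - v p) p\<bar>)"
        by (intro Bochner_Integration.integral_add continuous_integrable_circle continuous_intros Pn)
      finally show ?thesis using 1 2 by (simp add: algebra_simps)
    qed
  qed
  then show ?thesis using \<rho> C by (intro that[of \<rho> "2 * C + 2"]) auto
qed

end

section \<open>The stationary density and the decay of correlations\<close>

context random_circle_maps
begin

lemma measurable_Q_iterate:
  fixes f :: "circle \<Rightarrow> 'b::{banach, second_countable_topology}"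
  assumes "f \<in> borel_measurable borel" shows "(Q ^^ n) f \<in> borel_measurable borel"
  by (induction n) (simp_all add: assms measurable_Q)

text \<open>By duality, the measure of the preimage of \<open>N\<close> is the integral over \<open>N\<close> of the transferred constant.\<close>

lemma map_preserves_null:
  assumes \<omega>: "\<omega> \<in> space \<eta>" and N [measurable]: "N \<in> sets borel" and null: "AE p in circle_measure. p \<notin> N"
  shows "AE p in circle_measure. T \<omega> p \<notin> N"
proof -
  interpret circle_map "T \<omega>" by (rule circle_map[OF \<omega>])
  have m: "(indicator N :: circle \<Rightarrow> real) \<in> borel_measurable borel" "\<And>p. \<bar>indicator N p :: real\<bar> \<le> 1"
    "(\<lambda>_::circle. 1::real) \<in> borel_measurable borel" "\<And>p::circle. \<bar>1::real\<bar> \<le> 1"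
    by (auto simp: indicator_def)
  have "mean (\<lambda>p. indicator N (T \<omega> p) * (1::real)) = mean (\<lambda>p. indicator N p * transfer_op (T \<omega>) (\<lambda>_. 1) p)"
    by (rule transfer_op_duality(1)[of "indicator N" 1 "\<lambda>_. 1" 1, OF m])
  also have "\<dots> = mean (\<lambda>p. 0)"
  proof (rule integral_cong_AE)
    show "(\<lambda>p. indicator N p * transfer_op (T \<omega>) (\<lambda>_. 1 :: real) p) \<in> borel_measurable circle_measure"
      using m(1) transfer_op_duality(2)[of "indicator N" 1 "\<lambda>_. 1" 1, OF m] by measurable
  qed (use null in auto)
  finally have "mean (\<lambda>p. indicator N (T \<omega> p)) = (0::real)" by simp
  moreover have "integrable circle_measure (\<lambda>p. indicator N (T \<omega> p) :: real)"
    by (rule bounded_integrable_circle[where B = 1]) (auto simp: indicator_def)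
  ultimately have "AE p in circle_measure. indicator N (T \<omega> p) = (0::real)"
    by (subst (asm) integral_nonneg_eq_0_iff_AE) auto
  then show ?thesis by eventually_elim (auto simp: indicator_def split: if_splits)
qed

text \<open>Hence \<open>Q\<close> is well defined on classes of functions modulo null sets.\<close>

lemma Q_cong_AE:
  fixes f g :: "circle \<Rightarrow> 'b::{banach, second_countable_topology}"
  assumes f [measurable]: "f \<in> borel_measurable borel" and g [measurable]: "g \<in> borel_measurable borel"
    and eq: "AE p in circle_measure. f p = g p"
  shows "AE p in circle_measure. Q f p = Q g p"
proof -
  define N where "N = {p. f p \<noteq> g p}"
  have N [measurable]: "N \<in> sets borel" unfolding N_def by measurable
  have "AE p in circle_measure. p \<notin> N" using eq by (simp add: N_def)
  then have "AE \<omega> in \<eta>. AE p in circle_measure. T \<omega> p \<notin> N"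
    by (intro AE_I2[of \<eta>] map_preserves_null N)
  moreover have "{x \<in> space (\<eta> \<Otimes>\<^sub>M circle_measure). T (fst x) (snd x) \<notin> N} \<in> sets (\<eta> \<Otimes>\<^sub>M circle_measure)"
    by measurable
  ultimately have "AE p in circle_measure. AE \<omega> in \<eta>. T \<omega> p \<notin> N"
    using pair.AE_commute[of "\<lambda>\<omega> p. T \<omega> p \<notin> N"] by blast
  then show ?thesis
  proof eventually_elim
    case (elim p)
    show ?case unfolding annealed_koopman_op_def
      by (rule integral_cong_AE) (use elim in \<open>auto simp: N_def\<close>)
  qed
qed

lemma Q_iterate_cong_AE:
  fixes f g :: "circle \<Rightarrow> 'b::{banach, second_countable_topology}"
  assumes f: "f \<in> borel_measurable borel" and g: "g \<in> borel_measurable borel"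
    and eq: "AE p in circle_measure. f p = g p"
  shows "AE p in circle_measure. (Q ^^ n) f p = (Q ^^ n) g p"
proof (induction n)
  case (Suc n)
  then show ?case
    using Q_cong_AE[OF measurable_Q_iterate[OF f] measurable_Q_iterate[OF g]] by simp
qed (simp add: eq)

lemma Q_iterate_Re_Im:
  fixes f :: "circle \<Rightarrow> complex"
  assumes f: "f \<in> borel_measurable borel" and A: "\<And>p. norm (f p) \<le> A"
  shows "(Q ^^ n) (\<lambda>p. Re (f p)) = (\<lambda>p. Re ((Q ^^ n) f p))"
    and "(Q ^^ n) (\<lambda>p. Im (f p)) = (\<lambda>p. Im ((Q ^^ n) f p))"
proof -
  have step: "Q (\<lambda>p. Re (h p)) = (\<lambda>p. Re (Q h p))" "Q (\<lambda>p. Im (h p)) = (\<lambda>p. Im (Q h p))"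
    if h [measurable]: "h \<in> borel_measurable borel" and B: "\<And>p. norm (h p) \<le> A" for h :: "circle \<Rightarrow> complex"
  proof -
    have "integrable \<eta> (\<lambda>\<omega>. h (T \<omega> p))" for p
      by (rule noise.integrable_const_bound[where B = A]) (use B in auto)
    then show "Q (\<lambda>p. Re (h p)) = (\<lambda>p. Re (Q h p))" "Q (\<lambda>p. Im (h p)) = (\<lambda>p. Im (Q h p))"
      unfolding annealed_koopman_op_def by simp_all
  qed
  note b = Q_iterate_norm_bounded[OF f A]
  show "(Q ^^ n) (\<lambda>p. Re (f p)) = (\<lambda>p. Re ((Q ^^ n) f p))"
    by (induction n) (use step b in auto)
  show "(Q ^^ n) (\<lambda>p. Im (f p)) = (\<lambda>p. Im ((Q ^^ n) f p))"
    by (induction n) (use step b in auto)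
qed

end

text \<open>A representative that is bounded everywhere, not just almost everywhere, so that all
  integrals over the maps exist at every point.\<close>

lemma ess_bounded_truncation:
  fixes g :: "circle \<Rightarrow> 'b::{banach, second_countable_topology}"
  assumes g: "ess_bounded g"
  obtains h where "h \<in> borel_measurable borel" "\<And>p. norm (h p) \<le> linf_norm g"
    "AE p in circle_measure. g p = h p"
proof -
  have gm: "g \<in> borel_measurable borel" using g unfolding ess_bounded_def
    by (simp cong: measurable_cong_sets)
  obtain B where B: "AE x in circle_measure. norm (g x) \<le> B" using g unfolding ess_bounded_def by blast
  let ?e = "esssup circle_measure (\<lambda>x. ereal (norm (g x)))"
  have m: "(\<lambda>x. ereal (norm (g x))) \<in> borel_measurable circle_measure"
    using gm by measurable
  have "?e \<le> ereal B" by (rule esssup_I[OF m]) (use B in simp)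
  moreover have "0 \<le> ?e"
  proof -
    have "0 = esssup circle_measure (\<lambda>_. 0 :: ereal)"
      by (rule esssup_const[symmetric]) (use circle.emeasure_space_1 in simp)
    also have "\<dots> \<le> ?e" by (rule esssup_mono) auto
    finally show ?thesis .
  qed
  ultimately have e: "?e = ereal (linf_norm g)"
    unfolding linf_norm_def by (cases ?e) auto
  have L0: "0 \<le> linf_norm g" using \<open>0 \<le> ?e\<close> unfolding e by simp
  have ae: "AE x in circle_measure. norm (g x) \<le> linf_norm g"
    using esssup_AE[of "\<lambda>x. ereal (norm (g x))" circle_measure] unfolding e by simp
  define h where "h p = (if norm (g p) \<le> linf_norm g then g p else 0)" for p
  show ?thesis
  proof (rule that)
    show "h \<in> borel_measurable borel" unfolding h_def using gm by measurable
    show "norm (h p) \<le> linf_norm g" for p using L0 by (simp add: h_def)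
    show "AE p in circle_measure. g p = h p" using ae by eventually_elim (simp add: h_def)
  qed
qed

locale stationary_random_circle_maps = random_circle_maps \<eta> T
  for \<eta> :: "'w measure" and T :: "'w \<Rightarrow> circle \<Rightarrow> circle" +
  fixes \<phi> :: "circle \<Rightarrow> real"
  assumes density: "prob_density \<phi>" and lipschitz: "\<exists>L. L-lipschitz_on UNIV \<phi>"
    and stationary: "stationary \<eta> T (density circle_measure (\<lambda>p. ennreal (\<phi> p)))"
begin

lemma density_nonneg: "0 \<le> \<phi> p" and density_integral: "mean \<phi> = 1"
  using density by (auto simp: prob_density_def)

lemma continuous_density: "continuous_on UNIV \<phi>"
  using lipschitz lipschitz_on_continuous_on by blast

lemmas measurable_density [measurable] = continuous_measurable_circle[OF continuous_density]

lemma integral_stationary: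
  fixes f :: "circle \<Rightarrow> 'b::{banach, second_countable_topology}"
  assumes "f \<in> borel_measurable borel"
  shows "(\<integral>p. f p \<partial>density circle_measure (\<lambda>p. ennreal (\<phi> p))) = mean (\<lambda>p. \<phi> p *\<^sub>R f p)"
    and "integrable (density circle_measure (\<lambda>p. ennreal (\<phi> p))) f \<longleftrightarrow> integrable circle_measure (\<lambda>p. \<phi> p *\<^sub>R f p)"
proof -
  have m: "f \<in> borel_measurable circle_measure" "\<phi> \<in> borel_measurable circle_measure"
    using assms measurable_density by (simp_all cong: measurable_cong_sets)
  have nn: "AE p in circle_measure. 0 \<le> \<phi> p" by (simp add: density_nonneg)
  show "(\<integral>p. f p \<partial>density circle_measure (\<lambda>p. ennreal (\<phi> p))) = mean (\<lambda>p. \<phi> p *\<^sub>R f p)"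
    by (rule integral_density[OF m nn])
  show "integrable (density circle_measure (\<lambda>p. ennreal (\<phi> p))) f \<longleftrightarrow> integrable circle_measure (\<lambda>p. \<phi> p *\<^sub>R f p)"
    by (rule integrable_density[OF m nn])
qed

text \<open>Stationarity says that \<open>P \<phi> - \<phi>\<close> is orthogonal to all bounded functions; it is continuous, so pairing it with
  itself gives equality everywhere.\<close>

lemma P_density: "P \<phi> = \<phi>"
proof
  fix p
  note c = continuous_density continuous_P[OF continuous_density]
  define f where "f q = P \<phi> q - \<phi> q" for q
  have f: "continuous_on UNIV f" unfolding f_def by (intro continuous_intros c)
  have fm: "f \<in> borel_measurable borel" by (rule continuous_measurable_circle[OF f])
  obtain B where B: "\<And>q. \<bar>f q\<bar> \<le> B" using f by (rule continuous_on_circle_bounded) auto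
  have "bounded (range f)" unfolding bounded_iff using B by auto
  then have "mean (\<lambda>q. \<phi> q * Q f q) = mean (\<lambda>q. \<phi> q * f q)"
    using stationary fm measurable_Q[OF fm] unfolding stationary_def by (auto simp: integral_stationary)
  moreover have "mean (\<lambda>q. f q * P \<phi> q) = mean (\<lambda>q. Q f q * \<phi> q)"
    by (rule duality[OF fm B continuous_density])
  ultimately have "mean (\<lambda>q. f q * P \<phi> q) - mean (\<lambda>q. f q * \<phi> q) = 0"
    by (simp add: mult.commute)
  moreover have "mean (\<lambda>q. f q * P \<phi> q) - mean (\<lambda>q. f q * \<phi> q)
      = mean (\<lambda>q. f q * P \<phi> q - f q * \<phi> q)"
    by (intro Bochner_Integration.integral_diff[symmetric] continuous_integrable_circle continuous_intros f c)
  ultimately have "mean (\<lambda>q. f q * f q) = 0" by (simp add: f_def algebra_simps)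
  then have "f p * f p = 0"
    by (rule continuous_nonneg_integral_zero[rotated 2]) (auto intro!: continuous_intros f)
  then show "P \<phi> p = \<phi> p" by (simp add: f_def)
qed

lemma P_iterate_density: "(P ^^ n) \<phi> = \<phi>"
  by (induction n) (simp_all add: P_density)

lemma density_bounds:
  obtains A where "0 < A" "\<And>p. \<bar>\<phi> p\<bar> \<le> A"
    "\<And>\<alpha> p q. 0 < \<alpha> \<Longrightarrow> \<alpha> < 1 \<Longrightarrow> \<bar>\<phi> p - \<phi> q\<bar> \<le> A * dist p q powr \<alpha>"
proof -
  obtain L where L: "L-lipschitz_on UNIV \<phi>" using lipschitz by blast
  obtain B where B: "B > 0" "\<And>p. \<bar>\<phi> p\<bar> \<le> B" using continuous_density by (rule continuous_on_circle_bounded) auto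
  have L0: "0 \<le> L" using L by (rule lipschitz_on_nonneg)
  have "\<bar>\<phi> p - \<phi> q\<bar> \<le> (B + L) * dist p q powr \<alpha>" if "0 < \<alpha>" "\<alpha> < 1" for \<alpha> p q
  proof -
    have "dist p q powr 1 \<le> dist p q powr \<alpha>"
      using that dist_circle_le_half[of p q] by (intro powr_mono') auto
    then have d: "dist p q \<le> dist p q powr \<alpha>" by simp
    have "\<bar>\<phi> p - \<phi> q\<bar> \<le> L * dist p q" using lipschitz_onD[OF L, of p q] by (simp add: dist_real_def)
    also have "\<dots> \<le> (B + L) * dist p q powr \<alpha>" using d B L0 by (intro mult_mono) auto
    finally show ?thesis .
  qed
  moreover have "\<bar>\<phi> p\<bar> \<le> B + L" for p using B(2)[of p] L0 by linarith
  ultimately show ?thesis using B(1) L0 by (intro that[of "B + L"]) auto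
qed

lemma densities_converge:
  assumes decay: "holder_decay \<theta> C" and C: "0 < C"
  obtains C' where "0 < C'"
    "\<And>\<alpha> n \<psi>. 0 < \<alpha> \<Longrightarrow> \<alpha> < 1 \<Longrightarrow> prob_density \<psi> \<Longrightarrow> holder_on_circle \<alpha> \<psi> \<Longrightarrow>
       integrable circle_measure ((P ^^ n) \<psi>) \<and>
       mean (\<lambda>p. \<bar>(P ^^ n) \<psi> p - \<phi> p\<bar>) \<le> C' * holder_norm \<alpha> \<psi> * \<theta> powr (\<alpha> * real n)"
proof -
  obtain A where A: "0 < A" "\<And>p. \<bar>\<phi> p\<bar> \<le> A"
    and A\<alpha>: "\<And>\<alpha> p q. 0 < \<alpha> \<Longrightarrow> \<alpha> < 1 \<Longrightarrow> \<bar>\<phi> p - \<phi> q\<bar> \<le> A * dist p q powr \<alpha>"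
    by (rule density_bounds) blast
  show ?thesis
  proof (rule that[of "C * (1 + A)"])
    show "0 < C * (1 + A)" using C A by simp
    fix \<alpha> n \<psi>
    assume \<alpha>: "0 < \<alpha>" "\<alpha> < 1" and \<psi>: "prob_density \<psi>" and hol: "holder_on_circle \<alpha> \<psi>"
    define H where "H = holder_norm \<alpha> \<psi>"
    have Hb: "\<bar>\<psi> p\<bar> \<le> H" "\<bar>\<psi> p - \<psi> q\<bar> \<le> H * dist p q powr \<alpha>" for p q
      using holder_norm_bounds[OF hol \<alpha>(1)] by (auto simp: H_def)
    have c: "continuous_on UNIV \<psi>" by (rule holder_continuous[OF \<alpha>(1), of \<psi> H]) (simp add: Hb)
    have int: "mean \<psi> = 1" using \<psi> by (simp add: prob_density_def)
    have "mean \<psi> \<le> mean (\<lambda>p. H)"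
      using Hb(1) by (intro integral_mono continuous_integrable_circle continuous_intros c) (auto simp: abs_le_iff)
    then have H1: "1 \<le> H" using int circle.prob_space by simp
    define u where "u p = \<psi> p - \<phi> p" for p
    have AH: "A \<le> A * H" using H1 A by simp
    have "mean u = 0"
      unfolding u_def using continuous_integrable_circle[OF c] continuous_integrable_circle[OF continuous_density] int density_integral by simp
    moreover have "\<bar>u p\<bar> \<le> (1 + A) * H" for p
      using Hb(1)[of p] A(2)[of p] AH unfolding u_def by (simp add: algebra_simps)
    moreover have "\<bar>u p - u q\<bar> \<le> (1 + A) * H * dist p q powr \<alpha>" for p q
    proof -
      have "A * dist p q powr \<alpha> \<le> A * H * dist p q powr \<alpha>" using AH by (intro mult_right_mono) auto
      moreover have "(1 + A) * H * dist p q powr \<alpha> = H * dist p q powr \<alpha> + A * H * dist p q powr \<alpha>"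
        by (simp add: algebra_simps)
      ultimately show ?thesis using Hb(2)[of p q] A\<alpha>[OF \<alpha>, of p q] unfolding u_def by linarith
    qed
    ultimately have "mean (\<lambda>p. \<bar>(P ^^ n) u p\<bar>) \<le> C * ((1 + A) * H) * \<theta> powr (\<alpha> * real n)"
      using decay \<alpha> unfolding holder_decay_def by blast
    moreover have "(P ^^ n) u = (\<lambda>p. (P ^^ n) \<psi> p - \<phi> p)"
      unfolding u_def[abs_def] P_iterate_diff[OF c continuous_density] P_iterate_density ..
    ultimately show "integrable circle_measure ((P ^^ n) \<psi>) \<and>
       mean (\<lambda>p. \<bar>(P ^^ n) \<psi> p - \<phi> p\<bar>) \<le> C * (1 + A) * holder_norm \<alpha> \<psi> * \<theta> powr (\<alpha> * real n)"
      using continuous_integrable_circle[OF continuous_P_iterate[OF c]] by (simp add: H_def mult.assoc)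
  qed
qed

text \<open>With \<open>m = \<integral> f \<phi>\<close> and \<open>u = f \<phi> - m \<phi>\<close>, the correlation is \<open>\<integral> u (Q ^^ n) g\<close>, because \<open>\<phi>\<close> is stationary.
  Duality moves the iterates to \<open>u\<close>, which is Hoelder and has mean zero.\<close>

lemma real_correlations_decay:
  assumes decay: "holder_decay \<theta> C" and C: "0 < C"
  obtains C' where "0 < C'"
    "\<And>\<alpha> n f g H b. 0 < \<alpha> \<Longrightarrow> \<alpha> < 1 \<Longrightarrow> (\<And>p. \<bar>f p\<bar> \<le> H) \<Longrightarrow>
       (\<And>p q. \<bar>f p - f q\<bar> \<le> H * dist p q powr \<alpha>) \<Longrightarrow>
       g \<in> borel_measurable borel \<Longrightarrow> (\<And>p. \<bar>g p\<bar> \<le> b) \<Longrightarrow>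
       \<bar>mean (\<lambda>p. \<phi> p * (f p * (Q ^^ n) g p))
         - mean (\<lambda>p. \<phi> p * f p) * mean (\<lambda>p. \<phi> p * g p)\<bar>
       \<le> C' * H * b * \<theta> powr (\<alpha> * real n)"
proof -
  obtain A where A: "0 < A" "\<And>p. \<bar>\<phi> p\<bar> \<le> A"
    and A\<alpha>: "\<And>\<alpha> p q. 0 < \<alpha> \<Longrightarrow> \<alpha> < 1 \<Longrightarrow> \<bar>\<phi> p - \<phi> q\<bar> \<le> A * dist p q powr \<alpha>"
    by (rule density_bounds) blast
  show ?thesis
  proof (rule that[of "C * (3 * A)"])
    show "0 < C * (3 * A)" using C A by simp
    fix \<alpha> n H b and f g :: "circle \<Rightarrow> real"
    assume \<alpha>: "0 < \<alpha>" "\<alpha> < 1" and fH: "\<And>p. \<bar>f p\<bar> \<le> H" and f\<alpha>: "\<And>p q. \<bar>f p - f q\<bar> \<le> H * dist p q powr \<alpha>"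
      and g: "g \<in> borel_measurable borel" and b: "\<And>p. \<bar>g p\<bar> \<le> b"
    have f: "continuous_on UNIV f" by (rule holder_continuous[OF \<alpha>(1), of f H]) (simp add: f\<alpha>)
    have H0: "0 \<le> H" using fH[of undefined] by linarith
    have b0: "0 \<le> b" using b[of undefined] by linarith
    note c = f continuous_density
    define m where "m = mean (\<lambda>p. \<phi> p * f p)"
    define u where "u p = \<phi> p * f p - m * \<phi> p" for p
    have u: "continuous_on UNIV u" unfolding u_def by (intro continuous_intros c)
    have mH: "\<bar>m\<bar> \<le> H"
    proof -
      have "\<bar>m\<bar> \<le> mean (\<lambda>p. \<bar>\<phi> p * f p\<bar>)" unfolding m_def by simp
      also have "\<dots> \<le> mean (\<lambda>p. \<phi> p * H)"
        by (intro integral_mono continuous_integrable_circle continuous_intros c)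
           (use fH density_nonneg in \<open>auto simp: abs_mult intro!: mult_left_mono\<close>)
      finally show ?thesis by (simp add: density_integral)
    qed
    have "mean u = mean (\<lambda>p. \<phi> p * f p) - mean (\<lambda>p. m * \<phi> p)"
      unfolding u_def by (intro Bochner_Integration.integral_diff continuous_integrable_circle continuous_intros c)
    then have "mean u = 0" by (simp add: m_def density_integral)
    moreover have "\<bar>u p\<bar> \<le> 3 * A * H" for p
    proof -
      have "\<bar>u p\<bar> = \<bar>\<phi> p\<bar> * \<bar>f p - m\<bar>" by (simp add: u_def abs_mult flip: right_diff_distrib) (simp add: algebra_simps abs_mult[symmetric])
      also have "\<dots> \<le> A * (2 * H)"
        using A fH[of p] mH by (intro mult_mono) auto
      also have "\<dots> \<le> 3 * A * H" using A H0 by simp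
      finally show ?thesis .
    qed
    moreover have "\<bar>u p - u q\<bar> \<le> 3 * A * H * dist p q powr \<alpha>" for p q
    proof -
      let ?d = "dist p q powr \<alpha>"
      have "u p - u q = \<phi> p * (f p - f q) + (f q - m) * (\<phi> p - \<phi> q)" by (simp add: u_def algebra_simps)
      then have "\<bar>u p - u q\<bar> \<le> \<bar>\<phi> p\<bar> * \<bar>f p - f q\<bar> + \<bar>f q - m\<bar> * \<bar>\<phi> p - \<phi> q\<bar>"
        by (metis abs_mult abs_triangle_ineq)
      also have "\<dots> \<le> A * (H * ?d) + (2 * H) * (A * ?d)"
        using A(1) H0 fH[of q] mH by (intro add_mono mult_mono A f\<alpha> A\<alpha> \<alpha>) auto
      finally show ?thesis by (simp add: algebra_simps)
    qed
    ultimately have L1: "mean (\<lambda>p. \<bar>(P ^^ n) u p\<bar>) \<le> C * (3 * A * H) * \<theta> powr (\<alpha> * real n)"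
      using decay \<alpha> unfolding holder_decay_def by blast
    note Qg = Q_iterate_bounded[OF g b, of n]
    have int: "integrable circle_measure (\<lambda>p. h p * (Q ^^ n) g p)" if h: "continuous_on UNIV h" for h
    proof -
      obtain B where B: "\<And>p. \<bar>h p\<bar> \<le> B" using h by (rule continuous_on_circle_bounded) auto
      have B0: "0 \<le> B" using B[of undefined] by linarith
      show ?thesis
      proof (rule bounded_integrable_circle[where B = "B * b"])
        show "(\<lambda>p. h p * (Q ^^ n) g p) \<in> borel_measurable borel"
          using continuous_measurable_circle[OF h] Qg(1) by measurable
        show "norm (h p * (Q ^^ n) g p) \<le> B * b" for p
          unfolding real_norm_def abs_mult by (rule mult_mono[OF B Qg(2) B0 abs_ge_zero])
      qed
    qed
    have "mean (\<lambda>p. (Q ^^ n) g p * u p) = mean (\<lambda>p. (\<phi> p * f p) * (Q ^^ n) g p - m * \<phi> p * (Q ^^ n) g p)"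
      by (simp add: u_def algebra_simps)
    also have "\<dots> = mean (\<lambda>p. (\<phi> p * f p) * (Q ^^ n) g p) - mean (\<lambda>p. m * \<phi> p * (Q ^^ n) g p)"
      by (intro Bochner_Integration.integral_diff int continuous_intros c)
    also have "mean (\<lambda>p. m * \<phi> p * (Q ^^ n) g p) = m * mean (\<lambda>p. (Q ^^ n) g p * \<phi> p)"
      by (simp add: mult_ac)
    also have "mean (\<lambda>p. (Q ^^ n) g p * \<phi> p) = mean (\<lambda>p. g p * \<phi> p)"
      using duality_iterate[OF g b continuous_density, of n] by (simp add: P_iterate_density)
    finally have eq: "mean (\<lambda>p. \<phi> p * (f p * (Q ^^ n) g p))
         - m * mean (\<lambda>p. \<phi> p * g p) = mean (\<lambda>p. g p * (P ^^ n) u p)"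
      using duality_iterate[OF g b u, of n] by (simp add: mult_ac)
    note Pu = continuous_P_iterate[OF u, of n]
    obtain D where D: "\<And>p. \<bar>(P ^^ n) u p\<bar> \<le> D" using Pu by (rule continuous_on_circle_bounded) auto
    have "\<bar>\<integral>p. g p * (P ^^ n) u p \<partial>circle_measure\<bar> \<le> mean (\<lambda>p. \<bar>g p * (P ^^ n) u p\<bar>)" by simp
    also have "\<dots> \<le> mean (\<lambda>p. b * \<bar>(P ^^ n) u p\<bar>)"
    proof (rule integral_mono)
      show "integrable circle_measure (\<lambda>p. \<bar>g p * (P ^^ n) u p\<bar>)"
      proof (rule bounded_integrable_circle[where B = "b * D"])
        show "(\<lambda>p. \<bar>g p * (P ^^ n) u p\<bar>) \<in> borel_measurable borel"
          using continuous_measurable_circle[OF Pu] g by measurable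
        show "norm \<bar>g p * (P ^^ n) u p\<bar> \<le> b * D" for p
          unfolding real_norm_def abs_idempotent abs_mult by (rule mult_mono[OF b D b0 abs_ge_zero])
      qed
      show "integrable circle_measure (\<lambda>p. b * \<bar>(P ^^ n) u p\<bar>)"
        by (intro continuous_integrable_circle continuous_intros Pu)
      show "\<bar>g p * (P ^^ n) u p\<bar> \<le> b * \<bar>(P ^^ n) u p\<bar>" for p
        unfolding abs_mult by (rule mult_right_mono[OF b]) simp
    qed
    also have "\<dots> \<le> b * (C * (3 * A * H) * \<theta> powr (\<alpha> * real n))"
      using L1 b0 by (simp add: mult_left_mono)
    finally show "\<bar>mean (\<lambda>p. \<phi> p * (f p * (Q ^^ n) g p))
         - mean (\<lambda>p. \<phi> p * f p) * mean (\<lambda>p. \<phi> p * g p)\<bar>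
       \<le> C * (3 * A) * H * b * \<theta> powr (\<alpha> * real n)"
      unfolding eq m_def[symmetric] by (simp add: mult_ac)
  qed
qed

lemma integrable_weighted:
  fixes F :: "circle \<Rightarrow> 'b::{banach, second_countable_topology}"
  assumes F: "F \<in> borel_measurable borel" and B: "\<And>p. norm (F p) \<le> B"
  shows "integrable circle_measure (\<lambda>p. \<phi> p *\<^sub>R F p)"
proof -
  obtain A where A: "\<And>p. \<bar>\<phi> p\<bar> \<le> A" by (rule density_bounds) blast
  have A0: "0 \<le> A" using A[of undefined] by linarith
  show ?thesis
  proof (rule bounded_integrable_circle[where B = "A * B"])
    show "(\<lambda>p. \<phi> p *\<^sub>R F p) \<in> borel_measurable borel" using F by measurable
    show "norm (\<phi> p *\<^sub>R F p) \<le> A * B" for p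
      unfolding norm_scaleR by (rule mult_mono[OF A B A0 norm_ge_zero])
  qed
qed

text \<open>Real and imaginary parts are treated separately; the correlation is bilinear, so it
  splits into four real ones.\<close>

lemma complex_correlations_decay:
  assumes decay: "holder_decay \<theta> C" and C: "0 < C"
  defines "\<mu> \<equiv> density circle_measure (\<lambda>p. ennreal (\<phi> p))"
  obtains C' where "0 < C'"
    "\<And>\<alpha> n f g. 0 < \<alpha> \<Longrightarrow> \<alpha> < 1 \<Longrightarrow> holder_on_circle \<alpha> f \<Longrightarrow> ess_bounded g \<Longrightarrow>
       integrable \<mu> (\<lambda>p. f p * (Q ^^ n) g p) \<and>
       cmod ((\<integral>p. f p * (Q ^^ n) g p \<partial>\<mu>) - (\<integral>p. f p \<partial>\<mu>) * (\<integral>p. g p \<partial>\<mu>))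
       \<le> C' * holder_norm \<alpha> f * linf_norm g * \<theta> powr (\<alpha> * real n)"
proof -
  obtain C' where C': "0 < C'" and real_decay: "\<And>\<alpha> n f g H b. 0 < \<alpha> \<Longrightarrow> \<alpha> < 1 \<Longrightarrow> (\<And>p. \<bar>f p\<bar> \<le> H) \<Longrightarrow>
       (\<And>p q. \<bar>f p - f q\<bar> \<le> H * dist p q powr \<alpha>) \<Longrightarrow>
       g \<in> borel_measurable borel \<Longrightarrow> (\<And>p. \<bar>g p\<bar> \<le> b) \<Longrightarrow>
       \<bar>mean (\<lambda>p. \<phi> p * (f p * (Q ^^ n) g p))
         - mean (\<lambda>p. \<phi> p * f p) * mean (\<lambda>p. \<phi> p * g p)\<bar>
       \<le> C' * H * b * \<theta> powr (\<alpha> * real n)"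
    using real_correlations_decay[OF decay C] by blast
  show ?thesis
  proof (rule that[of "4 * C'"])
    show "0 < 4 * C'" using C' by simp
    fix \<alpha> n and f g :: "circle \<Rightarrow> complex"
    assume \<alpha>: "0 < \<alpha>" "\<alpha> < 1" and hol: "holder_on_circle \<alpha> f" and g: "ess_bounded g"
    define H b where "H = holder_norm \<alpha> f" and "b = linf_norm g"
    have fH: "cmod (f p) \<le> H" "cmod (f p - f q) \<le> H * dist p q powr \<alpha>" for p q
      using holder_norm_bounds[OF hol \<alpha>(1)] by (auto simp: H_def)
    have f: "f \<in> borel_measurable borel"
      by (rule borel_measurable_continuous_onI, rule holder_continuous[OF \<alpha>(1), of f H]) (rule fH)
    obtain h where h: "h \<in> borel_measurable borel" and hb: "\<And>p. cmod (h p) \<le> b"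
      and gh: "AE p in circle_measure. g p = h p"
      using ess_bounded_truncation[OF g] by (metis b_def)
    have gm: "g \<in> borel_measurable borel" using g unfolding ess_bounded_def
      by (simp cong: measurable_cong_sets)
    note Qgm = measurable_Q_iterate[OF gm, of n]
    have Qh: "(Q ^^ n) h \<in> borel_measurable borel" "\<And>p. cmod ((Q ^^ n) h p) \<le> b"
      using Q_iterate_norm_bounded[OF h hb] by blast+
    have Qae: "AE p in circle_measure. (Q ^^ n) g p = (Q ^^ n) h p"
      by (rule Q_iterate_cong_AE[OF gm h gh])
    have H0: "0 \<le> H" using order_trans[OF norm_ge_zero fH(1)] .
    have fQm: "(\<lambda>p. f p * (Q ^^ n) g p) \<in> borel_measurable borel" "(\<lambda>p. f p * (Q ^^ n) h p) \<in> borel_measurable borel"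
      using f Qgm Qh(1) by measurable
    have fQb: "cmod (f p * (Q ^^ n) h p) \<le> H * b" for p
      unfolding norm_mult by (rule mult_mono[OF fH(1) Qh(2) H0 norm_ge_zero])
    have i: "integrable circle_measure (\<lambda>p. \<phi> p *\<^sub>R (f p * (Q ^^ n) h p))"
      "integrable circle_measure (\<lambda>p. \<phi> p *\<^sub>R f p)" "integrable circle_measure (\<lambda>p. \<phi> p *\<^sub>R h p)"
      by (rule integrable_weighted[OF fQm(2) fQb] integrable_weighted[OF f fH(1)] integrable_weighted[OF h hb])+
    have ae: "AE p in circle_measure. \<phi> p *\<^sub>R (f p * (Q ^^ n) g p) = \<phi> p *\<^sub>R (f p * (Q ^^ n) h p)"
      using Qae by eventually_elim simp
    have m: "(\<lambda>p. \<phi> p *\<^sub>R (f p * (Q ^^ n) g p)) \<in> borel_measurable circle_measure"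
      "(\<lambda>p. \<phi> p *\<^sub>R (f p * (Q ^^ n) h p)) \<in> borel_measurable circle_measure"
      "(\<lambda>p. \<phi> p *\<^sub>R g p) \<in> borel_measurable circle_measure" "(\<lambda>p. \<phi> p *\<^sub>R h p) \<in> borel_measurable circle_measure"
      using fQm gm h by measurable
    have intg: "integrable \<mu> (\<lambda>p. f p * (Q ^^ n) g p)"
      unfolding \<mu>_def integral_stationary(2)[OF fQm(1)] using i(1) integrable_cong_AE[OF m(1,2) ae] by blast
    define X where "X = (\<integral>p. f p * (Q ^^ n) g p \<partial>\<mu>) - (\<integral>p. f p \<partial>\<mu>) * (\<integral>p. g p \<partial>\<mu>)"
    have X: "X = mean (\<lambda>p. \<phi> p *\<^sub>R (f p * (Q ^^ n) h p))
        - mean (\<lambda>p. \<phi> p *\<^sub>R f p) * mean (\<lambda>p. \<phi> p *\<^sub>R h p)"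
    proof -
      have "mean (\<lambda>p. \<phi> p *\<^sub>R g p) = mean (\<lambda>p. \<phi> p *\<^sub>R h p)"
        by (rule integral_cong_AE[OF m(3,4)]) (use gh in \<open>eventually_elim, simp\<close>)
      then show ?thesis
        unfolding X_def \<mu>_def integral_stationary(1)[OF fQm(1)] integral_stationary(1)[OF f] integral_stationary(1)[OF gm]
          integral_cong_AE[OF m(1,2) ae] by simp
    qed
    define S where "S v w = mean (\<lambda>p. \<phi> p * (v p * (Q ^^ n) w p))
        - mean (\<lambda>p. \<phi> p * v p) * mean (\<lambda>p. \<phi> p * w p)" for v w :: "circle \<Rightarrow> real"
    define e where "e = C' * H * b * \<theta> powr (\<alpha> * real n)"
    let ?f1 = "\<lambda>p. Re (f p)" and ?f2 = "\<lambda>p. Im (f p)" and ?h1 = "\<lambda>p. Re (h p)" and ?h2 = "\<lambda>p. Im (h p)"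
    note QRI = Q_iterate_Re_Im[OF h hb, of n]
    have parts: "?f1 \<in> borel_measurable borel" "?f2 \<in> borel_measurable borel" "?h1 \<in> borel_measurable borel" "?h2 \<in> borel_measurable borel"
      using f h by measurable
    have fb: "\<bar>?f1 p\<bar> \<le> H" "\<bar>?f2 p\<bar> \<le> H" "\<bar>?h1 p\<bar> \<le> b" "\<bar>?h2 p\<bar> \<le> b" for p
      using fH(1)[of p] hb[of p] abs_Re_le_cmod[of "f p"] abs_Im_le_cmod[of "f p"] abs_Re_le_cmod[of "h p"] abs_Im_le_cmod[of "h p"]
      by linarith+
    have f\<alpha>: "\<bar>?f1 p - ?f1 q\<bar> \<le> H * dist p q powr \<alpha>" "\<bar>?f2 p - ?f2 q\<bar> \<le> H * dist p q powr \<alpha>" for p q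
      using fH(2)[of p q] abs_Re_le_cmod[of "f p - f q"] abs_Im_le_cmod[of "f p - f q"] by simp_all
    have S: "\<bar>S ?f1 ?h1\<bar> \<le> e" "\<bar>S ?f1 ?h2\<bar> \<le> e" "\<bar>S ?f2 ?h1\<bar> \<le> e" "\<bar>S ?f2 ?h2\<bar> \<le> e"
      unfolding S_def e_def by (intro real_decay \<alpha> fb f\<alpha> parts)+
    have int4: "integrable circle_measure (\<lambda>p. \<phi> p * (v p * Qw p))"
      if v: "v \<in> borel_measurable borel" "\<And>p. \<bar>v p\<bar> \<le> H" and w: "Qw \<in> borel_measurable borel" "\<And>p. \<bar>Qw p\<bar> \<le> b" for v Qw :: "circle \<Rightarrow> real"
    proof -
      have "(\<lambda>p. v p * Qw p) \<in> borel_measurable borel" using v(1) w(1) by measurable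
      moreover have "norm (v p * Qw p) \<le> H * b" for p
        unfolding real_norm_def abs_mult by (rule mult_mono[OF v(2) w(2) H0 abs_ge_zero])
      ultimately show ?thesis using integrable_weighted[of "\<lambda>p. v p * Qw p" "H * b"] by simp
    qed
    have Qm: "(\<lambda>p. Re ((Q ^^ n) h p)) \<in> borel_measurable borel" "(\<lambda>p. Im ((Q ^^ n) h p)) \<in> borel_measurable borel"
      using Qh(1) by measurable
    have Qb: "\<bar>Re ((Q ^^ n) h p)\<bar> \<le> b" "\<bar>Im ((Q ^^ n) h p)\<bar> \<le> b" for p
      using Qh(2)[of p] abs_Re_le_cmod[of "(Q ^^ n) h p"] abs_Im_le_cmod[of "(Q ^^ n) h p"] by linarith+
    note i4 = int4[OF parts(1) fb(1) Qm(1) Qb(1)] int4[OF parts(1) fb(1) Qm(2) Qb(2)]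
      int4[OF parts(2) fb(2) Qm(1) Qb(1)] int4[OF parts(2) fb(2) Qm(2) Qb(2)]
    have ReX: "Re X = S ?f1 ?h1 - S ?f2 ?h2"
    proof -
      have "Re (mean (\<lambda>p. \<phi> p *\<^sub>R (f p * (Q ^^ n) h p)))
        = mean (\<lambda>p. \<phi> p * (?f1 p * Re ((Q ^^ n) h p)) - \<phi> p * (?f2 p * Im ((Q ^^ n) h p)))"
        unfolding integral_Re[OF i(1), symmetric] by (simp add: algebra_simps)
      also have "\<dots> = mean (\<lambda>p. \<phi> p * (?f1 p * Re ((Q ^^ n) h p))) - mean (\<lambda>p. \<phi> p * (?f2 p * Im ((Q ^^ n) h p)))"
        by (rule Bochner_Integration.integral_diff[OF i4(1,4)])
      finally show ?thesis
        unfolding X S_def QRI minus_complex.sel times_complex.sel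
          integral_Re[OF i(2), symmetric] integral_Re[OF i(3), symmetric] integral_Im[OF i(2), symmetric] integral_Im[OF i(3), symmetric]
        by (simp add: scaleR_complex.sel)
    qed
    have ImX: "Im X = S ?f1 ?h2 + S ?f2 ?h1"
    proof -
      have "Im (mean (\<lambda>p. \<phi> p *\<^sub>R (f p * (Q ^^ n) h p)))
        = mean (\<lambda>p. \<phi> p * (?f1 p * Im ((Q ^^ n) h p)) + \<phi> p * (?f2 p * Re ((Q ^^ n) h p)))"
        unfolding integral_Im[OF i(1), symmetric] by (simp add: algebra_simps)
      also have "\<dots> = mean (\<lambda>p. \<phi> p * (?f1 p * Im ((Q ^^ n) h p))) + mean (\<lambda>p. \<phi> p * (?f2 p * Re ((Q ^^ n) h p)))"
        by (rule Bochner_Integration.integral_add[OF i4(2,3)])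
      finally show ?thesis
        unfolding X S_def QRI minus_complex.sel times_complex.sel
          integral_Re[OF i(2), symmetric] integral_Re[OF i(3), symmetric] integral_Im[OF i(2), symmetric] integral_Im[OF i(3), symmetric]
        by (simp add: scaleR_complex.sel)
    qed
    have "cmod X \<le> \<bar>Re X\<bar> + \<bar>Im X\<bar>" by (rule cmod_le)
    also have "\<dots> \<le> 4 * e" unfolding ReX ImX using S by linarith
    finally have "cmod X \<le> 4 * C' * H * b * \<theta> powr (\<alpha> * real n)" by (simp add: e_def)
    with intg show "integrable \<mu> (\<lambda>p. f p * (Q ^^ n) g p) \<and>
       cmod ((\<integral>p. f p * (Q ^^ n) g p \<partial>\<mu>) - (\<integral>p. f p \<partial>\<mu>) * (\<integral>p. g p \<partial>\<mu>))
       \<le> 4 * C' * holder_norm \<alpha> f * linf_norm g * \<theta> powr (\<alpha> * real n)"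
      unfolding X_def H_def b_def by blast
  qed
qed

end

theorem theorem4:
  fixes \<eta> :: "'w measure" and T :: "'w \<Rightarrow> circle \<Rightarrow> circle"
    and \<phi> :: "circle \<Rightarrow> real" and \<mu> :: "circle measure"
  assumes "prob_space \<eta>"
    and "\<And>\<omega>. \<omega> \<in> space \<eta> \<Longrightarrow> C2_circle_map (T \<omega>)"
    and "\<And>\<omega> x. \<omega> \<in> space \<eta> \<Longrightarrow> circle_deriv (T \<omega>) x \<noteq> 0"
    and "(\<lambda>(\<omega>, x). T \<omega> x) \<in> \<eta> \<Otimes>\<^sub>M borel \<rightarrow>\<^sub>M borel"
    and "integrable \<eta> (\<lambda>\<omega>. 1 / (min_expansion (T \<omega>))\<^sup>2)"
    and "(\<integral>\<omega>. 1 / (min_expansion (T \<omega>))\<^sup>2 \<partial>\<eta>) < 1"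
    and "integrable \<eta> (\<lambda>\<omega>. (distortion (T \<omega>))\<^sup>2)"
    and "prob_density \<phi>"
    and "\<exists>L. L-lipschitz_on UNIV \<phi>"
    and "\<exists>c>0. \<forall>x. c \<le> \<phi> x"
    and "\<mu> = density circle_measure (\<lambda>x. ennreal (\<phi> x))"
    and "stationary \<eta> T \<mu>"
  shows "\<exists>\<theta>::real. 0 < \<theta> \<and> \<theta> < 1 \<and>
    (\<forall>\<alpha>::real. 0 < \<alpha> \<and> \<alpha> < 1 \<longrightarrow>
      (\<exists>C>0.
        (\<forall>(n::nat) (\<psi>::circle \<Rightarrow> real).
           prob_density \<psi> \<and> holder_on_circle \<alpha> \<psi> \<longrightarrow>
           integrable circle_measure ((annealed_transfer_op \<eta> T ^^ n) \<psi>) \<and>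
           (\<integral>x. \<bar>(annealed_transfer_op \<eta> T ^^ n) \<psi> x - \<phi> x\<bar> \<partial>circle_measure)
             \<le> C * holder_norm \<alpha> \<psi> * \<theta> powr (\<alpha> * real n)) \<and>
        (\<forall>(n::nat) (f::circle \<Rightarrow> complex) (g::circle \<Rightarrow> complex).
           holder_on_circle \<alpha> f \<and> ess_bounded g \<longrightarrow>
           integrable \<mu> (\<lambda>x. f x * (annealed_koopman_op \<eta> T ^^ n) g x) \<and>
           cmod ((\<integral>x. f x * (annealed_koopman_op \<eta> T ^^ n) g x \<partial>\<mu>)
                 - (\<integral>x. f x \<partial>\<mu>) * (\<integral>x. g x \<partial>\<mu>))
             \<le> C * holder_norm \<alpha> f * linf_norm g * \<theta> powr (\<alpha> * real n))))"
proof -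
  interpret prob_space \<eta> by fact
  interpret stationary_random_circle_maps \<eta> T \<phi>
    by unfold_locales (use assms in \<open>auto simp: \<open>\<mu> = density circle_measure (\<lambda>x. ennreal (\<phi> x))\<close>\<close>)
  obtain \<theta> C where \<theta>: "0 < \<theta>" "\<theta> < 1" and C: "0 < C" and decay: "holder_decay \<theta> C"
    by (rule holder_decay_exists)
  obtain C1 where C1: "0 < C1" and densities:
    "\<And>\<alpha> n \<psi>. 0 < \<alpha> \<Longrightarrow> \<alpha> < 1 \<Longrightarrow> prob_density \<psi> \<Longrightarrow> holder_on_circle \<alpha> \<psi> \<Longrightarrow>
       integrable circle_measure ((P ^^ n) \<psi>) \<and>
       mean (\<lambda>p. \<bar>(P ^^ n) \<psi> p - \<phi> p\<bar>) \<le> C1 * holder_norm \<alpha> \<psi> * \<theta> powr (\<alpha> * real n)"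
    using densities_converge[OF decay C] by blast
  obtain C2 where C2: "0 < C2" and correlations:
    "\<And>\<alpha> n f g. 0 < \<alpha> \<Longrightarrow> \<alpha> < 1 \<Longrightarrow> holder_on_circle \<alpha> f \<Longrightarrow> ess_bounded g \<Longrightarrow>
       integrable \<mu> (\<lambda>p. f p * (Q ^^ n) g p) \<and>
       cmod ((\<integral>p. f p * (Q ^^ n) g p \<partial>\<mu>) - (\<integral>p. f p \<partial>\<mu>) * (\<integral>p. g p \<partial>\<mu>))
       \<le> C2 * holder_norm \<alpha> f * linf_norm g * \<theta> powr (\<alpha> * real n)"
    using complex_correlations_decay[OF decay C] unfolding assms(11) by blast
  define D where "D = max C1 C2"
  show ?thesis
  proof (rule exI[of _ \<theta>], intro conjI \<theta> allI impI, rule exI[of _ D], intro conjI allI impI)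
    show "0 < D" using C1 by (simp add: D_def)
  next
    fix \<alpha> :: real and n :: nat and \<psi> :: "circle \<Rightarrow> real"
    assume \<alpha>: "0 < \<alpha> \<and> \<alpha> < 1" and \<psi>: "prob_density \<psi> \<and> holder_on_circle \<alpha> \<psi>"
    show "integrable circle_measure ((P ^^ n) \<psi>)" using densities \<alpha> \<psi> by blast
    have "0 \<le> holder_norm \<alpha> \<psi>"
      using holder_norm_bounds(1)[of \<alpha> \<psi>] \<alpha> \<psi> norm_ge_zero order_trans by blast
    then have "C1 * holder_norm \<alpha> \<psi> * \<theta> powr (\<alpha> * real n) \<le> D * holder_norm \<alpha> \<psi> * \<theta> powr (\<alpha> * real n)"
      by (intro mult_right_mono) (auto simp: D_def)
    then show "mean (\<lambda>x. \<bar>(P ^^ n) \<psi> x - \<phi> x\<bar>) \<le> D * holder_norm \<alpha> \<psi> * \<theta> powr (\<alpha> * real n)"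
      using densities[of \<alpha> \<psi> n] \<alpha> \<psi> by linarith
  next
    fix \<alpha> :: real and n :: nat and f g :: "circle \<Rightarrow> complex"
    assume \<alpha>: "0 < \<alpha> \<and> \<alpha> < 1" and fg: "holder_on_circle \<alpha> f \<and> ess_bounded g"
    show "integrable \<mu> (\<lambda>x. f x * (Q ^^ n) g x)" using correlations \<alpha> fg by blast
    have "0 \<le> holder_norm \<alpha> f"
      using holder_norm_bounds(1)[of \<alpha> f] \<alpha> fg norm_ge_zero order_trans by blast
    moreover have "0 \<le> linf_norm g"
      using ess_bounded_truncation[of g] fg norm_ge_zero order_trans by metis
    ultimately have "C2 * holder_norm \<alpha> f * linf_norm g * \<theta> powr (\<alpha> * real n)
        \<le> D * holder_norm \<alpha> f * linf_norm g * \<theta> powr (\<alpha> * real n)"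
      by (intro mult_right_mono) (auto simp: D_def)
    then show "cmod ((\<integral>x. f x * (Q ^^ n) g x \<partial>\<mu>) - (\<integral>x. f x \<partial>\<mu>) * (\<integral>x. g x \<partial>\<mu>))
        \<le> D * holder_norm \<alpha> f * linf_norm g * \<theta> powr (\<alpha> * real n)"
      using correlations[of \<alpha> f g n] \<alpha> fg by linarith
  qed
qed

end
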